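(* Let $n\ge 4$ and let $d_1\le d_2\le\cdots\le d_n$ be positive integers. Let $I=(f_1,\dots,f_n)$ be a generic homogeneous ideal of type $(n;d_1,\dots,d_n)$ in $K[x_1,\dots,x_n]$. For $1\le i\le n$ put $\delta_i=d_1+\cdots+d_i-i$, and for $2\le i\le n$ put $\sigma_i=\min\{\delta_{i-1},\lfloor \delta_i/2\rfloor\}$. If $d_i\ge\sigma_{i-1}$ for all $4\le i\le n$, then Pardue's conjecture holds for $I$: whenever $x^\mu$ is a minimal generator of $\operatorname{in}(I)$ with $\max(x^\mu)=m$ and $\deg(x^\mu)=d$, every monomial of degree $d$ in the variables $x_1,\dots,x_{m-1}$ belongs to $\operatorname{in}(I)$.
   Context: $K$ is an infinite field that is an extension of a base field $F$. A form of degree $d$ in $K[x_1,\dots,x_n]$ is generic over $F$ if it is a linear combination of all monomials of degree $d$ with coefficients algebraically independent over $F$. A homogeneous ideal $(f_1,\dots,f_r)$ is a generic homogeneous ideal of type $(n;d_1,\dots,d_r)$ if $f_1,\dots,f_r\in K[x_1,\dots,x_n]$ are generic forms of degrees $d_1,\dots,d_r$ such that all the coefficients of all the $f_i$ taken together are algebraically independent over $F$. Initial ideals $\operatorname{in}(\cdot)$ are taken with respect to the degree reverse lexicographic order with $x_1>\cdots>x_n$; minimal generators of $\operatorname{in}(I)$ are its minimal monomial generators. For a monomial $x^\alpha$, $\max(x^\alpha)$ is the largest index $i$ such that $x_i$ divides $x^\alpha$. *)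

theory Defs
  imports "HOL-Library.Poly_Mapping" "HOL-Algebra.Algebraic_Closure_Type"
begin

text \<open>
  An exponent vector is a finitely supported map from variable indices to exponents, and a polynomial
  is a finitely supported map from exponent vectors to coefficients. The multiplication on
  polynomials is the convolution product from \<^theory>\<open>HOL-Library.Poly_Mapping\<close>.
  The variables of \<open>K[x\<^sub>1, \<dots>, x\<^sub>n]\<close> are indexed by \<open>{1..n}\<close>.
\<close>

type_synonym expo = "nat \<Rightarrow>\<^sub>0 nat"
type_synonym 'a mpoly = "expo \<Rightarrow>\<^sub>0 'a"

abbreviation xmonom :: "expo \<Rightarrow> 'a::comm_ring_1 mpoly"
  where "xmonom \<mu> \<equiv> Poly_Mapping.single \<mu> 1"

definition mdeg :: "expo \<Rightarrow> nat"
  where "mdeg \<mu> = (\<Sum>i\<in>Poly_Mapping.keys \<mu>. Poly_Mapping.lookup \<mu> i)"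

definition mpoly_ring :: "nat \<Rightarrow> 'a::comm_ring_1 mpoly ring"
  where "mpoly_ring n = ring_of_type_algebra
    \<lparr>carrier := {p. \<forall>\<mu>\<in>Poly_Mapping.keys p. Poly_Mapping.keys \<mu> \<subseteq> {1..n}}\<rparr>"

text \<open>The monomials of degree \<open>d\<close> in the variables with index in \<open>V\<close>.\<close>

definition monomials :: "nat set \<Rightarrow> nat \<Rightarrow> expo set"
  where "monomials V d = {\<mu>. Poly_Mapping.keys \<mu> \<subseteq> V \<and> mdeg \<mu> = d}"


subsection \<open>Algebraic independence and generic ideals\<close>

definition mpoly_eval :: "('i \<Rightarrow> 'a::comm_ring_1) \<Rightarrow> (('i \<Rightarrow>\<^sub>0 nat) \<Rightarrow>\<^sub>0 'a) \<Rightarrow> 'a"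
  where "mpoly_eval c p = (\<Sum>m\<in>Poly_Mapping.keys p. Poly_Mapping.lookup p m *
    (\<Prod>i\<in>Poly_Mapping.keys m. c i ^ Poly_Mapping.lookup m i))"

text \<open>Independence of the family \<open>c\<close> indexed by \<open>A\<close>, so \<open>c\<close> is in particular injective on \<open>A\<close>.\<close>

definition alg_indep :: "'a::field set \<Rightarrow> 'i set \<Rightarrow> ('i \<Rightarrow> 'a) \<Rightarrow> bool"
  where "alg_indep F A c \<longleftrightarrow>
    (\<forall>p. (\<forall>m. Poly_Mapping.lookup p m \<in> F) \<longrightarrow>
         (\<forall>m\<in>Poly_Mapping.keys p. Poly_Mapping.keys m \<subseteq> A) \<longrightarrow>
         mpoly_eval c p = 0 \<longrightarrow> p = 0)"

definition generic_form :: "'a::field set \<Rightarrow> nat \<Rightarrow> nat \<Rightarrow> 'a mpoly \<Rightarrow> bool"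
  where "generic_form F n d f \<longleftrightarrow>
    Poly_Mapping.keys f \<subseteq> monomials {1..n} d \<and>
    alg_indep F (monomials {1..n} d) (Poly_Mapping.lookup f)"

text \<open>Generic homogeneous ideals of type \<open>(n; d\<^sub>1, \<dots>, d\<^sub>r)\<close>.\<close>

definition generic_ideal :: "'a::field set \<Rightarrow> nat \<Rightarrow> nat \<Rightarrow> (nat \<Rightarrow> nat) \<Rightarrow> 'a mpoly set \<Rightarrow> bool"
  where "generic_ideal F n r d I \<longleftrightarrow>
    (\<exists>f. (\<forall>i\<in>{1..r}. generic_form F n (d i) (f i)) \<and>
         alg_indep F (SIGMA i:{1..r}. monomials {1..n} (d i))
           (\<lambda>(i, \<mu>). Poly_Mapping.lookup (f i) \<mu>) \<and>
         I = Idl\<^bsub>mpoly_ring n\<^esub> (f ` {1..r}))"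


subsection \<open>Initial ideals\<close>

text \<open>The degree reverse lexicographic order with \<open>x\<^sub>1 > x\<^sub>2 > \<dots>\<close>.\<close>

definition drl_less :: "expo \<Rightarrow> expo \<Rightarrow> bool"
  where "drl_less \<alpha> \<beta> \<longleftrightarrow> mdeg \<alpha> < mdeg \<beta> \<or>
    mdeg \<alpha> = mdeg \<beta> \<and>
    (\<exists>i. Poly_Mapping.lookup \<alpha> i > Poly_Mapping.lookup \<beta> i \<and>
         (\<forall>j>i. Poly_Mapping.lookup \<alpha> j = Poly_Mapping.lookup \<beta> j))"

text \<open>Meaningful for nonzero polynomials only.\<close>

definition lead_expo :: "'a::zero mpoly \<Rightarrow> expo"
  where "lead_expo p = (THE \<mu>. \<mu> \<in> Poly_Mapping.keys p \<and>
    (\<forall>\<nu>\<in>Poly_Mapping.keys p. \<nu> \<noteq> \<mu> \<longrightarrow> drl_less \<nu> \<mu>))"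

definition initial_ideal :: "nat \<Rightarrow> 'a::field mpoly set \<Rightarrow> 'a mpoly set"
  where "initial_ideal n I = Idl\<^bsub>mpoly_ring n\<^esub> {xmonom (lead_expo p) | p. p \<in> I \<and> p \<noteq> 0}"

text \<open>
  The minimal monomial generators of a monomial ideal \<open>J\<close>: the monomials in \<open>J\<close> that are minimal
  with respect to divisibility. The order that \<^theory>\<open>HOL-Library.Poly_Mapping\<close> puts on exponent
  vectors is lexicographic, so divisibility is spelled out pointwise.
\<close>

definition min_generator :: "'a::field mpoly set \<Rightarrow> expo \<Rightarrow> bool"
  where "min_generator J \<mu> \<longleftrightarrow> xmonom \<mu> \<in> J \<and>
    (\<forall>\<nu>. xmonom \<nu> \<in> J \<longrightarrow>
      (\<forall>i. Poly_Mapping.lookup \<nu> i \<le> Poly_Mapping.lookup \<mu> i) \<longrightarrow> \<nu> = \<mu>)"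


subsection \<open>The numbers \<open>\<delta>\<^sub>i\<close> and \<open>\<sigma>\<^sub>i\<close>\<close>

definition delta :: "(nat \<Rightarrow> nat) \<Rightarrow> nat \<Rightarrow> int"
  where "delta d i = (\<Sum>j=1..i. int (d j)) - int i"

definition sigma :: "(nat \<Rightarrow> nat) \<Rightarrow> nat \<Rightarrow> int"
  where "sigma d i = min (delta d (i - 1)) (delta d i div 2)"

end

theory Submission
  imports Defs "Jordan_Normal_Form.Determinant"
begin

text \<open>
  Let \<open>A\<^sub>m\<close> be the quotient of \<open>K[x\<^sub>1, \<dots>, x\<^sub>m]\<close> by the images of all \<open>n\<close> forms. By the properties of
  the reverse lexicographic order, a minimal generator of degree \<open>e\<close> whose largest variable is \<open>x\<^sub>m\<close>
  shows that \<open>x\<^sub>m\<close> is not injective on \<open>A\<^sub>m\<close> from degree \<open>e - 1\<close> to degree \<open>e\<close>, and the conclusion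
  says that it is surjective there. So it is enough that multiplication by \<open>x\<^sub>m\<close> on \<open>A\<^sub>m\<close> has maximal
  rank in every degree.

  The assumption \<open>d\<^sub>m\<^sub>+\<^sub>1 \<ge> \<sigma>\<^sub>m\<close> means that the forms after the \<open>m\<close>-th one can only matter in degree
  \<open>\<sigma>\<^sub>m\<close>, where they are generic elements of the cokernel of \<open>x\<^sub>m\<close>. This leaves the complete
  intersection of \<open>f\<^sub>1, \<dots>, f\<^sub>m\<close>. Put \<open>r = m - 1\<close>. Modulo \<open>x\<^sub>m\<close>, maximal rank of \<open>x\<^sub>m\<close> becomes maximal
  rank of multiplication by \<open>f\<^sub>m\<close> on \<open>K[x\<^sub>1, \<dots>, x\<^sub>r]/(f\<^sub>1, \<dots>, f\<^sub>r)\<close>.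

  Linear independence is an open condition, so this may be checked on one special choice of forms with
  coefficients in \<open>K\<close>. Let \<open>f\<^sub>1, \<dots>, f\<^bsub>r-1\<^esub>\<close> cut out a grid of points in the chart \<open>x\<^sub>r = 1\<close>, let
  \<open>f\<^sub>m\<close> be a power of \<open>x\<^sub>r\<close>, and let \<open>f\<^sub>r\<close> vanish exactly at the grid points of low total degree. Then
  \<open>u f\<^sub>r + v f\<^sub>m = 0\<close> on the grid makes \<open>v\<close> vanish on a lower set and \<open>u\<close> on the complementary upper set,
  and Newton interpolation gives \<open>u = v = 0\<close>. The argument works in every characteristic. The degree
  assumptions enter through their consequence \<open>d\<^sub>r + d\<^sub>m \<ge> \<delta>\<^bsub>r-1\<^esub>\<close>.
\<close>


text \<open>The familiar special choice, powers of the variables and a power of x_1 + ... + x_r, has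
  maximal rank by Lefschetz properties that can fail in positive characteristic. A grid only asks
  for enough distinct coordinates, which any infinite field has. Write D for \<delta>_{r-1}, the
  largest total degree of a grid index. In degree e the cofactors of f_m and f_r have degrees e -
  d_m and e - d_r, so they are determined by their values on index degrees below b = e - d_m + 1 and
  below c = e - d_r + 1. Reversing the grid exchanges the degrees t and D - t, so the second set can
  be moved off the first when b + c \<le> D + 1, that is 2e + 1 \<le> D + d_r + d_m. The degrees
  with 2e \<le> \<delta>_m and e \<le> \<delta>_{m-1} are those up to \<sigma>_m, whence \<sigma>.
  The bound D \<le> d_r + d_m acts twice: below the threshold it gives b \<le> d_r, so that a form
  of degree d_r can vanish on all indices of degree below b, and above the threshold it gives D
  \<le> e. Only independence is ever specialized. Surjectivity comes from counting independent
  products.\<close>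

abbreviation lk where "lk \<equiv> Poly_Mapping.lookup"
abbreviation ks where "ks \<equiv> Poly_Mapping.keys"
abbreviation sg where "sg \<equiv> Poly_Mapping.single"

subsection \<open>Polynomials\<close>

lemma poly_mapping_expand:
  fixes p :: "'i \<Rightarrow>\<^sub>0 'a::comm_monoid_add"
  shows "p = (\<Sum>k\<in>ks p. sg k (lk p k))"
  by (rule poly_mapping_eqI) (auto simp: lookup_sum lookup_single when_def in_keys_iff)

lemma poly_mapping_add_induct [case_names single add zero]:
  fixes p :: "'i \<Rightarrow>\<^sub>0 'a::comm_monoid_add"
  assumes "\<And>k v. P (sg k v)" "\<And>p q. P p \<Longrightarrow> P q \<Longrightarrow> P (p + q)" "P 0"
  shows "P p"
proof -
  have "finite S \<Longrightarrow> P (\<Sum>k\<in>S. sg k (lk p k))" for S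
    by (induction S rule: finite_induct) (auto intro: assms)
  then show ?thesis
    by (subst poly_mapping_expand) simp
qed

lemma lookup_monom_mult:
  fixes p :: "('i::cancel_comm_monoid_add) \<Rightarrow>\<^sub>0 'a::comm_ring_1"
  shows "lk (sg \<alpha> a * p) (\<alpha> + \<nu>) = a * lk p \<nu>"
proof (induction p rule: poly_mapping_add_induct)
  case (single k v)
  then show ?case by (auto simp: mult_single lookup_single when_def)
qed (auto simp: distrib_left lookup_add)

lemma keys_monom_mult: "ks (sg \<alpha> a * p) \<subseteq> (+) \<alpha> ` ks p"
proof -
  have "ks (sg \<alpha> a * p) \<subseteq> {x + y | x y. x \<in> ks (sg \<alpha> a) \<and> y \<in> ks p}"
    by (rule keys_mult)
  then show ?thesis
    by (cases "a = 0") auto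
qed

lemma lookup_monom_mult_eq_0:
  "(\<And>\<kappa>. \<nu> \<noteq> \<alpha> + \<kappa>) \<Longrightarrow> lk (sg \<alpha> a * p) \<nu> = 0"
  using keys_monom_mult[of \<alpha> a p] by (metis imageE in_keys_iff subsetD)

lemma keys_add_nat: "ks (a + b :: 'i \<Rightarrow>\<^sub>0 nat) = ks a \<union> ks b"
  by (auto simp: in_keys_iff lookup_add)

lemma mdeg_superset: "finite S \<Longrightarrow> ks \<mu> \<subseteq> S \<Longrightarrow> mdeg \<mu> = (\<Sum>i\<in>S. lk \<mu> i)"
  unfolding mdeg_def by (rule sum.mono_neutral_left) (auto simp: in_keys_iff)

lemma mdeg_add [simp]: "mdeg (a + b) = mdeg a + mdeg b"
  using mdeg_superset[of "ks a \<union> ks b" a] mdeg_superset[of "ks a \<union> ks b" b]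
    mdeg_superset[of "ks a \<union> ks b" "a + b"]
  by (simp add: keys_add_nat lookup_add sum.distrib)

lemma mdeg_single [simp]: "mdeg (sg i k) = k"
  by (simp add: mdeg_def)

lemma mdeg_zero [simp]: "mdeg 0 = 0"
  by (simp add: mdeg_def)

lemma mdeg_eq_0: "mdeg a = 0 \<Longrightarrow> a = 0"
  by (rule poly_mapping_eqI) (metis mdeg_def finite_keys in_keys_iff lookup_zero sum_eq_0_iff)

lemma lookup_le_mdeg: "lk a i \<le> mdeg a"
  by (cases "i \<in> ks a") (auto simp: mdeg_def in_keys_iff intro: member_le_sum)

lemma finite_monomials [simp]: "finite V \<Longrightarrow> finite (monomials V d)"
proof -
  assume V: "finite V"
  let ?Fs = "{f. \<forall>x. (x \<in> V \<longrightarrow> f x \<in> {..d}) \<and> (x \<notin> V \<longrightarrow> f x = (0::nat))}"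
  have "finite ?Fs"
    by (rule finite_set_of_finite_funs) (use V in auto)
  moreover have "lk ` monomials V d \<subseteq> ?Fs"
  proof (intro image_subsetI CollectI allI conjI impI)
    fix a x assume a: "a \<in> monomials V d"
    show "lk a x \<in> {..d}" using a lookup_le_mdeg[of a x] by (simp add: monomials_def)
    assume "x \<notin> V"
    then have "x \<notin> ks a" using a by (auto simp: monomials_def)
    then show "lk a x = 0" by (simp add: in_keys_iff)
  qed
  ultimately have "finite (lk ` monomials V d)"
    by (rule rev_finite_subset)
  moreover have "inj_on lk (monomials V d)"
    by (rule inj_onI) (simp only: poly_mapping_eq_iff)
  ultimately show ?thesis by (rule finite_imageD)
qed

lemma monomials_add: "a \<in> monomials V d \<Longrightarrow> b \<in> monomials V e \<Longrightarrow> a + b \<in> monomials V (d + e)"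
  by (auto simp: monomials_def keys_add_nat)

lemma expo_diff:
  assumes "\<And>i. lk b i \<le> lk (a :: 'i \<Rightarrow>\<^sub>0 nat) i"
  shows "b + (a - b) = a" "lk (a - b) i = lk a i - lk b i"
  using assms by (auto intro!: poly_mapping_eqI simp: lookup_add lookup_minus)

lemma keys_homogeneous_mult:
  assumes "ks p \<subseteq> monomials V d" "ks q \<subseteq> monomials V e"
  shows "ks (p * q) \<subseteq> monomials V (d + e)"
  using keys_mult[of p q] assms monomials_add[of _ V d _ e] by blast

section \<open>Evaluation as a ring homomorphism\<close>

definition mono_eval :: "('i \<Rightarrow> 'a::comm_ring_1) \<Rightarrow> ('i \<Rightarrow>\<^sub>0 nat) \<Rightarrow> 'a"
  where "mono_eval c m = (\<Prod>i\<in>ks m. c i ^ lk m i)"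

lemma mono_eval_superset:
  "finite S \<Longrightarrow> ks m \<subseteq> S \<Longrightarrow> mono_eval c m = (\<Prod>i\<in>S. c i ^ lk m i)"
  unfolding mono_eval_def by (rule prod.mono_neutral_left) (auto simp: in_keys_iff)

lemma mono_eval_add: "mono_eval c (a + b) = mono_eval c a * mono_eval c b"
  using mono_eval_superset[of "ks a \<union> ks b" a c] mono_eval_superset[of "ks a \<union> ks b" b c]
    mono_eval_superset[of "ks a \<union> ks b" "a + b" c]
  by (simp add: keys_add_nat lookup_add prod.distrib power_add)

lemma mono_eval_single [simp]: "mono_eval c (sg i k) = c i ^ k"
  by (simp add: mono_eval_def)

lemma mpoly_eval_add: "mpoly_eval c (p + q) = mpoly_eval c p + mpoly_eval c q"
  unfolding mpoly_eval_def by (rule setsum_keys_plus_distrib) (auto simp: algebra_simps)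

lemma mpoly_eval_single: "mpoly_eval c (sg m v) = v * mono_eval c m"
  by (simp add: mpoly_eval_def mono_eval_def)

lemma mpoly_eval_0 [simp]: "mpoly_eval c 0 = 0"
  by (simp add: mpoly_eval_def)

lemma mpoly_eval_1 [simp]: "mpoly_eval c 1 = 1"
  by (simp add: mpoly_eval_def)

lemma mpoly_eval_mult: "mpoly_eval c (p * q) = mpoly_eval c p * mpoly_eval c q"
proof (induction p rule: poly_mapping_add_induct)
  case (single k v)
  show ?case
  proof (induction q rule: poly_mapping_add_induct)
    case (single k' v')
    then show ?case
      by (simp add: mult_single mpoly_eval_single mono_eval_add algebra_simps)
  qed (auto simp: distrib_left mpoly_eval_add)
qed (auto simp: distrib_right mpoly_eval_add)

lemma comm_ring_hom_mpoly_eval: "comm_ring_hom (mpoly_eval c)"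
  by unfold_locales (auto simp: mpoly_eval_add mpoly_eval_mult)

lemma mpoly_eval_sum: "mpoly_eval c (sum f S) = (\<Sum>x\<in>S. mpoly_eval c (f x))"
  by (induction S rule: infinite_finite_induct) (auto simp: mpoly_eval_add)

lemma mpoly_eval_prod: "mpoly_eval c (prod f S) = (\<Prod>x\<in>S. mpoly_eval c (f x))"
  by (induction S rule: infinite_finite_induct) (auto simp: mpoly_eval_mult)

subsection \<open>Linear algebra\<close>

definition scl :: "'a::comm_ring_1 \<Rightarrow> 'a mpoly \<Rightarrow> 'a mpoly"
  where "scl a p = sg 0 a * p"

lemma lookup_scl [simp]: "lk (scl a p) \<nu> = a * lk p \<nu>"
  using lookup_monom_mult[of 0 a p \<nu>] by (simp add: scl_def)

interpretation vs: vector_space "scl :: 'k::field \<Rightarrow> 'k mpoly \<Rightarrow> 'k mpoly"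
  by unfold_locales
    (auto intro!: poly_mapping_eqI simp: lookup_add algebra_simps)

lemma scl_mult: "scl a (p * q) = scl a p * q" "scl a (p * q) = p * scl a q"
  by (auto simp: scl_def algebra_simps)

lemma mpoly_eval_scl: "mpoly_eval c (scl a p) = a * mpoly_eval c p"
  by (simp add: scl_def mpoly_eval_mult mpoly_eval_single mono_eval_def)

text \<open>A property of the indexed family, not of its image: two indices with the same vector
  already are a dependency. This lets sizes of index sets be compared with dimensions.\<close>

definition indep :: "'t set \<Rightarrow> ('t \<Rightarrow> 'k::field mpoly) \<Rightarrow> bool"
  where "indep T w \<longleftrightarrow> (\<forall>q. (\<Sum>t\<in>T. scl (q t) (w t)) = 0 \<longrightarrow> (\<forall>t\<in>T. q t = 0))"

lemma indepD: "indep T w \<Longrightarrow> (\<Sum>t\<in>T. scl (q t) (w t)) = 0 \<Longrightarrow> t \<in> T \<Longrightarrow> q t = 0"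
  by (auto simp: indep_def)

lemma span_image_eq:
  fixes w :: "'t \<Rightarrow> 'k::field mpoly"
  assumes "finite T"
  shows "vs.span (w ` T) = range (\<lambda>q. \<Sum>t\<in>T. scl (q t) (w t))" (is "_ = ?R")
proof
  show "?R \<subseteq> vs.span (w ` T)"
    by (intro image_subsetI vs.span_sum vs.span_scale vs.span_base imageI)
  have "vs.subspace ?R"
  proof (rule vs.subspaceI)
    show "0 \<in> ?R" by (rule range_eqI[of _ _ "\<lambda>_. 0"]) simp
  next
    fix x y assume "x \<in> ?R" "y \<in> ?R"
    then obtain q q' where "x = (\<Sum>t\<in>T. scl (q t) (w t))" "y = (\<Sum>t\<in>T. scl (q' t) (w t))"
      by auto
    then show "x + y \<in> ?R"
      by (intro range_eqI[of _ _ "\<lambda>t. q t + q' t"]) (simp add: vs.scale_left_distrib sum.distrib)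
  next
    fix c x assume "x \<in> ?R"
    then obtain q where "x = (\<Sum>t\<in>T. scl (q t) (w t))" by auto
    then show "scl c x \<in> ?R"
      by (intro range_eqI[of _ _ "\<lambda>t. c * q t"]) (simp add: vs.scale_sum_right)
  qed
  moreover have "w ` T \<subseteq> ?R"
  proof
    fix x assume "x \<in> w ` T"
    then obtain s where s: "s \<in> T" "x = w s" by auto
    have "x = (\<Sum>t\<in>T. scl (if t = s then 1 else 0) (w t))"
      using s assms by (subst sum.mono_neutral_right[of T "{s}"]) auto
    then show "x \<in> ?R"
      by (rule range_eqI[of _ _ "\<lambda>t. if t = s then 1 else 0"])
  qed
  ultimately show "vs.span (w ` T) \<subseteq> ?R" by (rule vs.span_minimal[rotated])
qed

lemma indep_imp_independent:
  assumes "finite T" "indep T w"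
  shows "inj_on w T" "vs.independent (w ` T)"
proof -
  show inj: "inj_on w T"
  proof (rule inj_onI, rule ccontr)
    fix s t assume st: "s \<in> T" "t \<in> T" "w s = w t" "s \<noteq> t"
    let ?q = "\<lambda>u. if u = s then 1 else if u = t then -1 else 0"
    have "(\<Sum>u\<in>T. scl (?q u) (w u)) = (\<Sum>u\<in>{s,t}. scl (?q u) (w u))"
      using st assms by (intro sum.mono_neutral_right) auto
    also have "\<dots> = 0" using st by (simp add: vs.scale_minus_left)
    finally show False using indepD[OF assms(2), of ?q s] st by simp
  qed
  show "vs.independent (w ` T)"
  proof (rule vs.independent_if_scalars_zero)
    fix f x assume f: "(\<Sum>x\<in>w ` T. scl (f x) x) = 0" and x: "x \<in> w ` T"
    then have "(\<Sum>t\<in>T. scl (f (w t)) (w t)) = 0" by (simp add: sum.reindex[OF inj])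
    then show "f x = 0" using indepD[OF assms(2), of "\<lambda>t. f (w t)"] x by auto
  qed (use assms in simp)
qed

text \<open>A dimension count. It turns independence, which passes from special to generic forms,
  into a spanning statement.\<close>

lemma indep_card_spans:
  fixes w :: "'t \<Rightarrow> 'k::field mpoly"
  assumes "finite T" "indep T w" "finite M" "w ` T \<subseteq> vs.span M" "card M \<le> card T"
  shows "vs.span M \<subseteq> vs.span (w ` T)"
proof -
  note i = indep_imp_independent[OF assms(1,2)]
  have c: "card (w ` T) = card T" by (rule card_image[OF i(1)])
  have "vs.dim M \<le> card M" by (rule vs.dim_le_card) (auto simp: assms vs.span_superset)
  have "M \<subseteq> vs.span (w ` T)"
  proof (rule ccontr)
    assume "\<not> ?thesis"
    then obtain m where m: "m \<in> M" "m \<notin> vs.span (w ` T)" by auto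
    then have "vs.independent (insert m (w ` T))" by (intro vs.independent_insertI i)
    moreover have "insert m (w ` T) \<subseteq> vs.span M" using m assms by (auto intro: vs.span_base)
    ultimately have "card (insert m (w ` T)) \<le> card M"
      using vs.independent_span_bound[OF assms(3)] by blast
    moreover have "m \<notin> w ` T" using m vs.span_base by blast
    ultimately show False using c assms by simp
  qed
  then show ?thesis by (simp add: vs.span_minimal)
qed

lemma indep_mono: "indep T w \<Longrightarrow> S \<subseteq> T \<Longrightarrow> finite T \<Longrightarrow> indep S w"
  unfolding indep_def
proof (intro allI impI ballI)
  fix q s assume T: "\<forall>q. (\<Sum>t\<in>T. scl (q t) (w t)) = 0 \<longrightarrow> (\<forall>t\<in>T. q t = 0)"
    and *: "S \<subseteq> T" "finite T" "(\<Sum>t\<in>S. scl (q t) (w t)) = 0" "s \<in> S"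
  have "(\<Sum>t\<in>T. scl (if t \<in> S then q t else 0) (w t)) = (\<Sum>t\<in>S. scl (q t) (w t))"
    using * by (intro sum.mono_neutral_cong_right) auto
  then show "q s = 0" using T[rule_format, of "\<lambda>t. if t \<in> S then q t else 0" s] * by auto
qed

lemma indep_cong: "(\<And>t. t \<in> T \<Longrightarrow> w t = w' t) \<Longrightarrow> indep T w = indep T w'"
  by (simp add: indep_def)

lemma indep_insert:
  assumes "finite T" "s \<notin> T"
  shows "indep (insert s T) w \<longleftrightarrow> indep T w \<and> w s \<notin> vs.span (w ` T)"
proof
  assume L: "indep (insert s T) w"
  then have "indep T w" by (rule indep_mono) (use assms in auto)
  moreover have "w s \<notin> vs.span (w ` T)"
  proof
    assume "w s \<in> vs.span (w ` T)"
    then obtain q where q: "w s = (\<Sum>t\<in>T. scl (q t) (w t))"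
      by (auto simp: span_image_eq[OF assms(1)])
    let ?q = "\<lambda>t. if t = s then - 1 else q t"
    have "(\<Sum>t\<in>T. scl (?q t) (w t)) = w s"
      unfolding q using assms by (intro sum.cong) auto
    then have "(\<Sum>t\<in>insert s T. scl (?q t) (w t)) = 0"
      using assms by (simp add: vs.scale_minus_left)
    from indepD[OF L this, of s] show False by simp
  qed
  ultimately show "indep T w \<and> w s \<notin> vs.span (w ` T)" ..
next
  assume R: "indep T w \<and> w s \<notin> vs.span (w ` T)"
  show "indep (insert s T) w"
    unfolding indep_def
  proof (intro allI impI)
    fix q assume q: "(\<Sum>t\<in>insert s T. scl (q t) (w t)) = 0"
    then have e: "scl (q s) (w s) + (\<Sum>t\<in>T. scl (q t) (w t)) = 0" using assms by simp
    have "q s = 0"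
    proof (rule ccontr)
      assume nz: "q s \<noteq> 0"
      have "scl (q s) (w s) = - (\<Sum>t\<in>T. scl (q t) (w t))"
        using e by (simp add: eq_neg_iff_add_eq_0)
      also have "\<dots> \<in> vs.span (w ` T)"
        by (intro vs.span_neg vs.span_sum vs.span_scale vs.span_base) auto
      finally have "scl (inverse (q s)) (scl (q s) (w s)) \<in> vs.span (w ` T)"
        by (rule vs.span_scale)
      then show False using nz R by simp
    qed
    then show "\<forall>t\<in>insert s T. q t = 0"
      using e R by (auto simp: indep_def)
  qed
qed

lemma indep_extend_spanning:
  fixes w :: "'t \<Rightarrow> 'k::field mpoly"
  assumes "finite T" "S \<subseteq> T" "indep S w"
  obtains U where "S \<subseteq> U" "U \<subseteq> T" "indep U w" "vs.span (w ` U) = vs.span (w ` T)"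
proof -
  have "\<exists>U. S \<subseteq> U \<and> U \<subseteq> T \<and> indep U w \<and> vs.span (w ` U) = vs.span (w ` T)"
    using assms
  proof (induction "card (T - S)" arbitrary: S rule: less_induct)
    case less
    show ?case
    proof (cases "w ` T \<subseteq> vs.span (w ` S)")
      case True
      then have "vs.span (w ` T) \<subseteq> vs.span (w ` S)" by (simp add: vs.span_minimal)
      moreover have "vs.span (w ` S) \<subseteq> vs.span (w ` T)"
        by (rule vs.span_mono) (use less in auto)
      ultimately show ?thesis using less by blast
    next
      case False
      then obtain t where t: "t \<in> T" "w t \<notin> vs.span (w ` S)" by auto
      then have tS: "t \<notin> S" using vs.span_base by blast
      have fS: "finite S" using less finite_subset by blast
      have "card (T - insert t S) < card (T - S)"
        by (rule psubset_card_mono) (use t tS less in auto)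
      moreover have "indep (insert t S) w"
        using indep_insert[OF fS tS, of w] t less by simp
      ultimately obtain U where "insert t S \<subseteq> U \<and> U \<subseteq> T \<and> indep U w \<and> vs.span (w ` U) = vs.span (w ` T)"
        using less(1)[of "insert t S"] less t by auto
      then show ?thesis by blast
    qed
  qed
  then show ?thesis using that by blast
qed

subsection \<open>Specialization\<close>

text \<open>The square matrix with entries \<open>lk (w t) (\<nu> s)\<close> is invertible.
  Surjectivity is carried along because the induction needs it: it supplies the combination of the
  old vectors that agrees with the new one at all exponents chosen so far.\<close>

lemma nonsingular_minor:
  fixes w :: "'t \<Rightarrow> 'k::field mpoly"
  assumes "finite T" "indep T w"
  shows "\<exists>\<nu>. (\<forall>q. (\<forall>s\<in>T. (\<Sum>t\<in>T. q t * lk (w t) (\<nu> s)) = 0) \<longrightarrow> (\<forall>t\<in>T. q t = 0)) \<and>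
             (\<forall>y. \<exists>q. \<forall>s\<in>T. (\<Sum>t\<in>T. q t * lk (w t) (\<nu> s)) = y s)"
  using assms
proof (induction T rule: finite_induct)
  case empty
  show ?case by simp
next
  case (insert t0 T)
  then have ind: "indep T w" "w t0 \<notin> vs.span (w ` T)"
    using indep_insert[of T t0 w] by auto
  obtain \<nu> where
    inj: "\<And>q t. (\<forall>s\<in>T. (\<Sum>t\<in>T. q t * lk (w t) (\<nu> s)) = 0) \<Longrightarrow> t \<in> T \<Longrightarrow> q t = 0" and
    surj: "\<And>y. \<exists>q. \<forall>s\<in>T. (\<Sum>t\<in>T. q t * lk (w t) (\<nu> s)) = y s"
    using insert.IH[OF ind(1)] by blast
  obtain q where q: "\<And>s. s \<in> T \<Longrightarrow> (\<Sum>t\<in>T. q t * lk (w t) (\<nu> s)) = lk (w t0) (\<nu> s)"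
    using surj[of "\<lambda>s. lk (w t0) (\<nu> s)"] by auto
  \<comment> \<open>This difference vanishes at all chosen exponents and is nonzero by independence.
    Any exponent in its support can be the next row, since the enlarged system is then block
    triangular.\<close>
  define v where "v = w t0 - (\<Sum>t\<in>T. scl (q t) (w t))"
  have lkv: "lk v \<kappa> = lk (w t0) \<kappa> - (\<Sum>t\<in>T. q t * lk (w t) \<kappa>)" for \<kappa>
    by (simp add: v_def lookup_minus lookup_sum)
  have "v \<noteq> 0"
  proof
    assume "v = 0"
    then have "w t0 = (\<Sum>t\<in>T. scl (q t) (w t))" by (simp add: v_def)
    then show False using ind(2) span_image_eq[OF insert.hyps(1), of w] by auto
  qed
  then obtain \<nu>0 where \<nu>0: "lk v \<nu>0 \<noteq> 0"
    by (metis poly_mapping_eqI lookup_zero)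
  have v0: "lk v (\<nu> s) = 0" if "s \<in> T" for s using q[OF that] by (simp add: lkv)
  define \<nu>' where "\<nu>' = \<nu>(t0 := \<nu>0)"
  have \<nu>': "\<nu>' t0 = \<nu>0" "\<And>s. s \<in> T \<Longrightarrow> \<nu>' s = \<nu> s" using insert.hyps by (auto simp: \<nu>'_def)
  have key: "(\<Sum>t\<in>insert t0 T. p t * lk (w t) \<kappa>) =
      p t0 * lk v \<kappa> + (\<Sum>t\<in>T. (p t + p t0 * q t) * lk (w t) \<kappa>)" for p \<kappa>
  proof -
    have "(\<Sum>t\<in>T. (p t + p t0 * q t) * lk (w t) \<kappa>) =
        (\<Sum>t\<in>T. p t * lk (w t) \<kappa>) + p t0 * (\<Sum>t\<in>T. q t * lk (w t) \<kappa>)"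
      by (simp add: distrib_right sum.distrib sum_distrib_left mult.assoc)
    then show ?thesis using insert.hyps by (simp add: lkv algebra_simps)
  qed
  show ?case
  proof (intro exI[of _ \<nu>'] conjI allI impI)
    fix p assume p: "\<forall>s\<in>insert t0 T. (\<Sum>t\<in>insert t0 T. p t * lk (w t) (\<nu>' s)) = 0"
    have pq: "p t + p t0 * q t = 0" if "t \<in> T" for t
    proof (rule inj[OF _ that])
      show "\<forall>s\<in>T. (\<Sum>t\<in>T. (p t + p t0 * q t) * lk (w t) (\<nu> s)) = 0"
      proof
        fix s assume s: "s \<in> T"
        have "(\<Sum>t\<in>insert t0 T. p t * lk (w t) (\<nu>' s)) = 0" using p s by blast
        then show "(\<Sum>t\<in>T. (p t + p t0 * q t) * lk (w t) (\<nu> s)) = 0"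
          unfolding key \<nu>'(2)[OF s] v0[OF s] by simp
      qed
    qed
    have "(\<Sum>t\<in>insert t0 T. p t * lk (w t) (\<nu>' t0)) = 0" using p by blast
    then have "p t0 = 0" unfolding key using pq \<nu>0 \<nu>' by simp
    then show "\<forall>t\<in>insert t0 T. p t = 0" using pq by auto
  next
    fix y
    obtain p' where p': "\<And>s. s \<in> T \<Longrightarrow> (\<Sum>t\<in>T. p' t * lk (w t) (\<nu> s)) = y s"
      using surj[of y] by auto
    define a where "a = (y t0 - (\<Sum>t\<in>T. p' t * lk (w t) \<nu>0)) / lk v \<nu>0"
    define p where "p = (\<lambda>t. if t = t0 then a else p' t - a * q t)"
    have e: "(\<Sum>t\<in>T. (p t + p t0 * q t) * lk (w t) \<kappa>) = (\<Sum>t\<in>T. p' t * lk (w t) \<kappa>)" for \<kappa>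
      using insert.hyps by (intro sum.cong) (auto simp: p_def)
    have "\<forall>s\<in>insert t0 T. (\<Sum>t\<in>insert t0 T. p t * lk (w t) (\<nu>' s)) = y s"
    proof
      fix s assume "s \<in> insert t0 T"
      then consider "s = t0" | "s \<in> T" by auto
      then show "(\<Sum>t\<in>insert t0 T. p t * lk (w t) (\<nu>' s)) = y s"
      proof cases
        case 1
        then show ?thesis unfolding key e using \<nu>0 \<nu>' by (simp add: p_def a_def)
      next
        case 2
        then show ?thesis unfolding key e using p'[OF 2] v0[OF 2] \<nu>' by simp
      qed
    qed
    then show "\<exists>q. \<forall>s\<in>insert t0 T. (\<Sum>t\<in>insert t0 T. q t * lk (w t) (\<nu>' s)) = y s" by blast
  qed
qed

context
  fixes F :: "'k::field set"
  assumes F: "subfield F (ring_of_type_algebra :: 'k ring)"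
begin

lemma subfield_closed:
  "0 \<in> F" "1 \<in> F" "a \<in> F \<Longrightarrow> b \<in> F \<Longrightarrow> a + b \<in> F" "- 1 \<in> F"
proof -
  note E = subringE[OF subfieldE(1)[OF F]]
  show "0 \<in> F" "1 \<in> F" "a \<in> F \<Longrightarrow> b \<in> F \<Longrightarrow> a + b \<in> F"
    using E(2,3,7) by (auto simp: ring_of_type_algebra_def)
  interpret R: ring "ring_of_type_algebra :: 'k ring" by (rule ring_from_type_algebra)
  have "\<ominus>\<^bsub>ring_of_type_algebra\<^esub> (1 :: 'k) = - 1"
    by (rule R.minus_equality) (auto simp: ring_of_type_algebra_def)
  moreover have "\<ominus>\<^bsub>ring_of_type_algebra\<^esub> (1 :: 'k) \<in> F"
    using E(5)[OF E(3)] by (simp add: ring_of_type_algebra_def)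
  ultimately show "- 1 \<in> F" by simp
qed

text \<open>Each Leibniz term is 0 or, up to sign, a monomial with coefficient 1, so the determinant
  has coefficients in the prime field. For \<open>F\<close> it suffices to contain 0, 1, -1 and to
  be closed under addition.\<close>

lemma monomial_det_coeffs:
  fixes B :: "(('i \<Rightarrow>\<^sub>0 nat) \<Rightarrow>\<^sub>0 'k) mat"
  assumes B: "B \<in> carrier_mat N N"
    and ent: "\<And>k l. k < N \<Longrightarrow> l < N \<Longrightarrow> B $$ (k, l) \<in> insert 0 {sg \<kappa> 1 | \<kappa>. ks \<kappa> \<subseteq> A}"
  shows "lk (det B) m \<in> F" "m \<in> ks (det B) \<Longrightarrow> ks m \<subseteq> A"
proof -
  let ?Z = "{p :: ('i \<Rightarrow>\<^sub>0 nat) \<Rightarrow>\<^sub>0 'k. (\<forall>m. lk p m \<in> F) \<and> (\<forall>m\<in>ks p. ks m \<subseteq> A)}"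
  let ?E = "insert 0 {sg \<kappa> (1 :: 'k) | \<kappa> :: 'i \<Rightarrow>\<^sub>0 nat. ks \<kappa> \<subseteq> A}"
  have sum_closed: "(\<And>x. x \<in> S \<Longrightarrow> h x \<in> ?Z) \<Longrightarrow> sum h S \<in> ?Z"
    for S and h :: "(nat \<Rightarrow> nat) \<Rightarrow> ('i \<Rightarrow>\<^sub>0 nat) \<Rightarrow>\<^sub>0 'k"
  proof (induction S rule: infinite_finite_induct)
    case (insert x S)
    have hZ: "h x \<in> ?Z" and sZ: "sum h S \<in> ?Z"
      using insert.IH insert.prems by blast+
    have "ks (h x + sum h S) \<subseteq> ks (h x) \<union> ks (sum h S)" by (rule keys_add)
    then have "\<forall>m\<in>ks (h x + sum h S). ks m \<subseteq> A"
      using hZ sZ by blast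
    moreover have "\<forall>m. lk (h x + sum h S) m \<in> F"
      using hZ sZ by (simp add: lookup_add subfield_closed)
    ultimately have "h x + sum h S \<in> ?Z" by blast
    then show ?case using insert by simp
  qed (auto simp: subfield_closed)
  have prod_E: "(\<And>x. x \<in> S \<Longrightarrow> h x \<in> ?E) \<Longrightarrow> prod h S \<in> ?E" for S and h :: "nat \<Rightarrow> _"
  proof (induction S rule: infinite_finite_induct)
    case (insert x S)
    have hE: "h x \<in> ?E" and pE: "prod h S \<in> ?E"
      using insert.IH insert.prems by blast+
    have "h x * prod h S \<in> ?E"
    proof (cases "h x = 0 \<or> prod h S = 0")
      case False
      then obtain \<kappa> \<kappa>' where "h x = sg \<kappa> 1" "prod h S = sg \<kappa>' 1" "ks \<kappa> \<subseteq> A" "ks \<kappa>' \<subseteq> A"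
        using hE pE by blast
      then have "h x * prod h S = sg (\<kappa> + \<kappa>') 1" "ks (\<kappa> + \<kappa>') \<subseteq> A"
        by (simp_all add: mult_single keys_add_nat)
      then show ?thesis by blast
    qed auto
    then show ?case using insert by simp
  next
    case (infinite S)
    show ?case using infinite by (auto intro!: exI[of _ 0])
  next
    case empty
    show ?case by (auto intro!: exI[of _ 0])
  qed
  have EZ: "p \<in> ?E \<Longrightarrow> p \<in> ?Z" "p \<in> ?E \<Longrightarrow> - p \<in> ?Z" for p
    by (auto simp: lookup_single when_def subfield_closed split: if_splits)
  have "det B \<in> ?Z"
    unfolding det_def'[OF B]
  proof (rule sum_closed)
    fix p assume p: "p \<in> {p. p permutes {0..<N}}"
    have "(\<Prod>i = 0..<N. B $$ (i, p i)) \<in> ?E"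
      using p by (intro prod_E ent) (auto dest: permutes_in_image)
    then show "signof p * (\<Prod>i = 0..<N. B $$ (i, p i)) \<in> ?Z"
      using EZ by (cases "evenperm p") (simp_all add: sign_def)
  qed
  then show "lk (det B) m \<in> F" "m \<in> ks (det B) \<Longrightarrow> ks m \<subseteq> A" by auto
qed

text \<open>A nonzero minor for \<open>g\<close> is a polynomial over the prime field that does not vanish identically,
  so it does not vanish at the algebraically independent coefficients of \<open>f\<close>.\<close>

lemma generic_indep:
  fixes f g :: "nat \<Rightarrow> 'k mpoly"
  assumes gen: "alg_indep F (SIGMA i:{1..n}. M i) (\<lambda>(i, \<mu>). lk (f i) \<mu>)"
    and fg0: "f 0 = 1" "g 0 = 1"
    and fg: "\<And>i. i \<in> {1..n} \<Longrightarrow> ks (f i) \<subseteq> M i" "\<And>i. i \<in> {1..n} \<Longrightarrow> ks (g i) \<subseteq> M i"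
    and T: "finite T" "fst ` T \<subseteq> {0..n}"
    and ind: "indep T (\<lambda>(i, \<alpha>). xmonom \<alpha> * g i)"
  shows "indep T (\<lambda>(i, \<alpha>). xmonom \<alpha> * f i)"
proof -
  define w :: "(nat \<Rightarrow> 'k mpoly) \<Rightarrow> nat \<times> expo \<Rightarrow> 'k mpoly"
    where "w h = (\<lambda>(i, \<alpha>). xmonom \<alpha> * h i)" for h
  \<comment> \<open>The matrix over unknown coefficients: the coefficient of \<open>\<nu>\<close> in
    x^\<alpha> f_i is the unknown with index \<open>(i, \<nu> - \<alpha>)\<close>, and for
    \<open>i = 0\<close> it is a constant because that entry of the sequence is 1. One matrix thus
    evaluates to the coefficient matrices of both \<open>f\<close> and \<open>g\<close>.\<close>
  define ent :: "nat \<times> expo \<Rightarrow> expo \<Rightarrow> ((nat \<times> expo) \<Rightarrow>\<^sub>0 nat) \<Rightarrow>\<^sub>0 'k" where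
    "ent = (\<lambda>(i, \<alpha>) \<nu>. if i = 0 then (if \<nu> = \<alpha> then 1 else 0)
       else if \<exists>\<mu>\<in>M i. \<nu> = \<alpha> + \<mu> then sg (sg (i, \<nu> - \<alpha>) 1) 1 else 0)"
  let ?c = "\<lambda>h :: nat \<Rightarrow> 'k mpoly. \<lambda>(i, \<mu>). lk (h i) \<mu>"
  have ent_eval: "mpoly_eval (?c h) (ent (i, \<alpha>) \<nu>) = lk (w h (i, \<alpha>)) \<nu>"
    if h: "h 0 = 1" "\<And>i. i \<in> {1..n} \<Longrightarrow> ks (h i) \<subseteq> M i" and i: "i \<le> n" for h i \<alpha> \<nu>
  proof (cases "i = 0")
    case True
    then show ?thesis using h by (auto simp: w_def ent_def lookup_single)
  next
    case i0: False
    show ?thesis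
    proof (cases "\<exists>\<kappa>. \<nu> = \<alpha> + \<kappa>")
      case True
      then obtain \<kappa> where \<kappa>: "\<nu> = \<alpha> + \<kappa>" by auto
      have "lk (w h (i, \<alpha>)) \<nu> = lk (h i) \<kappa>"
        by (simp add: w_def \<kappa> lookup_monom_mult)
      moreover have "mpoly_eval (?c h) (ent (i, \<alpha>) \<nu>) = lk (h i) \<kappa>"
      proof (cases "\<kappa> \<in> M i")
        case True
        then show ?thesis using i0 by (simp add: ent_def \<kappa> mpoly_eval_single)
      next
        case False
        then have "\<kappa> \<notin> ks (h i)" using h(2)[of i] i i0 by auto
        then show ?thesis using i0 False by (auto simp: ent_def \<kappa> in_keys_iff)
      qed
      ultimately show ?thesis by simp
    next
      case False
      then have "lk (w h (i, \<alpha>)) \<nu> = 0"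
        by (auto simp: w_def intro!: lookup_monom_mult_eq_0)
      then show ?thesis using False i0 by (auto simp: ent_def)
    qed
  qed
  obtain \<nu> where \<nu>: "\<And>q t. (\<forall>s\<in>T. (\<Sum>t\<in>T. q t * lk (w g t) (\<nu> s)) = 0) \<Longrightarrow> t \<in> T \<Longrightarrow> q t = 0"
    using nonsingular_minor[OF T(1) ind] unfolding w_def by blast
  define N where "N = card T"
  obtain e where e: "bij_betw e {0..<N} T"
    unfolding N_def using ex_bij_betw_nat_finite[OF T(1)] by blast
  have eT: "e k \<in> T" if "k < N" for k using e that by (auto simp: bij_betw_def)
  define B where "B = mat N N (\<lambda>(k, l). ent (e l) (\<nu> (e k)))"
  define C where "C h = mat N N (\<lambda>(k, l). lk (w h (e l)) (\<nu> (e k)))" for h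
  have B: "B \<in> carrier_mat N N" and C: "C h \<in> carrier_mat N N" for h
    by (auto simp: B_def C_def)
  have BC: "map_mat (mpoly_eval (?c h)) B = C h"
    if h: "h 0 = 1" "\<And>i. i \<in> {1..n} \<Longrightarrow> ks (h i) \<subseteq> M i" for h
  proof (rule eq_matI)
    fix k l assume "k < dim_row (C h)" "l < dim_col (C h)"
    then have kl: "k < N" "l < N" by (auto simp: C_def)
    obtain i \<alpha> where i: "e l = (i, \<alpha>)" by fastforce
    have "i \<le> n" using eT[OF kl(2)] T(2) i by force
    then show "map_mat (mpoly_eval (?c h)) B $$ (k, l) = C h $$ (k, l)"
      using kl ent_eval[OF h, of i \<alpha>] by (simp add: B_def C_def i)
  qed (auto simp: B_def C_def)
  have detC: "det (C h) = mpoly_eval (?c h) (det B)"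
    if h: "h 0 = 1" "\<And>i. i \<in> {1..n} \<Longrightarrow> ks (h i) \<subseteq> M i" for h
  proof -
    interpret comm_ring_hom "mpoly_eval (?c h)" by (rule comm_ring_hom_mpoly_eval)
    show ?thesis using BC[OF h] hom_det[of B] by simp
  qed
  have mult: "(C h *\<^sub>v v) $ k = (\<Sum>t\<in>T. v $ (inv_into {0..<N} e t) * lk (w h t) (\<nu> (e k)))"
    if "v \<in> carrier_vec N" "k < N" for h v k
  proof -
    have "(C h *\<^sub>v v) $ k = (\<Sum>l\<in>{0..<N}. v $ l * lk (w h (e l)) (\<nu> (e k)))"
      using that by (simp add: C_def scalar_prod_def mult.commute)
    also have "\<dots> = (\<Sum>l\<in>{0..<N}. v $ (inv_into {0..<N} e (e l)) * lk (w h (e l)) (\<nu> (e k)))"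
      using e by (intro sum.cong) (auto simp: bij_betw_def inv_into_f_f)
    also have "\<dots> = (\<Sum>t\<in>T. v $ (inv_into {0..<N} e t) * lk (w h t) (\<nu> (e k)))"
      by (rule sum.reindex_bij_betw[OF e])
    finally show ?thesis .
  qed
  have "det (C g) \<noteq> 0"
  proof
    assume "det (C g) = 0"
    then obtain v where v: "v \<in> carrier_vec N" "v \<noteq> 0\<^sub>v N" "C g *\<^sub>v v = 0\<^sub>v N"
      using det_0_iff_vec_prod_zero_field[OF C[of g]] by auto
    have "v $ (inv_into {0..<N} e t) = 0" if "t \<in> T" for t
    proof (rule \<nu>[OF _ that])
      show "\<forall>s\<in>T. (\<Sum>t\<in>T. v $ (inv_into {0..<N} e t) * lk (w g t) (\<nu> s)) = 0"
      proof
        fix s assume "s \<in> T"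
        then obtain k where k: "k < N" "s = e k" using e by (auto simp: bij_betw_def)
        show "(\<Sum>t\<in>T. v $ (inv_into {0..<N} e t) * lk (w g t) (\<nu> s)) = 0"
          using mult[OF v(1) k(1), of g] k v(3) by simp
      qed
    qed
    then have "v $ k = 0" if "k < N" for k
      using eT[OF that] e that by (metis atLeast0LessThan bij_betw_inv_into_left lessThan_iff)
    then show False using v by (auto intro: eq_vecI)
  qed
  then have "det B \<noteq> 0" using detC[of g] fg0 fg by auto
  moreover have "B $$ (k, l) \<in> insert 0 {sg \<kappa> 1 | \<kappa>. ks \<kappa> \<subseteq> (SIGMA i:{1..n}. M i)}"
    if kl: "k < N" "l < N" for k l
  proof -
    obtain i \<alpha> where i: "e l = (i, \<alpha>)" by fastforce
    have "i \<le> n" using eT[OF kl(2)] T(2) i by force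
    then show ?thesis
      using kl by (auto simp: B_def i ent_def intro: exI[of _ 0])
  qed
  ultimately have "mpoly_eval (?c f) (det B) \<noteq> 0"
    using gen monomial_det_coeffs[OF B, of "SIGMA i:{1..n}. M i"] unfolding alg_indep_def by blast
  then have detf: "det (C f) \<noteq> 0" using detC[of f] fg0 fg by auto
  show ?thesis
    unfolding w_def[symmetric] indep_def
  proof (intro allI impI ballI)
    fix q t assume q: "(\<Sum>t\<in>T. scl (q t) (w f t)) = 0" and t: "t \<in> T"
    have z: "(\<Sum>t\<in>T. q t * lk (w f t) \<kappa>) = 0" for \<kappa>
      using arg_cong[OF q, of "\<lambda>p. lk p \<kappa>"] by (simp add: lookup_sum)
    define v where "v = vec N (\<lambda>k. q (e k))"
    have qv: "v $ (inv_into {0..<N} e t) = q t" if "t \<in> T" for t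
    proof -
      have "inv_into {0..<N} e t < N" using that e
        by (metis atLeastLessThan_iff bij_betwE bij_betw_inv_into)
      then show ?thesis using that e by (simp add: v_def bij_betw_inv_into_right)
    qed
    have "C f *\<^sub>v v = 0\<^sub>v N"
    proof (rule eq_vecI)
      fix k assume "k < dim_vec (0\<^sub>v N)"
      then have k: "k < N" by simp
      show "(C f *\<^sub>v v) $ k = 0\<^sub>v N $ k"
        using k z[of "\<nu> (e k)"] qv by (subst mult) (auto simp: v_def cong: sum.cong)
    qed (simp add: C_def)
    moreover have "v \<in> carrier_vec N" by (simp add: v_def)
    ultimately have "v = 0\<^sub>v N" using det_0_iff_vec_prod_zero_field[OF C[of f]] detf by blast
    moreover have "inv_into {0..<N} e t < N" using t e
      by (metis atLeastLessThan_iff bij_betwE bij_betw_inv_into)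
    ultimately show "q t = 0" using qv[OF t] by simp
  qed
qed

end

subsection \<open>Graded pieces of ideals\<close>

definition forms :: "nat \<Rightarrow> nat \<Rightarrow> 'k::field mpoly set"
  where "forms r e = vs.span (xmonom ` monomials {1..r} e)"

text \<open>Sequences of forms carry the dummy entry \<open>f 0 = 1\<close>, so that the index \<open>0\<close> stands for plain
  monomials in families of products.\<close>

definition wm :: "(nat \<Rightarrow> 'k::field mpoly) \<Rightarrow> nat \<times> expo \<Rightarrow> 'k mpoly"
  where "wm f = (\<lambda>(i, \<alpha>). xmonom \<alpha> * f i)"

text \<open>The guard \<open>d j \<le> e\<close> is essential: truncated subtraction would otherwise
  let a form of degree above \<open>e\<close> contribute its constant multiples.\<close>

definition fam :: "nat \<Rightarrow> (nat \<Rightarrow> nat) \<Rightarrow> nat \<Rightarrow> nat \<Rightarrow> (nat \<times> expo) set"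
  where "fam r d k e = {(j, \<alpha>). j \<in> {1..k} \<and> d j \<le> e \<and> \<alpha> \<in> monomials {1..r} (e - d j)}"

text \<open>These are the monomials outside the ideal of x_1^{d_1}, ..., x_k^{d_k}. For k at most r
  they also represent a basis modulo generic f_1, ..., f_k, as the lemmas on generic sequences
  show.\<close>

definition std :: "nat \<Rightarrow> (nat \<Rightarrow> nat) \<Rightarrow> nat \<Rightarrow> nat \<Rightarrow> expo set"
  where "std r d k e = {\<alpha> \<in> monomials {1..r} e. \<forall>j\<in>{1..k}. lk \<alpha> j < d j}"

text \<open>For \<open>f\<^sub>j = x\<^sub>j ^ d\<^sub>j\<close> the products indexed by \<open>red\<close> are the monomials of the ideal, each listed once,
  at the first \<open>j\<close> whose power divides it.\<close>

definition red :: "nat \<Rightarrow> (nat \<Rightarrow> nat) \<Rightarrow> nat \<Rightarrow> nat \<Rightarrow> (nat \<times> expo) set"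
  where "red r d k e = {(j, \<alpha>). j \<in> {1..k} \<and> d j \<le> e \<and> \<alpha> \<in> std r d (j - 1) (e - d j)}"

text \<open>The degree e piece of the ideal (f_1, ..., f_k) in r variables, as a vector space, so
  that ideal membership becomes linear algebra in a fixed degree.\<close>

definition idl :: "(nat \<Rightarrow> 'k::field mpoly) \<Rightarrow> nat \<Rightarrow> (nat \<Rightarrow> nat) \<Rightarrow> nat \<Rightarrow> nat \<Rightarrow> 'k mpoly set"
  where "idl f r d k e = vs.span (wm f ` fam r d k e)"

lemma forms_iff: "p \<in> forms r e \<longleftrightarrow> ks p \<subseteq> monomials {1..r} e"
proof
  have "vs.subspace {p :: 'a mpoly. ks p \<subseteq> monomials {1..r} e}"
  proof (rule vs.subspaceI)
    fix p q :: "'a mpoly" assume "p \<in> {p. ks p \<subseteq> monomials {1..r} e}" "q \<in> {p. ks p \<subseteq> monomials {1..r} e}"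
    then show "p + q \<in> {p. ks p \<subseteq> monomials {1..r} e}" using keys_add[of p q] by blast
  next
    fix c and p :: "'a mpoly" assume "p \<in> {p. ks p \<subseteq> monomials {1..r} e}"
    moreover have "ks (scl c p) \<subseteq> ks p" by (auto simp: in_keys_iff)
    ultimately show "scl c p \<in> {p. ks p \<subseteq> monomials {1..r} e}" by blast
  qed simp
  then have "forms r e \<subseteq> {p :: 'a mpoly. ks p \<subseteq> monomials {1..r} e}"
    unfolding forms_def by (rule vs.span_minimal[rotated]) auto
  then show "p \<in> forms r e \<Longrightarrow> ks p \<subseteq> monomials {1..r} e" by blast
next
  assume p: "ks p \<subseteq> monomials {1..r} e"
  have "p = (\<Sum>k\<in>ks p. scl (lk p k) (xmonom k))"
    by (subst poly_mapping_expand) (simp add: scl_def mult_single)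
  also have "\<dots> \<in> forms r e"
    unfolding forms_def by (intro vs.span_sum vs.span_scale vs.span_base) (use p in blast)
  finally show "p \<in> forms r e" .
qed

lemma xmonom_forms: "\<alpha> \<in> monomials {1..r} e \<Longrightarrow> xmonom \<alpha> \<in> forms r e"
  by (simp add: forms_iff)

lemma forms_mult: "p \<in> forms r a \<Longrightarrow> q \<in> forms r b \<Longrightarrow> p * q \<in> forms r (a + b)"
  unfolding forms_iff by (rule keys_homogeneous_mult)

lemma forms_diff: "p \<in> forms r e \<Longrightarrow> q \<in> forms r e \<Longrightarrow> p - q \<in> forms r e"
  unfolding forms_def by (rule vs.span_diff)

lemma span_mult_subset:
  assumes "\<And>a b. a \<in> A \<Longrightarrow> b \<in> B \<Longrightarrow> a * b \<in> vs.span C" "p \<in> vs.span A" "q \<in> vs.span B"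
  shows "p * q \<in> vs.span C"
  using assms(2)
proof (induction p rule: vs.span_induct_alt)
  case base
  then show ?case by (simp add: vs.span_zero)
next
  case (step c a p)
  have "a * q \<in> vs.span C"
    using assms(3)
  proof (induction q rule: vs.span_induct_alt)
    case base
    then show ?case by (simp add: vs.span_zero)
  next
    case (step c' b q)
    then show ?case
      using assms(1)[OF \<open>a \<in> A\<close>, of b]
      by (simp add: distrib_left scl_mult(2)[symmetric] vs.span_add vs.span_scale)
  qed
  then show ?case
    using step by (simp add: distrib_right scl_mult(1)[symmetric] vs.span_add vs.span_scale)
qed

lemma idl_mult: 
  assumes "q \<in> forms r b" "p \<in> idl f r d k a"
  shows "q * p \<in> idl f r d k (a + b)"
  unfolding idl_def
proof (rule span_mult_subset)
  fix x y assume "x \<in> (xmonom ` monomials {1..r} b :: 'a mpoly set)" "y \<in> wm f ` fam r d k a"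
  then obtain \<beta> j \<alpha> where x: "x = xmonom \<beta>" "\<beta> \<in> monomials {1..r} b"
    and y: "y = xmonom \<alpha> * f j" "(j, \<alpha>) \<in> fam r d k a" by (auto simp: wm_def)
  have "x * y = wm f (j, \<beta> + \<alpha>)"
    by (simp add: x y wm_def mult.assoc[symmetric] mult_single)
  moreover have "(j, \<beta> + \<alpha>) \<in> fam r d k (a + b)"
    using x y monomials_add[of \<beta> "{1..r}" b \<alpha> "a - d j"] by (auto simp: fam_def add.commute)
  ultimately show "x * y \<in> vs.span (wm f ` fam r d k (a + b))"
    by (simp add: vs.span_base)
qed (use assms in \<open>auto simp: forms_def idl_def\<close>)

lemma idl_gen_mult:
  assumes "j \<in> {1..k}" "q \<in> forms r (e - d j)" "d j \<le> e"
  shows "q * f j \<in> idl f r d k e"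
  unfolding idl_def
proof (rule span_mult_subset[where B = "{f j}"])
  fix a b assume "a \<in> (xmonom ` monomials {1..r} (e - d j) :: 'a mpoly set)" "b \<in> {f j}"
  then obtain \<alpha> where "\<alpha> \<in> monomials {1..r} (e - d j)" "a * b = wm f (j, \<alpha>)"
    by (auto simp: wm_def)
  then show "a * b \<in> vs.span (wm f ` fam r d k e)"
    using assms by (auto simp: fam_def intro!: vs.span_base imageI)
qed (use assms in \<open>auto simp: forms_def vs.span_base\<close>)

lemma idl_mono: "k \<le> l \<Longrightarrow> idl f r d k e \<subseteq> idl f r d l e"
  unfolding idl_def by (intro vs.span_mono image_mono) (auto simp: fam_def)

lemma idl_forms:
  assumes "\<And>i. i \<in> {1..k} \<Longrightarrow> ks (f i) \<subseteq> monomials {1..r} (d i)"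
  shows "idl f r d k e \<subseteq> forms r e"
  unfolding idl_def
proof (rule vs.span_minimal)
  show "wm f ` fam r d k e \<subseteq> forms r e"
  proof
    fix x assume "x \<in> wm f ` fam r d k e"
    then obtain j \<alpha> where j: "j \<in> {1..k}" "d j \<le> e" "\<alpha> \<in> monomials {1..r} (e - d j)" "x = xmonom \<alpha> * f j"
      by (auto simp: fam_def wm_def)
    have "f j \<in> forms r (d j)" using j assms by (simp add: forms_iff)
    from forms_mult[OF xmonom_forms[OF j(3)] this] show "x \<in> forms r e" using j by simp
  qed
qed (simp add: forms_def)

lemma finite_fam [simp]: "finite (fam r d k e)"
proof -
  have "fam r d k e \<subseteq> (SIGMA j:{1..k}. monomials {1..r} (e - d j))" by (auto simp: fam_def)
  then show ?thesis by (rule finite_subset) auto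
qed

lemma red_subset_fam: "red r d k e \<subseteq> fam r d k e"
  by (auto simp: red_def fam_def std_def)

lemma finite_red [simp]: "finite (red r d k e)"
  using red_subset_fam finite_fam by (rule finite_subset)

lemma std_subset: "std r d k e \<subseteq> monomials {1..r} e"
  by (auto simp: std_def)

lemma finite_std [simp]: "finite (std r d k e)"
  using std_subset by (rule finite_subset) simp

lemma red_Suc: "red r d (Suc k) e = red r d k e \<union> (if d (Suc k) \<le> e then {Suc k} \<times> std r d k (e - d (Suc k)) else {})"
  by (auto simp: red_def le_Suc_eq)

definition lead_index :: "(nat \<Rightarrow> nat) \<Rightarrow> nat \<times> expo \<Rightarrow> expo"
  where "lead_index d = (\<lambda>(j, \<alpha>). if j = 0 then \<alpha> else \<alpha> + sg j (d j))"

text \<open>A nonstandard monomial is divided by the first power x_j^{d_j} that divides it, and the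
  cofactor is then standard for the earlier indices. The index j can be read off from the monomial
  as its first exponent that reaches its bound. The bijection serves both for independence in the
  special case and for the dimension count.\<close>

lemma bij_lead_index:
  assumes "k \<le> r"
  shows "bij_betw (lead_index d) (red r d k e \<union> {0} \<times> std r d k e) (monomials {1..r} e)"
proof (rule bij_betw_imageI)
  show "inj_on (lead_index d) (red r d k e \<union> {0} \<times> std r d k e)"
  proof (rule inj_onI)
    fix x y assume xy: "x \<in> red r d k e \<union> {0} \<times> std r d k e" "y \<in> red r d k e \<union> {0} \<times> std r d k e"
      and eq: "lead_index d x = lead_index d y"
    have *: "fst x = fst y"
      if "x \<in> red r d k e \<union> {0} \<times> std r d k e" "y \<in> red r d k e \<union> {0} \<times> std r d k e"
        "lead_index d x = lead_index d y" "fst x \<noteq> 0" "fst y \<noteq> 0 \<longrightarrow> fst x \<le> fst y" for x y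
    proof (rule ccontr)
      assume ne: "fst x \<noteq> fst y"
      obtain j \<alpha> i \<beta> where x: "x = (j, \<alpha>)" "y = (i, \<beta>)" by fastforce
      have "j \<noteq> 0" using that x by simp
      then have "d j \<le> lk (lead_index d x) j" unfolding x by (simp add: lead_index_def lookup_add)
      moreover have "lk (lead_index d y) j < d j"
        using that x ne by (auto simp: lead_index_def lookup_add lookup_single red_def std_def when_def)
      ultimately show False using that by simp
    qed
    consider "fst x = 0" "fst y = 0" | "fst x \<noteq> 0" "fst y \<noteq> 0 \<longrightarrow> fst x \<le> fst y"
      | "fst y \<noteq> 0" "fst x \<noteq> 0 \<longrightarrow> fst y \<le> fst x" by linarith
    then have "fst x = fst y"
    proof cases
      case 1
      then show ?thesis by simp
    next
      case 2
      from *[OF xy eq this] show ?thesis .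
    next
      case 3
      from *[OF xy(2,1) eq[symmetric] this] show ?thesis by simp
    qed
    then show "x = y" using eq by (cases x; cases y) (auto simp: lead_index_def split: if_splits)
  qed
  show "lead_index d ` (red r d k e \<union> {0} \<times> std r d k e) = monomials {1..r} e"
  proof (intro equalityI subsetI)
    fix \<beta> assume "\<beta> \<in> lead_index d ` (red r d k e \<union> {0} \<times> std r d k e)"
    then obtain j \<alpha> where j: "(j, \<alpha>) \<in> red r d k e \<union> {0} \<times> std r d k e" "\<beta> = lead_index d (j, \<alpha>)" by auto
    show "\<beta> \<in> monomials {1..r} e"
    proof (cases "j = 0")
      case True
      then show ?thesis using j by (auto simp: lead_index_def red_def std_def)
    next
      case False
      then have *: "j \<in> {1..k}" "d j \<le> e" "\<alpha> \<in> monomials {1..r} (e - d j)"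
        using j by (auto simp: red_def std_def)
      have "sg j (d j) \<in> monomials {1..r} (d j)" using * assms by (auto simp: monomials_def)
      from monomials_add[OF *(3) this] show ?thesis
        using * False j by (simp add: lead_index_def)
    qed
  next
    fix \<beta> assume \<beta>: "\<beta> \<in> monomials {1..r} e"
    show "\<beta> \<in> lead_index d ` (red r d k e \<union> {0} \<times> std r d k e)"
    proof (cases "\<beta> \<in> std r d k e")
      case True
      then show ?thesis by (intro image_eqI[of _ _ "(0, \<beta>)"]) (auto simp: lead_index_def)
    next
      case False
      then have ex: "\<exists>j. j \<in> {1..k} \<and> d j \<le> lk \<beta> j" using \<beta> by (auto simp: std_def not_less)
      define j where "j = (LEAST j. j \<in> {1..k} \<and> d j \<le> lk \<beta> j)"
      have j: "j \<in> {1..k}" "d j \<le> lk \<beta> j" using LeastI_ex[OF ex] by (auto simp: j_def)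
      have less: "lk \<beta> i < d i" if "i \<in> {1..j-1}" for i
      proof -
        have "\<not> (i \<in> {1..k} \<and> d i \<le> lk \<beta> i)"
          unfolding j_def by (rule not_less_Least) (use that j j_def in auto)
        then show ?thesis using that j by auto
      qed
      have le: "lk (sg j (d j)) i \<le> lk \<beta> i" for i
        using j by (auto simp: lookup_single when_def)
      note D = expo_diff[of "sg j (d j)" \<beta>, OF le]
      have m: "mdeg \<beta> = d j + mdeg (\<beta> - sg j (d j))"
        using arg_cong[OF D(1), of mdeg] by simp
      have "ks (\<beta> - sg j (d j)) \<subseteq> ks \<beta>"
        using D(2) by (auto simp: in_keys_iff)
      then have "\<beta> - sg j (d j) \<in> monomials {1..r} (e - d j)" "d j \<le> e"
        using \<beta> m by (auto simp: monomials_def)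
      moreover have "lk (\<beta> - sg j (d j)) i < d i" if "i \<in> {1..j-1}" for i
        using less[OF that] D(2)[of i] by simp
      ultimately have "(j, \<beta> - sg j (d j)) \<in> red r d k e"
        using j by (auto simp: red_def std_def)
      moreover have "\<beta> = lead_index d (j, \<beta> - sg j (d j))"
        using D(1) j by (simp add: lead_index_def add.commute)
      ultimately show ?thesis by blast
    qed
  qed
qed

lemma indep_xmonom:
  assumes "inj_on \<phi> T" "finite T"
  shows "indep T (\<lambda>t. xmonom (\<phi> t) :: 'k::field mpoly)"
  unfolding indep_def
proof (intro allI impI ballI)
  fix q :: "_ \<Rightarrow> 'k" and t assume q: "(\<Sum>t\<in>T. scl (q t) (xmonom (\<phi> t))) = 0" and t: "t \<in> T"
  have "0 = (\<Sum>s\<in>T. q s * lk (xmonom (\<phi> s)) (\<phi> t))"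
    using arg_cong[OF q, of "\<lambda>p. lk p (\<phi> t)"] by (simp add: lookup_sum)
  also have "\<dots> = (\<Sum>s\<in>T. if s = t then q s else 0)"
    using assms t by (intro sum.cong) (auto simp: lookup_single when_def inj_on_def)
  also have "\<dots> = q t" using t assms by simp
  finally show "q t = 0" by simp
qed

lemma indep_span_disjoint:
  assumes "indep (A \<union> B) w" "A \<inter> B = {}" "finite A" "finite B"
    and "(\<Sum>t\<in>B. scl (q t) (w t)) \<in> vs.span (w ` A)" "t \<in> B"
  shows "q t = 0"
proof -
  obtain p where p: "(\<Sum>t\<in>B. scl (q t) (w t)) = (\<Sum>t\<in>A. scl (p t) (w t))"
    using assms(5) unfolding span_image_eq[OF assms(3)] by auto
  let ?h = "\<lambda>t. if t \<in> A then - p t else q t"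
  have "(\<Sum>t\<in>A \<union> B. scl (?h t) (w t)) = (\<Sum>t\<in>A. scl (?h t) (w t)) + (\<Sum>t\<in>B. scl (?h t) (w t))"
    using assms by (intro sum.union_disjoint) auto
  also have "(\<Sum>t\<in>A. scl (?h t) (w t)) = - (\<Sum>t\<in>A. scl (p t) (w t))"
    unfolding sum_negf[symmetric] by (intro sum.cong) (auto simp: vs.scale_minus_left)
  also have "(\<Sum>t\<in>B. scl (?h t) (w t)) = (\<Sum>t\<in>B. scl (q t) (w t))"
    using assms by (intro sum.cong) auto
  finally have "(\<Sum>t\<in>A \<union> B. scl (?h t) (w t)) = 0" using p by simp
  from indepD[OF assms(1) this, of t] have "?h t = 0" using assms(6) by blast
  moreover have "t \<notin> A" using assms(2,6) by blast
  ultimately show ?thesis by simp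
qed

lemma indep_cofactor_zero:
  assumes "indep (A \<union> {i} \<times> S) (wm f)" "A \<inter> {i} \<times> S = {}" "finite A" "finite S"
    and "s \<in> vs.span (xmonom ` S)" "s * f i \<in> vs.span (wm f ` A)"
  shows "s = 0"
proof -
  obtain q where q: "s = (\<Sum>\<beta>\<in>S. scl (q \<beta>) (xmonom \<beta>))"
    using assms(5) by (auto simp: span_image_eq[OF assms(4)])
  have "s * f i = (\<Sum>\<beta>\<in>S. scl (q \<beta>) (wm f (i, \<beta>)))"
    by (simp add: q sum_distrib_right wm_def scl_mult(1))
  also have "\<dots> = (\<Sum>t\<in>{i} \<times> S. scl (q (snd t)) (wm f t))"
    by (rule sum.reindex_bij_witness[of _ snd "\<lambda>\<beta>. (i, \<beta>)"]) auto
  finally have "(\<Sum>t\<in>{i} \<times> S. scl (q (snd t)) (wm f t)) \<in> vs.span (wm f ` A)"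
    using assms(6) by simp
  then have "q (snd (i, \<beta>)) = 0" if "\<beta> \<in> S" for \<beta>
    by (rule indep_span_disjoint[OF assms(1,2,3), rotated]) (use that assms in auto)
  then show "s = 0" by (simp add: q)
qed

subsection \<open>Generic sequences of forms\<close>

text \<open>The number n of forms and the number r of variables are separate parameters, because the
  locale is also instantiated with the forms left after the last variables are set to zero.\<close>

locale generic_forms =
  fixes F :: "'k::field set" and n r :: nat and d :: "nat \<Rightarrow> nat" and f :: "nat \<Rightarrow> 'k mpoly"
  assumes subfield: "subfield F (ring_of_type_algebra :: 'k ring)"
    and infinite_field: "infinite (UNIV :: 'k set)"
    and f_0: "f 0 = 1"
    and keys_f: "\<And>i. i \<in> {1..n} \<Longrightarrow> ks (f i) \<subseteq> monomials {1..r} (d i)"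
    and generic: "alg_indep F (SIGMA i:{1..n}. monomials {1..r} (d i)) (\<lambda>(i, \<mu>). lk (f i) \<mu>)"
begin

text \<open>The comparison sequence only has to have the right degrees. Its entries may be 0, and
  some may be the generic forms themselves.\<close>

lemma specialize:
  fixes g :: "nat \<Rightarrow> 'k mpoly"
  assumes "g 0 = 1" "\<And>i. i \<in> {1..n} \<Longrightarrow> ks (g i) \<subseteq> monomials {1..r} (d i)"
    and "finite T" "fst ` T \<subseteq> {0..n}" "indep T (wm g)"
  shows "indep T (wm f)"
  unfolding wm_def
  by (rule generic_indep[where M = "\<lambda>i. monomials {1..r} (d i)"
        and f = f and g = g and n = n and T = T, OF subfield generic f_0 assms(1) _ _ assms(3,4)])
    (use keys_f assms(2,5) in \<open>auto simp: wm_def\<close>)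

lemma wm_forms:
  assumes "t \<in> fam r d k e" "k \<le> n"
  shows "wm f t \<in> forms r e"
proof -
  have "wm f t \<in> idl f r d k e" using assms by (auto simp: idl_def intro: vs.span_base)
  then show ?thesis using idl_forms[of k f r d e] keys_f assms by auto
qed

lemma wm_0: "wm f (0, \<alpha>) = xmonom \<alpha>"
  by (simp add: wm_def f_0)

lemma spans_if_card:
  assumes "finite T" "indep T (wm f)" "wm f ` T \<subseteq> forms r e" "card (monomials {1..r} e) \<le> card T"
  shows "forms r e \<subseteq> vs.span (wm f ` T)"
  unfolding forms_def
proof (rule indep_card_spans[OF assms(1,2)])
  show "card (xmonom ` monomials {1..r} e) \<le> card T"
    by (rule order_trans[OF card_image_le assms(4)]) simp
qed (use assms in \<open>auto simp: forms_def\<close>)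

text \<open>For powers of the variables, with 0 for the later forms, the products are pairwise
  distinct monomials.\<close>

lemma indep_red_std:
  assumes "k \<le> r" "r \<le> n"
  shows "indep (red r d k e \<union> {0} \<times> std r d k e) (wm f)"
proof -
  define g :: "nat \<Rightarrow> 'k mpoly" where "g = (\<lambda>j. if j = 0 then 1 else if j \<le> r then xmonom (sg j (d j)) else 0)"
  show ?thesis
  proof (rule specialize[of g])
  show "g 0 = 1" by (simp add: g_def)
  show "ks (g i) \<subseteq> monomials {1..r} (d i)" if "i \<in> {1..n}" for i
    using that by (auto simp: g_def monomials_def split: if_splits)
  show "fst ` (red r d k e \<union> {0} \<times> std r d k e) \<subseteq> {0..n}"
    using assms by (auto simp: g_def red_def)
  have "indep (red r d k e \<union> {0} \<times> std r d k e) (\<lambda>t. xmonom (lead_index d t) :: 'k mpoly)"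
    using bij_lead_index[OF assms(1), of d e] by (intro indep_xmonom) (auto simp: g_def bij_betw_def)
  moreover have "wm g t = xmonom (lead_index d t)" if "t \<in> red r d k e \<union> {0} \<times> std r d k e" for t
    using that assms by (auto simp: g_def wm_def lead_index_def red_def mult_single)
  ultimately show "indep (red r d k e \<union> {0} \<times> std r d k e) (wm g)"
    by (subst indep_cong) auto
qed simp
qed

lemma forms_subset_span:
  assumes "k \<le> r" "r \<le> n"
  shows "forms r e \<subseteq> vs.span (wm f ` (red r d k e \<union> {0} \<times> std r d k e))"
proof (rule spans_if_card)
  show "wm f ` (red r d k e \<union> {0} \<times> std r d k e) \<subseteq> forms r e"
    using wm_forms[of _ k e] red_subset_fam[of r d k e] assms
    by (auto simp: wm_0 intro!: xmonom_forms subsetD[OF std_subset])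
  show "card (monomials {1..r} e) \<le> card (red r d k e \<union> {0} \<times> std r d k e)"
    using bij_betw_same_card[OF bij_lead_index[OF assms(1), of d e]] by simp
qed (use indep_red_std[OF assms] in auto)

lemma forms_decomp:
  assumes "k \<le> r" "r \<le> n" "p \<in> forms r e"
  obtains q s where "p = q + s" "q \<in> vs.span (wm f ` red r d k e)" "s \<in> vs.span (xmonom ` std r d k e)"
proof -
  have "wm f ` ({0} \<times> std r d k e) = xmonom ` std r d k e"
    by (auto simp: wm_0 image_iff)
  then show ?thesis
    using subsetD[OF forms_subset_span[OF assms(1,2)] assms(3)] that
    by (auto simp: image_Un vs.span_Un)
qed

lemma span_red_idl: "vs.span (wm f ` red r d k e) \<subseteq> idl f r d k e"
  unfolding idl_def by (intro vs.span_mono image_mono red_subset_fam)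

text \<open>In a multiple of f_{k+1} only the class of the cofactor modulo (f_1, ..., f_k) matters,
  since a cofactor in that ideal gives a product in that ideal. Every class has a representative
  made of standard monomials.\<close>

lemma idl_eq_span_red:
  assumes "k \<le> r" "r \<le> n"
  shows "idl f r d k e = vs.span (wm f ` red r d k e)"
  using assms(1)
proof (induction k arbitrary: e)
  case 0
  have "fam r d 0 e = {}" "red r d 0 e = {}" by (auto simp: fam_def red_def)
  then show ?case by (simp add: idl_def)
next
  case (Suc k)
  have "wm f t \<in> vs.span (wm f ` red r d (Suc k) e)" if t: "t \<in> fam r d (Suc k) e" for t
  proof -
    obtain j \<alpha> where j: "t = (j, \<alpha>)" "j \<in> {1..Suc k}" "d j \<le> e" "\<alpha> \<in> monomials {1..r} (e - d j)"
      using t by (auto simp: fam_def)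
    have sub: "idl f r d k e \<subseteq> vs.span (wm f ` red r d (Suc k) e)"
      using Suc by (auto simp: red_Suc intro!: vs.span_mono image_mono)
    show ?thesis
    proof (cases "j \<le> k")
      case True
      then have "wm f t \<in> idl f r d k e" using j by (auto simp: idl_def fam_def intro!: vs.span_base imageI)
      then show ?thesis using sub by blast
    next
      case False
      then have jk: "j = Suc k" using j by auto
      obtain q s where qs: "xmonom \<alpha> = q + s" "q \<in> vs.span (wm f ` red r d k (e - d j))"
          "s \<in> vs.span (xmonom ` std r d k (e - d j))"
        using forms_decomp[of k "xmonom \<alpha>" "e - d j"] xmonom_forms[OF j(4)] Suc.prems assms by auto
      have "f j \<in> forms r (d j)" using keys_f[of j] jk Suc.prems assms by (auto simp: forms_iff)
      then have "f j * q \<in> idl f r d k e"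
        using idl_mult[of "f j" r "d j" q f d k "e - d j"] qs(2) Suc j(3) by auto
      moreover have "s * f j \<in> vs.span (wm f ` red r d (Suc k) e)"
      proof (rule span_mult_subset[OF _ qs(3), of "{f j}"])
        fix a b assume "a \<in> (xmonom ` std r d k (e - d j) :: 'k mpoly set)" "b \<in> {f j}"
        then obtain \<beta> where "\<beta> \<in> std r d k (e - d j)" "a * b = wm f (j, \<beta>)" by (auto simp: wm_def)
        then show "a * b \<in> vs.span (wm f ` red r d (Suc k) e)"
          using j(3) jk by (auto simp: red_Suc intro!: vs.span_base imageI)
      qed (simp add: vs.span_base)
      moreover have "wm f t = f j * q + s * f j"
        using qs(1) j by (simp add: wm_def algebra_simps)
      ultimately show ?thesis using sub by (auto intro: vs.span_add)
    qed
  qed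
  then have "idl f r d (Suc k) e \<subseteq> vs.span (wm f ` red r d (Suc k) e)"
    unfolding idl_def by (intro vs.span_minimal) auto
  then show ?case using span_red_idl by blast
qed

text \<open>Modulo the ideal, \<open>h\<close> may be replaced by a combination s of standard
  monomials, and s f_i lying in the ideal is a relation among independent products. The index i is
  any index beyond k: i = k + 1 gives regular sequences, while k = r gives the action of a further
  form on a complete intersection.\<close>

lemma regular_if_indep:
  assumes k: "k \<le> r" "r \<le> n" and i: "i \<in> {k<..n}" "d i \<le> e"
    and ind: "indep (red r d k e \<union> {i} \<times> std r d k (e - d i)) (wm f)"
    and h: "h \<in> forms r (e - d i)" "h * f i \<in> idl f r d k e"
  shows "h \<in> idl f r d k (e - d i)"
proof -
  obtain q s where qs: "h = q + s" "q \<in> vs.span (wm f ` red r d k (e - d i))"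
      "s \<in> vs.span (xmonom ` std r d k (e - d i))"
    using forms_decomp[OF k h(1)] by auto
  then have q: "q \<in> idl f r d k (e - d i)" using span_red_idl by blast
  have "f i \<in> forms r (d i)" using keys_f[of i] i k by (auto simp: forms_iff)
  then have "f i * q \<in> idl f r d k e"
    using idl_mult[of "f i" r "d i" q f d k "e - d i"] q i by auto
  then have "h * f i - f i * q \<in> idl f r d k e" using h by (simp add: idl_def vs.span_diff)
  moreover have "h * f i - f i * q = s * f i" by (simp add: qs algebra_simps)
  ultimately have "s * f i \<in> vs.span (wm f ` red r d k e)" by (simp add: idl_eq_span_red[OF k])
  moreover have "red r d k e \<inter> {i} \<times> std r d k (e - d i) = {}" using i by (auto simp: red_def)
  ultimately have "s = 0"
    using indep_cofactor_zero[OF ind _ _ _ qs(3)] by simp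
  then show ?thesis using qs q by simp
qed

lemma regular:
  assumes "i \<in> {1..r}" "r \<le> n" "d i \<le> e" "h \<in> forms r (e - d i)" "h * f i \<in> idl f r d (i - 1) e"
  shows "h \<in> idl f r d (i - 1) (e - d i)"
proof (rule regular_if_indep[OF _ _ _ assms(3) _ assms(4,5)])
  show "indep (red r d (i - 1) e \<union> {i} \<times> std r d (i - 1) (e - d i)) (wm f)"
    using indep_red_std[of i e] assms red_Suc[of r d "i - 1" e]
    by (auto elim!: indep_mono)
qed (use assms in auto)

end

subsection \<open>Forms vanishing on a grid\<close>

text \<open>The index set of the grid. The same exponents index the grid points, the Newton
  polynomials and, once x_r fills up the degree, standard monomials.\<close>

definition box :: "nat \<Rightarrow> (nat \<Rightarrow> nat) \<Rightarrow> expo set"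
  where "box r d = {\<beta>. ks \<beta> \<subseteq> {1..<r} \<and> (\<forall>j\<in>{1..<r}. lk \<beta> j < d j)}"

definition grid_point :: "nat \<Rightarrow> (nat \<Rightarrow> nat \<Rightarrow> 'k::field) \<Rightarrow> expo \<Rightarrow> nat \<Rightarrow> 'k"
  where "grid_point r a \<beta> = (\<lambda>i. if i \<in> {1..<r} then a i (lk \<beta> i) else 1)"

definition lin :: "nat \<Rightarrow> nat \<Rightarrow> 'k::field \<Rightarrow> 'k mpoly"
  where "lin r i c = xmonom (sg i 1) - sg (sg r 1) c"

text \<open>The multivariate Newton basis, made homogeneous with x_r. Its value at the point with
  index \<open>\<beta>\<close> can be nonzero only if \<open>\<gamma>\<close> is pointwise at most
  \<open>\<beta>\<close>. The nodes may differ from coordinate to coordinate, which the reversal of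
  the grid requires.\<close>

definition newton :: "nat \<Rightarrow> (nat \<Rightarrow> nat \<Rightarrow> 'k::field) \<Rightarrow> expo \<Rightarrow> 'k mpoly"
  where "newton r a \<gamma> = (\<Prod>i\<in>{1..<r}. \<Prod>l<lk \<gamma> i. lin r i (a i l))"

lemma lookup_box_outside:
  assumes "\<beta> \<in> box r d" "i \<notin> {1..<r}"
  shows "lk \<beta> i = 0"
proof -
  have "i \<notin> ks \<beta>" using assms unfolding box_def by blast
  then show ?thesis by (simp add: in_keys_iff)
qed

lemma finite_box [simp]: "finite (box r d)"
proof -
  let ?Fs = "{f. \<forall>x. (x \<in> {1..<r} \<longrightarrow> f x \<in> {..(\<Sum>j\<in>{1..<r}. d j)}) \<and> (x \<notin> {1..<r} \<longrightarrow> f x = (0::nat))}"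
  have "finite ?Fs"
    by (rule finite_set_of_finite_funs) auto
  moreover have "lk ` box r d \<subseteq> ?Fs"
  proof (intro image_subsetI CollectI allI conjI impI)
    fix \<beta> x assume b: "\<beta> \<in> box r d"
    { assume x: "x \<in> {1..<r}"
      then have "lk \<beta> x \<le> d x" using b by (auto simp: box_def intro: less_imp_le)
      also have "\<dots> \<le> (\<Sum>j\<in>{1..<r}. d j)" using x by (intro member_le_sum) auto
      finally show "lk \<beta> x \<in> {..(\<Sum>j\<in>{1..<r}. d j)}" by simp }
    assume "x \<notin> {1..<r}"
    then show "lk \<beta> x = 0" by (rule lookup_box_outside[OF b])
  qed
  ultimately have "finite (lk ` box r d)"
    by (rule rev_finite_subset)
  moreover have "inj_on lk (box r d)"
    by (rule inj_onI) (simp only: poly_mapping_eq_iff)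
  ultimately show ?thesis by (rule finite_imageD)
qed

lemma mdeg_box: "\<beta> \<in> box r d \<Longrightarrow> mdeg \<beta> = (\<Sum>j\<in>{1..<r}. lk \<beta> j)"
  by (rule mdeg_superset) (auto simp: box_def)

lemma forms_prod:
  assumes "\<And>i. i \<in> I \<Longrightarrow> q i \<in> forms r (k i)"
  shows "prod q I \<in> forms r (sum k I)"
  using assms
proof (induction I rule: infinite_finite_induct)
  case (insert x I)
  then show ?case using forms_mult[of "q x" r "k x" "prod q I" "sum k I"] by simp
qed (auto simp: forms_iff monomials_def)

lemma lin_forms:
  assumes "i \<in> {1..r}"
  shows "lin r i c \<in> forms r 1"
proof -
  have "sg (sg r 1) c \<in> forms r 1" "xmonom (sg i 1) \<in> forms r 1"
    using assms by (auto simp: forms_iff monomials_def)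
  then show ?thesis unfolding lin_def using forms_diff by blast
qed

lemma lin_prod_forms:
  assumes "i \<in> {1..r}"
  shows "(\<Prod>l<k. lin r i (c l)) \<in> forms r k"
proof -
  have "(\<Prod>l<k. lin r i (c l)) \<in> forms r (\<Sum>l<k. 1)"
    by (rule forms_prod) (rule lin_forms[OF assms])
  then show ?thesis by simp
qed

lemma newton_forms: "\<gamma> \<in> box r d \<Longrightarrow> newton r a \<gamma> \<in> forms r (mdeg \<gamma>)"
  unfolding newton_def mdeg_box by (intro forms_prod lin_prod_forms) auto

lemma keys_mult_bound:
  assumes "\<And>\<mu>. \<mu> \<in> ks p \<Longrightarrow> lk \<mu> j \<le> (x::nat)" "\<And>\<mu>. \<mu> \<in> ks q \<Longrightarrow> lk \<mu> j \<le> y" "\<mu> \<in> ks (p * q)"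
  shows "lk \<mu> j \<le> x + y"
proof -
  obtain a b where "\<mu> = a + b" "a \<in> ks p" "b \<in> ks q"
    using assms(3) keys_mult[of p q] by blast
  then show ?thesis using assms(1,2) by (simp add: lookup_add add_mono)
qed

lemma keys_prod_bound:
  assumes "\<And>i \<mu>. i \<in> I \<Longrightarrow> \<mu> \<in> ks (p i) \<Longrightarrow> lk \<mu> j \<le> (x i :: nat)" "\<mu> \<in> ks (prod p I)"
  shows "lk \<mu> j \<le> sum x I"
  using assms
proof (induction I arbitrary: \<mu> rule: infinite_finite_induct)
  case (insert i I)
  have "lk \<mu> j \<le> x i + sum x I"
  proof (rule keys_mult_bound)
    show "\<mu> \<in> ks (p i * prod p I)" using insert by simp
  qed (use insert in auto)
  then show ?case using insert by simp
qed auto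

lemma keys_lin: "\<mu> \<in> ks (lin r i c) \<Longrightarrow> j \<noteq> r \<Longrightarrow> lk \<mu> j \<le> (if j = i then 1 else 0)"
  using keys_diff[of "xmonom (sg i 1)" "sg (sg r 1) c"]
  by (auto simp: lin_def lookup_single split: if_splits)

lemma keys_lin_prod:
  assumes "\<mu> \<in> ks (\<Prod>l<k. lin r i (c l))" "j \<noteq> r"
  shows "lk \<mu> j \<le> (if j = i then k else 0)"
proof -
  have "lk \<mu> j \<le> (\<Sum>l<k. if j = i then 1 else 0)"
    by (rule keys_prod_bound[OF keys_lin assms(1)]) (use assms(2) in auto)
  then show ?thesis by (auto split: if_splits)
qed

lemma keys_newton:
  assumes "\<mu> \<in> ks (newton r a \<gamma>)" "j \<in> {1..<r}"
  shows "lk \<mu> j \<le> lk \<gamma> j"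
proof -
  have "lk \<mu> j \<le> (\<Sum>i\<in>{1..<r}. if j = i then lk \<gamma> i else 0)"
    by (rule keys_prod_bound[OF keys_lin_prod assms(1)[unfolded newton_def]]) (use assms in auto)
  also have "\<dots> = lk \<gamma> j" using assms by simp
  finally show ?thesis .
qed

lemma eval_lin:
  "i \<in> {1..<r} \<Longrightarrow> mpoly_eval (grid_point r a \<beta>) (lin r i c) = a i (lk \<beta> i) - c"
proof -
  have "lin r i c = xmonom (sg i 1) + sg (sg r 1) (- c)" by (simp add: lin_def single_uminus)
  then show "i \<in> {1..<r} \<Longrightarrow> ?thesis"
    by (simp only: mpoly_eval_add) (simp add: mpoly_eval_single grid_point_def)
qed

lemma eval_newton:
  "mpoly_eval (grid_point r a \<beta>) (newton r a \<gamma>) =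
    (\<Prod>i\<in>{1..<r}. \<Prod>l<lk \<gamma> i. a i (lk \<beta> i) - a i l)"
  unfolding newton_def mpoly_eval_prod by (intro prod.cong refl) (simp add: eval_lin)

lemma eval_newton_eq_0:
  assumes "i \<in> {1..<r}" "lk \<beta> i < lk \<gamma> i"
  shows "mpoly_eval (grid_point r a \<beta>) (newton r a \<gamma>) = 0"
  unfolding eval_newton
proof (rule prod_zero)
  show "\<exists>i\<in>{1..<r}. (\<Prod>l<lk \<gamma> i. a i (lk \<beta> i) - a i l) = 0"
    using assms by (intro bexI[of _ i] prod_zero bexI[of _ "lk \<beta> i"]) auto
qed simp

lemma eval_newton_neq_0:
  assumes "\<And>i. i \<in> {1..<r} \<Longrightarrow> inj_on (a i) {..<d i}" "\<beta> \<in> box r d"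
    "\<And>i. i \<in> {1..<r} \<Longrightarrow> lk \<gamma> i \<le> lk \<beta> i"
  shows "mpoly_eval (grid_point r a \<beta>) (newton r a \<gamma>) \<noteq> 0"
proof -
  have "a i (lk \<beta> i) \<noteq> a i l" if "i \<in> {1..<r}" "l < lk \<gamma> i" for i l
  proof -
    have "lk \<beta> i < d i" "l < lk \<beta> i" using assms(2) assms(3)[OF that(1)] that by (auto simp: box_def)
    then show ?thesis using inj_onD[OF assms(1)[OF that(1)], of "lk \<beta> i" l] by auto
  qed
  then show ?thesis unfolding eval_newton by simp
qed

lemma eval_xr: "mpoly_eval (grid_point r a \<beta>) (xmonom (sg r k)) = 1"
  by (simp add: mpoly_eval_single grid_point_def)

text \<open>The evaluation matrix is triangular. At the point \<open>\<gamma>\<close> every other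
  Newton polynomial of at least the same degree vanishes, and those of smaller degree have
  coefficient 0 by induction.\<close>

lemma newton_coeffs_zero:
  assumes inj: "\<And>i. i \<in> {1..<r} \<Longrightarrow> inj_on (a i) {..<d i}"
    and z: "\<And>\<beta>. \<beta> \<in> box r d \<Longrightarrow> mdeg \<beta> < b \<Longrightarrow>
      (\<Sum>\<gamma> | \<gamma> \<in> box r d \<and> mdeg \<gamma> < b. c \<gamma> * mpoly_eval (grid_point r a \<beta>) (newton r a \<gamma>)) = 0"
    and g: "\<gamma> \<in> box r d" "mdeg \<gamma> < b"
  shows "c \<gamma> = 0"
  using g
proof (induction "mdeg \<gamma>" arbitrary: \<gamma> rule: less_induct)
  case less
  let ?ev = "\<lambda>\<gamma>'. mpoly_eval (grid_point r a \<gamma>) (newton r a \<gamma>')"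
  have "c \<gamma>' * ?ev \<gamma>' = 0" if g': "\<gamma>' \<in> box r d" "mdeg \<gamma>' < b" "\<gamma>' \<noteq> \<gamma>" for \<gamma>'
  proof (cases "mdeg \<gamma>' < mdeg \<gamma>")
    case True
    then show ?thesis using less g' by simp
  next
    case False
    have "\<exists>i\<in>{1..<r}. lk \<gamma> i < lk \<gamma>' i"
    proof (rule ccontr)
      assume n: "\<not> ?thesis"
      have le: "lk \<gamma>' i \<le> lk \<gamma> i" for i
      proof (cases "i \<in> {1..<r}")
        case True
        then show ?thesis using n by (meson not_less)
      qed (simp add: lookup_box_outside[OF g'(1)])
      have "\<gamma> = \<gamma>' + (\<gamma> - \<gamma>')" using expo_diff(1)[of \<gamma>' \<gamma>] le by simp
      then have "mdeg \<gamma> = mdeg \<gamma>' + mdeg (\<gamma> - \<gamma>')" by (metis mdeg_add)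
      then have "\<gamma> - \<gamma>' = 0" using False by (intro mdeg_eq_0) simp
      then show False using \<open>\<gamma> = \<gamma>' + (\<gamma> - \<gamma>')\<close> g' by simp
    qed
    then obtain i where "i \<in> {1..<r}" "lk \<gamma> i < lk \<gamma>' i" by blast
    then have "?ev \<gamma>' = 0" by (rule eval_newton_eq_0)
    then show ?thesis by simp
  qed
  then have "(\<Sum>\<gamma>' | \<gamma>' \<in> box r d \<and> mdeg \<gamma>' < b. c \<gamma>' * ?ev \<gamma>') = (\<Sum>\<gamma>'\<in>{\<gamma>}. c \<gamma>' * ?ev \<gamma>')"
    using less by (intro sum.mono_neutral_right) auto
  then have "c \<gamma> * ?ev \<gamma> = 0" using z[OF less.prems] by simp
  then show ?case using eval_newton_neq_0[OF inj less.prems(1)] by simp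
qed

text \<open>The homogenizations to degree e, by x_r, of the box monomials of degree below b in x_1,
  ..., x_{r-1}. This is the monomial side of interpolation on the lower part of the grid.\<close>

definition low_std :: "nat \<Rightarrow> (nat \<Rightarrow> nat) \<Rightarrow> nat \<Rightarrow> nat \<Rightarrow> expo set"
  where "low_std r d e b = {\<beta> \<in> std r d (r - 1) e. (\<Sum>i\<in>{1..<r}. lk \<beta> i) < b}"

lemma finite_low_std [simp]: "finite (low_std r d e b)"
  by (simp add: low_std_def)

text \<open>The bound \<open>b \<le> e + 1\<close> guarantees \<open>mdeg \<gamma> \<le> e\<close>,
  so that \<open>e - mdeg \<gamma>\<close> is the true exponent of x_r and not a truncated
  one.\<close>

lemma bij_low_std:
  assumes "b \<le> e + 1" "1 \<le> r"
  shows "bij_betw (\<lambda>\<gamma>. \<gamma> + sg r (e - mdeg \<gamma>)) {\<gamma> \<in> box r d. mdeg \<gamma> < b} (low_std r d e b)"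
proof (rule bij_betw_imageI)
  have nr: "lk \<gamma> r = 0" if "\<gamma> \<in> box r d" for \<gamma>
    using lookup_box_outside[OF that] by simp
  show "inj_on (\<lambda>\<gamma>. \<gamma> + sg r (e - mdeg \<gamma>)) {\<gamma> \<in> box r d. mdeg \<gamma> < b}"
  proof (rule inj_onI)
    fix x y assume xy: "x \<in> {\<gamma> \<in> box r d. mdeg \<gamma> < b}" "y \<in> {\<gamma> \<in> box r d. mdeg \<gamma> < b}"
      "x + sg r (e - mdeg x) = y + sg r (e - mdeg y)"
    have "lk (x + sg r (e - mdeg x)) r = lk (y + sg r (e - mdeg y)) r" using xy(3) by simp
    moreover have "lk x r = 0" "lk y r = 0" using xy nr by blast+
    ultimately have "e - mdeg x = e - mdeg y" by (simp add: lookup_add)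
    then show "x = y" using xy by simp
  qed
  show "(\<lambda>\<gamma>. \<gamma> + sg r (e - mdeg \<gamma>)) ` {\<gamma> \<in> box r d. mdeg \<gamma> < b} = low_std r d e b"
  proof (intro equalityI subsetI)
    fix \<beta> assume "\<beta> \<in> (\<lambda>\<gamma>. \<gamma> + sg r (e - mdeg \<gamma>)) ` {\<gamma> \<in> box r d. mdeg \<gamma> < b}"
    then obtain \<gamma> where g: "\<gamma> \<in> box r d" "mdeg \<gamma> < b" "\<beta> = \<gamma> + sg r (e - mdeg \<gamma>)" by auto
    have l: "lk \<beta> i = lk \<gamma> i" if "i \<in> {1..<r}" for i
      using that by (auto simp: g lookup_add lookup_single when_def)
    have "ks \<beta> \<subseteq> {1..r}" using g(1) assms by (auto simp: g(3) keys_add_nat box_def split: if_splits)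
    moreover have "mdeg \<beta> = e" using g assms by simp
    moreover have "lk \<beta> j < d j" if "j \<in> {1..r-1}" for j
    proof -
      have "j \<in> {1..<r}" using that by auto
      then show ?thesis using l[of j] g(1) by (auto simp: box_def)
    qed
    moreover have "(\<Sum>i\<in>{1..<r}. lk \<beta> i) < b"
      using mdeg_box[OF g(1)] g(2) l by simp
    ultimately show "\<beta> \<in> low_std r d e b" by (auto simp: low_std_def std_def monomials_def)
  next
    fix \<beta> assume b: "\<beta> \<in> low_std r d e b"
    define \<gamma> where "\<gamma> = \<beta> - sg r (lk \<beta> r)"
    have D: "sg r (lk \<beta> r) + \<gamma> = \<beta>" "lk \<gamma> i = lk \<beta> i - lk (sg r (lk \<beta> r)) i" for i
      using expo_diff[of "sg r (lk \<beta> r)" \<beta>] by (auto simp: \<gamma>_def lookup_single when_def)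
    have "lk \<gamma> i = (if i = r then 0 else lk \<beta> i)" for i
      using D(2)[of i] by (auto simp: lookup_single when_def)
    note l = this
    have kb: "ks \<beta> \<subseteq> {1..r}" "mdeg \<beta> = e" using b by (auto simp: low_std_def std_def monomials_def)
    have "ks \<gamma> \<subseteq> {1..<r}"
    proof
      fix i assume "i \<in> ks \<gamma>"
      then have "i \<noteq> r" "i \<in> ks \<beta>" using l[of i] by (auto simp: in_keys_iff split: if_splits)
      then show "i \<in> {1..<r}" using kb by force
    qed
    moreover have "lk \<gamma> j < d j" if "j \<in> {1..<r}" for j
      using that b l[of j] by (auto simp: low_std_def std_def)
    ultimately have gb: "\<gamma> \<in> box r d" by (auto simp: box_def)
    have "mdeg \<gamma> = (\<Sum>i\<in>{1..<r}. lk \<beta> i)"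
      unfolding mdeg_box[OF gb] using l by (intro sum.cong) auto
    then have "mdeg \<gamma> < b" using b by (simp add: low_std_def)
    moreover have "lk \<beta> r = e - mdeg \<gamma>"
      using arg_cong[OF D(1), of mdeg] kb by simp
    ultimately show "\<beta> \<in> (\<lambda>\<gamma>. \<gamma> + sg r (e - mdeg \<gamma>)) ` {\<gamma> \<in> box r d. mdeg \<gamma> < b}"
      using gb D(1) by (intro image_eqI[of _ _ \<gamma>]) (auto simp: add.commute)
  qed
qed

text \<open>The homogenized Newton polynomials of degree below b lie in the span in question, are
  independent, and are as many as its monomials. Hence \<open>v\<close> is a combination of them,
  and its values on the lower part of the grid determine the coefficients.\<close>

lemma zero_if_vanishes_below:
  assumes inj: "\<And>i. i \<in> {1..<r} \<Longrightarrow> inj_on (a i) {..<d i}"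
    and b: "b \<le> e + 1" "1 \<le> r"
    and v: "v \<in> vs.span (xmonom ` low_std r d e b)"
    and z: "\<And>\<beta>. \<beta> \<in> box r d \<Longrightarrow> mdeg \<beta> < b \<Longrightarrow> mpoly_eval (grid_point r a \<beta>) v = 0"
  shows "v = 0"
proof -
  let ?B = "{\<gamma> \<in> box r d. mdeg \<gamma> < b}"
  define w where "w \<gamma> = newton r a \<gamma> * xmonom (sg r (e - mdeg \<gamma>))" for \<gamma>
  have ev: "mpoly_eval (grid_point r a \<beta>) (\<Sum>\<gamma>\<in>?B. scl (c \<gamma>) (w \<gamma>)) =
      (\<Sum>\<gamma>\<in>?B. c \<gamma> * mpoly_eval (grid_point r a \<beta>) (newton r a \<gamma>))" for c \<beta>
    by (simp add: mpoly_eval_sum mpoly_eval_scl w_def mpoly_eval_mult eval_xr)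
  have ind: "indep ?B w"
    unfolding indep_def
  proof (intro allI impI ballI)
    fix c \<gamma> assume c: "(\<Sum>\<gamma>\<in>?B. scl (c \<gamma>) (w \<gamma>)) = 0" and g: "\<gamma> \<in> ?B"
    show "c \<gamma> = 0"
    proof (rule newton_coeffs_zero[where a = a and r = r and d = d and b = b and c = c])
      fix \<beta> :: expo
      show "(\<Sum>\<gamma> | \<gamma> \<in> box r d \<and> mdeg \<gamma> < b. c \<gamma> * mpoly_eval (grid_point r a \<beta>) (newton r a \<gamma>)) = 0"
        using ev[of \<beta> c] unfolding c by simp
    qed (use g inj in auto)
  qed
  have "w ` ?B \<subseteq> vs.span (xmonom ` low_std r d e b)"
  proof (rule image_subsetI)
    fix \<gamma> assume g: "\<gamma> \<in> ?B"
    have mono: "\<mu> \<in> low_std r d e b" if m: "\<mu> \<in> ks (w \<gamma>)" for \<mu>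
    proof -
      obtain \<kappa> where k: "\<kappa> \<in> ks (newton r a \<gamma>)" "\<mu> = \<kappa> + sg r (e - mdeg \<gamma>)"
        using m keys_mult[of "newton r a \<gamma>" "xmonom (sg r (e - mdeg \<gamma>))"] by (auto simp: w_def)
      have kh: "\<kappa> \<in> monomials {1..r} (mdeg \<gamma>)"
        using newton_forms[of \<gamma> r d a] g k(1) by (auto simp: forms_iff)
      have l: "lk \<mu> i \<le> lk \<gamma> i" if "i \<in> {1..<r}" for i
        using keys_newton[OF k(1) that] that by (auto simp: k(2) lookup_add lookup_single when_def)
      have "\<mu> \<in> monomials {1..r} e"
        using kh g b by (auto simp: k(2) monomials_def keys_add_nat split: if_splits)
      moreover have "lk \<mu> j < d j" if "j \<in> {1..r-1}" for j
      proof -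
        have "j \<in> {1..<r}" using that by auto
        then show ?thesis using l[of j] g by (auto simp: box_def intro: le_less_trans)
      qed
      moreover have "(\<Sum>i\<in>{1..<r}. lk \<mu> i) < b"
        using sum_mono[of "{1..<r}" "lk \<mu>" "lk \<gamma>"] l mdeg_box[of \<gamma> r d] g by force
      ultimately show ?thesis by (auto simp: low_std_def std_def)
    qed
    have "w \<gamma> = (\<Sum>\<mu>\<in>ks (w \<gamma>). scl (lk (w \<gamma>) \<mu>) (xmonom \<mu>))"
      by (subst poly_mapping_expand) (simp add: scl_def mult_single)
    also have "\<dots> \<in> vs.span (xmonom ` low_std r d e b)"
      by (intro vs.span_sum vs.span_scale vs.span_base imageI mono)
    finally show "w \<gamma> \<in> vs.span (xmonom ` low_std r d e b)" .
  qed
  moreover have "card (xmonom ` low_std r d e b :: 'a mpoly set) \<le> card ?B"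
    using bij_betw_same_card[OF bij_low_std[OF b, of d]] card_image_le[OF finite_low_std, of xmonom r d e b]
    by simp
  ultimately have "vs.span (xmonom ` low_std r d e b) \<subseteq> vs.span (w ` ?B)"
    by (intro indep_card_spans ind) auto
  then obtain c where c: "v = (\<Sum>\<gamma>\<in>?B. scl (c \<gamma>) (w \<gamma>))"
    using v span_image_eq[of ?B w] by auto
  have "c \<gamma> = 0" if g: "\<gamma> \<in> ?B" for \<gamma>
  proof (rule newton_coeffs_zero[where a = a and r = r and d = d and b = b and c = c])
    fix \<beta> assume "\<beta> \<in> box r d" "mdeg \<beta> < b"
    then show "(\<Sum>\<gamma> | \<gamma> \<in> box r d \<and> mdeg \<gamma> < b. c \<gamma> * mpoly_eval (grid_point r a \<beta>) (newton r a \<gamma>)) = 0"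
      using z ev[of \<beta> c] unfolding c by simp
  qed (use g inj in auto)
  then show ?thesis by (simp add: c)
qed

section \<open>Reversing the grid\<close>

definition reflect :: "nat \<Rightarrow> (nat \<Rightarrow> nat) \<Rightarrow> expo \<Rightarrow> expo"
  where "reflect r d \<beta> = (\<Sum>j\<in>{1..<r}. sg j (d j - 1 - lk \<beta> j))"

lemma lookup_reflect: "lk (reflect r d \<beta>) i = (if i \<in> {1..<r} then d i - 1 - lk \<beta> i else 0)"
  by (auto simp: reflect_def lookup_sum lookup_single when_def)

lemma reflect_box:
  assumes "\<And>j. j \<in> {1..<r} \<Longrightarrow> 0 < d j" "\<beta> \<in> box r d"
  shows "reflect r d \<beta> \<in> box r d" "reflect r d (reflect r d \<beta>) = \<beta>"
    "mdeg \<beta> + mdeg (reflect r d \<beta>) = (\<Sum>j\<in>{1..<r}. d j - 1)"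
proof -
  show b: "reflect r d \<beta> \<in> box r d"
    using assms(1) by (auto simp: box_def in_keys_iff lookup_reflect split: if_splits)
  show "reflect r d (reflect r d \<beta>) = \<beta>"
  proof (rule poly_mapping_eqI)
    fix i
    note lookup_box_outside[OF assms(2), of i]
    moreover have "lk \<beta> i < d i" if "i \<in> {1..<r}" using that assms(2) by (auto simp: box_def)
    ultimately show "lk (reflect r d (reflect r d \<beta>)) i = lk \<beta> i"
      by (force simp: lookup_reflect)
  qed
  have "mdeg \<beta> + mdeg (reflect r d \<beta>) = (\<Sum>j\<in>{1..<r}. lk \<beta> j + (d j - 1 - lk \<beta> j))"
    unfolding mdeg_box[OF b] mdeg_box[OF assms(2)] sum.distrib by (simp add: lookup_reflect)
  also have "\<dots> = (\<Sum>j\<in>{1..<r}. d j - 1)"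
  proof (rule sum.cong[OF refl])
    fix j assume "j \<in> {1..<r}"
    then have "lk \<beta> j < d j" using assms(2) by (auto simp: box_def)
    then show "lk \<beta> j + (d j - 1 - lk \<beta> j) = d j - 1" by simp
  qed
  finally show "mdeg \<beta> + mdeg (reflect r d \<beta>) = (\<Sum>j\<in>{1..<r}. d j - 1)" .
qed

text \<open>Listing the nodes of each coordinate backwards keeps the grid but moves each index to
  its reflection, so an upper set becomes a lower set. The bound on \<open>b + c\<close> says that
  indices of degree below b reflect to degrees at least c, where \<open>v\<close> is known to
  vanish.\<close>

lemma zero_if_vanishes_above:
  fixes a :: "nat \<Rightarrow> 'k::field"
  assumes inj: "inj a" and dpos: "\<And>j. j \<in> {1..<r} \<Longrightarrow> 0 < d j"
    and b: "b \<le> e + 1" "1 \<le> r" "b + c \<le> (\<Sum>j\<in>{1..<r}. d j - 1) + 1"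
    and v: "v \<in> vs.span (xmonom ` low_std r d e b)"
    and z: "\<And>\<beta>. \<beta> \<in> box r d \<Longrightarrow> c \<le> mdeg \<beta> \<Longrightarrow> mpoly_eval (grid_point r (\<lambda>_. a) \<beta>) v = 0"
  shows "v = 0"
proof (rule zero_if_vanishes_below[OF _ b(1,2) v])
  let ?a = "\<lambda>i l. a (d i - 1 - l)"
  show "inj_on (?a i) {..<d i}" for i
  proof (rule inj_onI)
    fix x y assume xy: "x \<in> {..<d i}" "y \<in> {..<d i}" "?a i x = ?a i y"
    then have "d i - 1 - x = d i - 1 - y" using inj by (simp add: inj_eq)
    then show "x = y" using xy by auto
  qed
  fix \<beta> assume \<beta>: "\<beta> \<in> box r d" "mdeg \<beta> < b"
  have "grid_point r ?a \<beta> = grid_point r (\<lambda>_. a) (reflect r d \<beta>)"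
    by (auto simp: grid_point_def lookup_reflect)
  moreover have "c \<le> mdeg (reflect r d \<beta>)"
    using reflect_box(3)[OF dpos \<beta>(1)] \<beta>(2) b by simp
  ultimately show "mpoly_eval (grid_point r ?a \<beta>) v = 0"
    using z reflect_box(1)[OF dpos \<beta>(1)] by simp
qed

text \<open>A multiple t of a function that is nonzero at the new point is added. Each point rules
  out at most one value of t, and the field is infinite.\<close>

lemma nonvanishing_combination:
  fixes ev :: "'y \<Rightarrow> 'g \<Rightarrow> 'k::field"
  assumes "infinite (UNIV :: 'k set)" "finite Y" "finite \<Gamma>" "\<And>y. y \<in> Y \<Longrightarrow> \<exists>\<gamma>\<in>\<Gamma>. ev y \<gamma> \<noteq> 0"
  shows "\<exists>c. \<forall>y\<in>Y. (\<Sum>\<gamma>\<in>\<Gamma>. c \<gamma> * ev y \<gamma>) \<noteq> 0"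
  using assms(2,4)
proof (induction Y rule: finite_induct)
  case (insert y Y)
  then obtain c where c: "\<forall>y\<in>Y. (\<Sum>\<gamma>\<in>\<Gamma>. c \<gamma> * ev y \<gamma>) \<noteq> 0" by auto
  obtain \<gamma>0 where g: "\<gamma>0 \<in> \<Gamma>" "ev y \<gamma>0 \<noteq> 0" using insert by auto
  let ?s = "\<lambda>z. \<Sum>\<gamma>\<in>\<Gamma>. c \<gamma> * ev z \<gamma>"
  have "finite ((\<lambda>z. - ?s z / ev z \<gamma>0) ` insert y Y)" using insert by simp
  then obtain t where t: "t \<notin> (\<lambda>z. - ?s z / ev z \<gamma>0) ` insert y Y"
    using assms(1) ex_new_if_finite by blast
  have s: "(\<Sum>\<gamma>\<in>\<Gamma>. (c(\<gamma>0 := c \<gamma>0 + t)) \<gamma> * ev z \<gamma>) = ?s z + t * ev z \<gamma>0" for z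
  proof -
    have "(\<Sum>\<gamma>\<in>\<Gamma>. (c(\<gamma>0 := c \<gamma>0 + t)) \<gamma> * ev z \<gamma>)
        = (\<Sum>\<gamma>\<in>\<Gamma>. c \<gamma> * ev z \<gamma> + (if \<gamma> = \<gamma>0 then t * ev z \<gamma> else 0))"
      by (intro sum.cong) (auto simp: algebra_simps)
    then show ?thesis using g assms(3) by (simp add: sum.distrib)
  qed
  have "?s z + t * ev z \<gamma>0 \<noteq> 0" if z: "z \<in> insert y Y" for z
  proof (cases "ev z \<gamma>0 = 0")
    case True
    then show ?thesis using c z g by auto
  next
    case False
    have "t \<noteq> - ?s z / ev z \<gamma>0" using t z by blast
    then show ?thesis using False by (auto simp: field_simps eq_neg_iff_add_eq_0 add.commute)
  qed
  then show ?case unfolding s[symmetric] by blast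
qed simp

lemma subexponent:
  assumes "t \<le> mdeg \<beta>"
  shows "\<exists>\<gamma>. (\<forall>i. lk \<gamma> i \<le> lk \<beta> i) \<and> mdeg \<gamma> = t"
  using assms
proof (induction "mdeg \<beta> - t" arbitrary: t)
  case 0
  then show ?case by (intro exI[of _ \<beta>]) auto
next
  case (Suc x)
  have "x = mdeg \<beta> - Suc t" "Suc t \<le> mdeg \<beta>" using Suc.hyps(2) by auto
  from Suc.hyps(1)[OF this] obtain \<gamma> where g: "\<And>i. lk \<gamma> i \<le> lk \<beta> i" "mdeg \<gamma> = Suc t"
    by auto
  then have "\<gamma> \<noteq> 0" by auto
  then obtain j where j: "lk \<gamma> j \<noteq> 0" by (metis poly_mapping_eqI lookup_zero)
  have "lk (sg j 1) i \<le> lk \<gamma> i" for i using j by (auto simp: lookup_single when_def)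
  note D = expo_diff[of "sg j 1" \<gamma>, OF this]
  have "mdeg (\<gamma> - sg j 1) = t" using arg_cong[OF D(1), of mdeg] g by simp
  moreover have "lk (\<gamma> - sg j 1) i \<le> lk \<beta> i" for i using D(2)[of i] g(1)[of i] by simp
  ultimately show ?case by blast
qed

text \<open>All Newton polynomials of degree exactly b vanish at indices of smaller degree. An index
  of degree at least b dominates some \<open>\<gamma>\<close> of degree b, whose polynomial is
  nonzero there. A suitable combination is nonzero at all these finitely many points at
  once.\<close>

lemma ex_grid_cutting_form:
  fixes a :: "nat \<Rightarrow> 'k::field"
  assumes inf: "infinite (UNIV :: 'k set)" and inj: "inj a" and r: "1 \<le> r"
  shows "\<exists>G \<in> forms r b. \<forall>\<beta>\<in>box r d. mpoly_eval (grid_point r (\<lambda>_. a) \<beta>) G = 0 \<longleftrightarrow> mdeg \<beta> < b"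
proof -
  let ?\<Gamma> = "{\<gamma> \<in> box r d. mdeg \<gamma> = b}"
  let ?ev = "\<lambda>\<beta> \<gamma>. mpoly_eval (grid_point r (\<lambda>_. a) \<beta>) (newton r (\<lambda>_. a) \<gamma>)"
  have "\<exists>c. \<forall>\<beta>\<in>{\<beta> \<in> box r d. b \<le> mdeg \<beta>}. (\<Sum>\<gamma>\<in>?\<Gamma>. c \<gamma> * ?ev \<beta> \<gamma>) \<noteq> 0"
  proof (rule nonvanishing_combination[OF inf])
    fix \<beta> assume \<beta>: "\<beta> \<in> {\<beta> \<in> box r d. b \<le> mdeg \<beta>}"
    then obtain \<gamma> where g: "\<And>i. lk \<gamma> i \<le> lk \<beta> i" "mdeg \<gamma> = b" using subexponent by blast
    have "ks \<gamma> \<subseteq> ks \<beta>"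
    proof
      fix i assume "i \<in> ks \<gamma>"
      then show "i \<in> ks \<beta>" using g(1)[of i] by (simp add: in_keys_iff)
    qed
    then have "\<gamma> \<in> ?\<Gamma>" using \<beta> g(2) by (auto simp: box_def intro: le_less_trans[OF g(1)])
    moreover have "?ev \<beta> \<gamma> \<noteq> 0"
      by (rule eval_newton_neq_0[where d = d]) (use \<beta> g inj in \<open>auto intro: inj_on_subset\<close>)
    ultimately show "\<exists>\<gamma>\<in>?\<Gamma>. ?ev \<beta> \<gamma> \<noteq> 0" by blast
  qed auto
  then obtain c where c: "\<And>\<beta>. \<beta> \<in> box r d \<Longrightarrow> b \<le> mdeg \<beta> \<Longrightarrow> (\<Sum>\<gamma>\<in>?\<Gamma>. c \<gamma> * ?ev \<beta> \<gamma>) \<noteq> 0"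
    by auto
  define G where "G = (\<Sum>\<gamma>\<in>?\<Gamma>. scl (c \<gamma>) (newton r (\<lambda>_. a) \<gamma>))"
  have ev: "mpoly_eval (grid_point r (\<lambda>_. a) \<beta>) G = (\<Sum>\<gamma>\<in>?\<Gamma>. c \<gamma> * ?ev \<beta> \<gamma>)" for \<beta>
    by (simp add: G_def mpoly_eval_sum mpoly_eval_scl)
  have "G \<in> forms r b"
  proof -
    have "newton r (\<lambda>_. a) \<gamma> \<in> forms r b" if "\<gamma> \<in> ?\<Gamma>" for \<gamma>
      using newton_forms[of \<gamma> r d "\<lambda>_. a"] that by auto
    then show ?thesis unfolding G_def forms_def by (intro vs.span_sum vs.span_scale)
  qed
  moreover have "mpoly_eval (grid_point r (\<lambda>_. a) \<beta>) G = 0"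
    if \<beta>: "\<beta> \<in> box r d" "mdeg \<beta> < b" for \<beta>
  proof -
    have "?ev \<beta> \<gamma> = 0" if g: "\<gamma> \<in> ?\<Gamma>" for \<gamma>
    proof -
      have "\<exists>i\<in>{1..<r}. lk \<beta> i < lk \<gamma> i"
      proof (rule ccontr)
        assume "\<not> ?thesis"
        then have "(\<Sum>i\<in>{1..<r}. lk \<gamma> i) \<le> (\<Sum>i\<in>{1..<r}. lk \<beta> i)"
          by (intro sum_mono) (auto simp: not_less)
        then show False using g \<beta> mdeg_box[of \<gamma> r d] mdeg_box[of \<beta> r d] by auto
      qed
      then show ?thesis using eval_newton_eq_0 by blast
    qed
    then show ?thesis by (simp add: ev)
  qed
  ultimately show ?thesis using c unfolding ev[symmetric] by (intro bexI[of _ G]) force+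
qed

lemma lookup_lin_prod:
  assumes "i \<noteq> r"
  shows "lk (\<Prod>l<k. lin r i (c l)) (sg i k) = (1 :: 'k::field)"
proof (induction k)
  case (Suc k)
  let ?p = "\<Prod>l<k. lin r i (c l)"
  have "lk (sg (sg r 1) (c k) * ?p) (sg i (Suc k)) = 0"
  proof (rule lookup_monom_mult_eq_0)
    fix \<kappa> :: expo
    have "lk (sg i (Suc k)) r \<noteq> lk (sg r 1 + \<kappa>) r"
      using assms by (simp add: lookup_add lookup_single)
    then show "sg i (Suc k) \<noteq> sg r 1 + \<kappa>" by metis
  qed
  moreover have "sg i (Suc k) = sg i 1 + sg i k"
    by (metis Suc_eq_plus1_left single_add)
  then have "lk (xmonom (sg i 1) * ?p) (sg i (Suc k)) = 1"
    using lookup_monom_mult[of "sg i 1" 1 ?p "sg i k"] Suc by simp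
  moreover have "(\<Prod>l<Suc k. lin r i (c l)) = xmonom (sg i 1) * ?p - sg (sg r 1) (c k) * ?p"
    by (simp add: lin_def algebra_simps)
  ultimately show ?case by (simp add: lookup_minus)
qed simp

text \<open>This concerns the special sequence itself and does not follow from the generic case:
  once evaluation on the grid has removed the cofactors of f_r and f_m, a relation among the forms
  that cut out the grid remains. These forms resemble powers, since x_j^{d_j} has coefficient 1 and
  no other x_i with i < r occurs in the j-th form.\<close>

lemma indep_red_grid:
  fixes g :: "nat \<Rightarrow> 'k::field mpoly"
  assumes g: "\<And>j. j \<in> {1..<r} \<Longrightarrow> g j = (\<Prod>l<d j. lin r j (a l))"
  shows "indep (red r d (r - 1) e) (wm g)"
  unfolding indep_def
proof (rule ccontr)
  let ?T = "red r d (r - 1) e"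
  assume "\<not> (\<forall>q. (\<Sum>t\<in>?T. scl (q t) (wm g t)) = 0 \<longrightarrow> (\<forall>t\<in>?T. q t = 0))"
  then obtain q where q: "(\<Sum>t\<in>?T. scl (q t) (wm g t)) = 0" and "\<exists>t\<in>?T. q t \<noteq> 0" by blast
  then have ex: "\<exists>j \<alpha>. (j, \<alpha>) \<in> ?T \<and> q (j, \<alpha>) \<noteq> 0" by auto
  \<comment> \<open>With j least in the support of the relation and \<open>\<alpha>\<close> of
    largest x_j-exponent for this j, the monomial x^\<alpha> x_j^{d_j} occurs in no other product of
    the relation. For i > j the cofactor has x_j-exponent below \<open>d j\<close> and the form
    contributes no x_j. For i = j maximality forces the pure power and so the same cofactor.\<close>
  define j where "j = (LEAST j. \<exists>\<alpha>. (j, \<alpha>) \<in> ?T \<and> q (j, \<alpha>) \<noteq> 0)"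
  have j: "\<exists>\<alpha>. (j, \<alpha>) \<in> ?T \<and> q (j, \<alpha>) \<noteq> 0"
    unfolding j_def by (rule LeastI_ex[OF ex])
  have jmin: "j \<le> i" if "(i, \<beta>) \<in> ?T" "q (i, \<beta>) \<noteq> 0" for i \<beta>
    unfolding j_def by (rule Least_le) (use that in blast)
  let ?S = "{\<alpha>. (j, \<alpha>) \<in> ?T \<and> q (j, \<alpha>) \<noteq> 0}"
  have "finite ?S"
    by (rule finite_subset[of _ "snd ` ?T"]) force+
  moreover have "?S \<noteq> {}" using j by auto
  ultimately have fin: "finite ((\<lambda>\<alpha>. lk \<alpha> j) ` ?S)" and "(\<lambda>\<alpha>. lk \<alpha> j) ` ?S \<noteq> {}"
    by blast+
  then have "Max ((\<lambda>\<alpha>. lk \<alpha> j) ` ?S) \<in> (\<lambda>\<alpha>. lk \<alpha> j) ` ?S" by (rule Max_in)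
  then obtain \<alpha>' where "\<alpha>' \<in> ?S" "Max ((\<lambda>\<alpha>. lk \<alpha> j) ` ?S) = lk \<alpha>' j" by (rule imageE)
  then have "\<exists>\<alpha>\<in>?S. \<forall>\<beta>\<in>?S. lk \<beta> j \<le> lk \<alpha> j"
    using Max_ge[OF fin imageI] by (intro bexI[of _ \<alpha>']) simp_all
  then obtain \<alpha> where \<alpha>: "(j, \<alpha>) \<in> ?T" "q (j, \<alpha>) \<noteq> 0"
    and amax: "\<And>\<beta>. (j, \<beta>) \<in> ?T \<Longrightarrow> q (j, \<beta>) \<noteq> 0 \<Longrightarrow> lk \<beta> j \<le> lk \<alpha> j" by blast
  have jr: "j \<in> {1..<r}" using \<alpha>(1) by (auto simp: red_def)
  let ?\<kappa> = "\<alpha> + sg j (d j)"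
  have "q t * lk (wm g t) ?\<kappa> = 0" if t: "t \<in> ?T" "t \<noteq> (j, \<alpha>)" for t
  proof (rule ccontr)
    assume nz: "q t * lk (wm g t) ?\<kappa> \<noteq> 0"
    obtain i \<beta> where i: "t = (i, \<beta>)" by fastforce
    have ir: "i \<in> {1..<r}" using t i by (auto simp: red_def)
    have "?\<kappa> \<in> ks (xmonom \<beta> * g i)" using nz by (simp add: i wm_def in_keys_iff)
    then obtain \<mu> where m: "\<mu> \<in> ks (g i)" "?\<kappa> = \<beta> + \<mu>" using keys_monom_mult[of \<beta> 1 "g i"] by auto
    have mj: "lk \<mu> j \<le> (if j = i then d i else 0)"
      using keys_lin_prod[where \<mu> = \<mu> and k = "d i" and r = r and i = i and c = a and j = j] m(1) g[OF ir] jr by auto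
    have kj: "lk \<alpha> j + d j = lk \<beta> j + lk \<mu> j"
      using arg_cong[OF m(2), of "\<lambda>x. lk x j"] by (simp add: lookup_add)
    have "j \<le> i" using jmin t nz i by auto
    show False
    proof (cases "i = j")
      case True
      have "lk \<beta> j \<le> lk \<alpha> j" using amax t nz i True by auto
      then have mu: "lk \<mu> j = d j" using kj mj True by auto
      have "mdeg \<mu> = d j"
        using lin_prod_forms[where i = i and r = r and k = "d i" and c = a] m(1) g[OF ir] ir True by (auto simp: forms_iff monomials_def)
      moreover have le: "lk (sg j (d j)) x \<le> lk \<mu> x" for x using mu by (auto simp: lookup_single when_def)
      ultimately have "mdeg (\<mu> - sg j (d j)) = 0"
        using arg_cong[OF expo_diff(1)[of "sg j (d j)" \<mu>, OF le], of mdeg] by simp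
      then have "\<mu> - sg j (d j) = 0" by (rule mdeg_eq_0)
      then have "\<mu> = sg j (d j)"
        using expo_diff(1)[of "sg j (d j)" \<mu>, OF le] by (metis add.right_neutral)
      then show False using m(2) t i True by simp
    next
      case False
      then have "j \<in> {1..i-1}" using \<open>j \<le> i\<close> jr by auto
      then have "lk \<beta> j < d j" using t i by (auto simp: red_def std_def)
      then show False using kj mj False by simp
    qed
  qed
  then have "(\<Sum>t\<in>?T. q t * lk (wm g t) ?\<kappa>) = (\<Sum>t\<in>{(j, \<alpha>)}. q t * lk (wm g t) ?\<kappa>)"
    using \<alpha> by (intro sum.mono_neutral_right) auto
  also have "\<dots> = q (j, \<alpha>)"
    using lookup_monom_mult[of \<alpha> 1 "g j" "sg j (d j)"] lookup_lin_prod[where i = j and r = r and c = a and k = "d j"] g[OF jr] jr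
    by (simp add: wm_def)
  finally show False using arg_cong[OF q, of "\<lambda>p. lk p ?\<kappa>"] \<alpha>(2) by (simp add: lookup_sum)
qed

lemma low_std_subset: "low_std r d e b \<subseteq> std r d (r - 1) e"
  by (auto simp: low_std_def)

lemma low_std_eq_std:
  assumes "e < b"
  shows "low_std r d e b = std r d (r - 1) e"
proof -
  have "(\<Sum>i\<in>{1..<r}. lk \<beta> i) < b" if "\<beta> \<in> std r d (r - 1) e" for \<beta>
  proof -
    have "mdeg \<beta> = (\<Sum>i\<in>{1..r}. lk \<beta> i)" "mdeg \<beta> = e"
      using that mdeg_superset[of "{1..r}" \<beta>] by (auto simp: std_def monomials_def)
    moreover have "(\<Sum>i\<in>{1..<r}. lk \<beta> i) \<le> (\<Sum>i\<in>{1..r}. lk \<beta> i)"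
      by (rule sum_mono2) auto
    ultimately show ?thesis using assms by simp
  qed
  then show ?thesis by (auto simp: low_std_def)
qed

text \<open>The number b plays two roles: it bounds the cofactor of f_m and it is the degree where
  \<open>G\<close> stops vanishing. The cofactor of f_r, bounded by c, is left with zeros on the
  degrees from b on, and \<open>c + b\<close> is limited accordingly.\<close>

lemma indep_grid:
  fixes a :: "nat \<Rightarrow> 'k::field" and g :: "nat \<Rightarrow> 'k mpoly"
  assumes a: "inj a" and r: "1 \<le> r" "r < m" and dpos: "\<And>j. j \<in> {1..<r} \<Longrightarrow> 0 < d j"
    and g: "\<And>j. j \<in> {1..<r} \<Longrightarrow> g j = (\<Prod>l<d j. lin r j (a l))"
    and gr: "g r = xmonom (sg r (d r - b)) * G"
    and G: "\<And>\<beta>. \<beta> \<in> box r d \<Longrightarrow> mpoly_eval (grid_point r (\<lambda>_. a) \<beta>) G = 0 \<longleftrightarrow> mdeg \<beta> < b"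
    and gm: "g m = xmonom (sg r (d m))"
    and e: "b \<le> e - d m + 1" "c \<le> e - d r + 1" "c + b \<le> (\<Sum>j\<in>{1..<r}. d j - 1) + 1"
  shows "indep (red r d (r - 1) e \<union> ({r} \<times> low_std r d (e - d r) c \<union> {m} \<times> low_std r d (e - d m) b)) (wm g)"
    (is "indep (?A \<union> (?R \<union> ?M)) _")
  unfolding indep_def
proof (intro allI impI)
  fix q assume q: "(\<Sum>t\<in>?A \<union> (?R \<union> ?M). scl (q t) (wm g t)) = 0"
  define u where "u = (\<Sum>\<beta>\<in>low_std r d (e - d r) c. scl (q (r, \<beta>)) (xmonom \<beta>))"
  define v where "v = (\<Sum>\<beta>\<in>low_std r d (e - d m) b. scl (q (m, \<beta>)) (xmonom \<beta>))"
  define p where "p = (\<Sum>t\<in>?A. scl (q t) (wm g t))"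
  have S: "(\<Sum>t\<in>{i} \<times> S. scl (q t) (wm g t)) = (\<Sum>\<beta>\<in>S. scl (q (i, \<beta>)) (xmonom \<beta>)) * g i" for i S
  proof -
    have "(\<Sum>t\<in>{i} \<times> S. scl (q t) (wm g t)) = (\<Sum>\<beta>\<in>S. scl (q (i, \<beta>)) (wm g (i, \<beta>)))"
      by (rule sum.reindex_bij_witness[of _ "\<lambda>\<beta>. (i, \<beta>)" snd]) auto
    then show ?thesis by (simp add: sum_distrib_right wm_def scl_mult(1))
  qed
  have disj: "?A \<inter> (?R \<union> ?M) = {}" "?R \<inter> ?M = {}" using r by (auto simp: red_def)
  have "(\<Sum>t\<in>?A \<union> (?R \<union> ?M). scl (q t) (wm g t)) = p + (\<Sum>t\<in>?R \<union> ?M. scl (q t) (wm g t))"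
    unfolding p_def by (rule sum.union_disjoint) (use disj in auto)
  also have "(\<Sum>t\<in>?R \<union> ?M. scl (q t) (wm g t)) = u * g r + v * g m"
    by (subst sum.union_disjoint) (use disj in \<open>auto simp: S u_def v_def\<close>)
  finally have eq: "p + (u * g r + v * g m) = 0" using q by simp
  let ?ev = "\<lambda>\<beta>. mpoly_eval (grid_point r (\<lambda>_. a) \<beta>)"
  have evp: "?ev \<beta> p = 0" if \<beta>: "\<beta> \<in> box r d" for \<beta>
  proof -
    have "?ev \<beta> (wm g t) = 0" if t: "t \<in> ?A" for t
    proof -
      obtain j \<alpha> where j: "t = (j, \<alpha>)" by fastforce
      have jr: "j \<in> {1..<r}" using t j by (auto simp: red_def)
      have "?ev \<beta> (g j) = (\<Prod>l<d j. a (lk \<beta> j) - a l)"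
        using jr by (simp add: g mpoly_eval_prod eval_lin)
      also have "\<dots> = 0"
        using \<beta> jr by (intro prod_zero bexI[of _ "lk \<beta> j"]) (auto simp: box_def)
      finally show ?thesis by (simp add: j wm_def mpoly_eval_mult)
    qed
    then show ?thesis by (simp add: p_def mpoly_eval_sum mpoly_eval_scl)
  qed
  have ev: "?ev \<beta> u * ?ev \<beta> G + ?ev \<beta> v = 0" if \<beta>: "\<beta> \<in> box r d" for \<beta>
    using arg_cong[OF eq, of "?ev \<beta>"] evp[OF \<beta>]
    by (simp add: gr gm mpoly_eval_add mpoly_eval_mult eval_xr)
  have vs: "v \<in> vs.span (xmonom ` low_std r d (e - d m) b)"
    "u \<in> vs.span (xmonom ` low_std r d (e - d r) c)"
    unfolding u_def v_def by (intro vs.span_sum vs.span_scale vs.span_base imageI; assumption)+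
  have v0: "v = 0"
  proof (rule zero_if_vanishes_below[OF _ e(1) r(1) vs(1)])
    fix \<beta> assume "\<beta> \<in> box r d" "mdeg \<beta> < b"
    then show "?ev \<beta> v = 0" using ev[of \<beta>] G[of \<beta>] by simp
  qed (use a in \<open>auto intro: inj_on_subset\<close>)
  have u0: "u = 0"
  proof (rule zero_if_vanishes_above[OF a dpos e(2) r(1) e(3) vs(2)])
    fix \<beta> assume "\<beta> \<in> box r d" "b \<le> mdeg \<beta>"
    then show "?ev \<beta> u = 0" using ev[of \<beta>] G[of \<beta>] v0 by simp
  qed
  have "p = 0" using eq u0 v0 by simp
  then have A0: "\<forall>t\<in>?A. q t = 0"
    using indep_red_grid[OF g] unfolding p_def indep_def by blast
  have "q (r, \<beta>) = 0" if "\<beta> \<in> low_std r d (e - d r) c" for \<beta>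
    using indepD[OF indep_xmonom[of "\<lambda>x. x"], of "low_std r d (e - d r) c" "\<lambda>\<beta>. q (r, \<beta>)"] that u0
    by (simp add: u_def)
  moreover have "q (m, \<beta>) = 0" if "\<beta> \<in> low_std r d (e - d m) b" for \<beta>
    using indepD[OF indep_xmonom[of "\<lambda>x. x"], of "low_std r d (e - d m) b" "\<lambda>\<beta>. q (m, \<beta>)"] that v0
    by (simp add: v_def)
  ultimately show "\<forall>t\<in>?A \<union> (?R \<union> ?M). q t = 0" using A0 by auto
qed

section \<open>Maximal rank of multiplication by one more generic form\<close>

context generic_forms
begin

lemma indep_mixed:
  assumes r: "1 \<le> r" "r < m" "m \<le> n" and dpos: "\<And>j. j \<in> {1..<r} \<Longrightarrow> 0 < d j"
    and e: "b \<le> d r" "b \<le> e - d m + 1" "c \<le> e - d r + 1" "c + b \<le> (\<Sum>j\<in>{1..<r}. d j - 1) + 1"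
  shows "indep (red r d (r - 1) e \<union> ({r} \<times> low_std r d (e - d r) c \<union> {m} \<times> low_std r d (e - d m) b)) (wm f)"
proof -
  obtain a :: "nat \<Rightarrow> 'k" where a: "inj a"
    using infinite_field infinite_countable_subset[of "UNIV :: 'k set"] by auto
  obtain G where G: "G \<in> forms r b"
    "\<And>\<beta>. \<beta> \<in> box r d \<Longrightarrow> mpoly_eval (grid_point r (\<lambda>_. a) \<beta>) G = 0 \<longleftrightarrow> mdeg \<beta> < b"
    using ex_grid_cutting_form[OF infinite_field a r(1), of b d] by blast
  define g :: "nat \<Rightarrow> 'k mpoly" where "g = (\<lambda>j. if j = 0 then 1
     else if j < r then \<Prod>l<d j. lin r j (a l)
     else if j = r then xmonom (sg r (d r - b)) * G
     else if j = m then xmonom (sg r (d m)) else 0)"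
  show ?thesis
  proof (rule specialize[of g])
    show "g 0 = 1" by (simp add: g_def)
    show "ks (g i) \<subseteq> monomials {1..r} (d i)" if i: "i \<in> {1..n}" for i
      unfolding forms_iff[symmetric]
    proof -
      have xr: "(xmonom (sg r k) :: 'k mpoly) \<in> forms r k" for k
        using r by (intro xmonom_forms) (auto simp: monomials_def)
      have "xmonom (sg r (d r - b)) * G \<in> forms r (d r)"
        using forms_mult[OF xr G(1), of "d r - b"] e(1) by simp
      moreover have "(\<Prod>l<d i. lin r i (a l)) \<in> forms r (d i)" if "i < r"
        using lin_prod_forms[of i r] i that by auto
      moreover have "(0 :: 'k mpoly) \<in> forms r (d i)" by (simp add: forms_iff)
      ultimately show "g i \<in> forms r (d i)"
        using i xr by (simp add: g_def)
    qed
    show "fst ` (red r d (r - 1) e \<union> ({r} \<times> low_std r d (e - d r) c \<union> {m} \<times> low_std r d (e - d m) b)) \<subseteq> {0..n}"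
      using r by (auto simp: red_def)
    show "indep (red r d (r - 1) e \<union> ({r} \<times> low_std r d (e - d r) c \<union> {m} \<times> low_std r d (e - d m) b)) (wm g)"
    proof (rule indep_grid[OF a r(1,2) dpos _ _ G(2) _ e(2,3,4)])
      show "g j = (\<Prod>l<d j. lin r j (a l))" if "j \<in> {1..<r}" for j
        using that by (simp add: g_def)
      show "g r = xmonom (sg r (d r - b)) * G" "g m = xmonom (sg r (d m))"
        using r by (simp_all add: g_def)
    qed
  qed simp
qed

text \<open>With b = e - d_m + 1 and c = e - d_r + 1 the cutoffs remove nothing, so all cofactors
  that are standard for the first r - 1 forms are covered. The hypothesis
  \<open>e < d m + d r\<close> is b \<le> d_r, and the bound on \<open>2 * e + 1\<close> is b + c
  \<le> D + 1, where D is the sum of d_j - 1 over j < r.\<close>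

lemma multiplication_injective:
  assumes r: "1 \<le> r" "r < m" "m \<le> n" and dpos: "\<And>j. j \<in> {1..<r} \<Longrightarrow> 0 < d j"
    and e: "d r \<le> d m" "d m \<le> e" "e < d m + d r" "2 * e + 1 \<le> (\<Sum>j\<in>{1..<r}. d j - 1) + d r + d m"
    and h: "h \<in> forms r (e - d m)" "h * f m \<in> idl f r d r e"
  shows "h \<in> idl f r d r (e - d m)"
proof (rule regular_if_indep[OF _ _ _ e(2) _ h])
  have low: "low_std r d k (k + 1) = std r d (r - 1) k" for k
    by (rule low_std_eq_std) simp
  have "indep (red r d (r - 1) e \<union>
      ({r} \<times> low_std r d (e - d r) (e - d r + 1) \<union> {m} \<times> low_std r d (e - d m) (e - d m + 1))) (wm f)"
    by (rule indep_mixed[OF r dpos]) (use e in auto)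
  then show "indep (red r d r e \<union> {m} \<times> std r d r (e - d m)) (wm f)"
  proof (rule indep_mono)
    have "std r d r (e - d m) \<subseteq> std r d (r - 1) (e - d m)" by (auto simp: std_def)
    moreover have "red r d r e \<subseteq> red r d (r - 1) e \<union> {r} \<times> std r d (r - 1) (e - d r)"
      using red_Suc[of r d "r - 1" e] r by (auto split: if_splits)
    ultimately show "red r d r e \<union> {m} \<times> std r d r (e - d m) \<subseteq> red r d (r - 1) e \<union>
      ({r} \<times> low_std r d (e - d r) (e - d r + 1) \<union> {m} \<times> low_std r d (e - d m) (e - d m + 1))"
      unfolding low by blast
  qed simp
qed (use r in auto)

text \<open>The complementary range. If b + c = D + 1, the reflection embeds the indices of degree
  at least b into those of degree below c. The two families of cofactors together are then at least
  as numerous as the box, hence as the standard monomials that have to be reached.\<close>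

lemma idl_full:
  assumes r: "1 \<le> r" "r < m" "m \<le> n" and dpos: "\<And>j. j \<in> {1..<r} \<Longrightarrow> 0 < d j"
    and e: "d r \<le> e" "d m \<le> e" "(\<Sum>j\<in>{1..<r}. d j - 1) \<le> d r + d m"
      "(\<Sum>j\<in>{1..<r}. d j - 1) + d r + d m \<le> 2 * e + 1"
  shows "forms r e \<subseteq> idl f r d m e"
proof -
  let ?D = "\<Sum>j\<in>{1..<r}. d j - 1"
  \<comment> \<open>The largest b allowed by the three constraints of \<open>indep_mixed\<close>:
    that c is not truncated, that \<open>G\<close> fits into degree d_r, and that the cofactors of
    f_m have degree e - d_m.\<close>
  define b where "b = min (?D + 1) (min (d r) (e - d m + 1))"
  define c where "c = ?D + 1 - b"
  let ?T = "red r d (r - 1) e \<union> ({r} \<times> low_std r d (e - d r) c \<union> {m} \<times> low_std r d (e - d m) b)"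
  have b: "b \<le> d r" "b \<le> e - d m + 1" by (auto simp: b_def)
  \<comment> \<open>If b = D + 1 then c = 0. If b = d_r the claim amounts to D \<le> e, which
    follows from the two inequalities on D. If b = e - d_m + 1 it is the lower bound on
    \<open>2 * e + 1\<close>.\<close>
  have c: "c \<le> e - d r + 1" using e by (auto simp: c_def b_def min_def)
  have sub: "?T \<subseteq> fam r d m e"
    using red_subset_fam[of r d "r - 1" e] low_std_subset[of r d] std_subset[of r d "r - 1"] e r
    by (fastforce simp: fam_def)
  have card_low: "card (low_std r d k x) = card {\<gamma> \<in> box r d. mdeg \<gamma> < x}" if "x \<le> k + 1" for k x
    using bij_betw_same_card[OF bij_low_std[OF that r(1), of d]] by simp
  have "card {\<gamma> \<in> box r d. b \<le> mdeg \<gamma>} \<le> card {\<gamma> \<in> box r d. mdeg \<gamma> < c}"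
  proof (rule card_inj_on_le[of "reflect r d"])
    show "inj_on (reflect r d) {\<gamma> \<in> box r d. b \<le> mdeg \<gamma>}"
      by (rule inj_on_inverseI[of _ "reflect r d"]) (use reflect_box(2)[OF dpos] in auto)
    show "reflect r d ` {\<gamma> \<in> box r d. b \<le> mdeg \<gamma>} \<subseteq> {\<gamma> \<in> box r d. mdeg \<gamma> < c}"
    proof (rule image_subsetI)
      fix \<gamma> assume g: "\<gamma> \<in> {\<gamma> \<in> box r d. b \<le> mdeg \<gamma>}"
      have "reflect r d \<gamma> \<in> box r d" "mdeg \<gamma> + mdeg (reflect r d \<gamma>) = ?D"
        using g reflect_box(1)[OF dpos, where \<beta> = \<gamma>] reflect_box(3)[OF dpos, where \<beta> = \<gamma>] by auto
      then show "reflect r d \<gamma> \<in> {\<gamma> \<in> box r d. mdeg \<gamma> < c}"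
        using g by (auto simp: c_def)
    qed
  qed simp
  moreover have "card (box r d) = card {\<gamma> \<in> box r d. mdeg \<gamma> < b} + card {\<gamma> \<in> box r d. b \<le> mdeg \<gamma>}"
    by (subst card_Un_disjoint[symmetric]) (auto intro!: arg_cong[of _ _ card])
  ultimately have cb: "card (box r d) \<le> card (low_std r d (e - d r) c) + card (low_std r d (e - d m) b)"
    using card_low[OF c] card_low[OF b(2)] by simp
  have low: "std r d (r - 1) e = low_std r d e (e + 1)"
    by (rule low_std_eq_std[symmetric]) simp
  have "card (std r d (r - 1) e) \<le> card (box r d)"
    unfolding low card_low[OF order_refl] by (rule card_mono) auto
  moreover have "card (monomials {1..r} e) = card (red r d (r - 1) e) + card (std r d (r - 1) e)"
  proof -
    have "card (monomials {1..r} e) = card (red r d (r - 1) e \<union> {0} \<times> std r d (r - 1) e)"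
      using bij_betw_same_card[OF bij_lead_index[of "r - 1" r d e]] by simp
    also have "\<dots> = card (red r d (r - 1) e) + card ({0 :: nat} \<times> std r d (r - 1) e)"
      by (rule card_Un_disjoint) (simp, simp, auto simp: red_def)
    finally show ?thesis by (simp add: card_cartesian_product)
  qed
  moreover have "card ?T = card (red r d (r - 1) e) + (card (low_std r d (e - d r) c) + card (low_std r d (e - d m) b))"
  proof -
    have "card ?T = card (red r d (r - 1) e) + card ({r} \<times> low_std r d (e - d r) c \<union> {m} \<times> low_std r d (e - d m) b)"
      using r by (intro card_Un_disjoint) (simp, simp, auto simp: red_def)
    also have "card ({r} \<times> low_std r d (e - d r) c \<union> {m} \<times> low_std r d (e - d m) b) =
        card ({r} \<times> low_std r d (e - d r) c) + card ({m} \<times> low_std r d (e - d m) b)"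
      using r by (intro card_Un_disjoint) auto
    finally show ?thesis by (simp add: card_cartesian_product)
  qed
  ultimately have card: "card (monomials {1..r} e) \<le> card ?T" using cb by linarith
  have "forms r e \<subseteq> vs.span (wm f ` ?T)"
  proof (rule spans_if_card[OF _ _ _ card])
    show "indep ?T (wm f)"
      by (rule indep_mixed[OF r dpos b c]) (use b e in \<open>auto simp: c_def b_def\<close>)
    show "wm f ` ?T \<subseteq> forms r e" using wm_forms[of _ m e] sub r by blast
  qed simp
  also have "\<dots> \<subseteq> idl f r d m e"
    unfolding idl_def by (intro vs.span_mono image_mono sub)
  finally show ?thesis .
qed

end

subsection \<open>Setting the last variables to zero\<close>

text \<open>Reduction modulo x_{r+1}, x_{r+2}, ..., realized inside the same polynomial type as a
  ring endomorphism, so that restrictions can be composed and compared directly.\<close>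

definition res :: "nat \<Rightarrow> 'k::field mpoly \<Rightarrow> 'k mpoly"
  where "res r p = (\<Sum>\<mu> | \<mu> \<in> ks p \<and> ks \<mu> \<subseteq> {1..r}. sg \<mu> (lk p \<mu>))"

lemma lookup_res: "lk (res r p) \<mu> = (if ks \<mu> \<subseteq> {1..r} then lk p \<mu> else 0)"
proof -
  have "lk (res r p) \<mu> = (\<Sum>\<nu> | \<nu> \<in> ks p \<and> ks \<nu> \<subseteq> {1..r}. if \<nu> = \<mu> then lk p \<mu> else 0)"
    unfolding res_def lookup_sum by (intro sum.cong) (auto simp: lookup_single when_def)
  then show ?thesis by (auto simp: in_keys_iff)
qed

lemma res_add: "res r (p + q) = res r p + res r q"
  by (rule poly_mapping_eqI) (simp add: lookup_res lookup_add)

lemma res_diff: "res r (p - q) = res r p - res r q"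
  by (rule poly_mapping_eqI) (simp add: lookup_res lookup_minus)

lemma res_scl: "res r (scl c p) = scl c (res r p)"
  by (rule poly_mapping_eqI) (simp add: lookup_res)

lemma res_zero [simp]: "res r 0 = 0"
  by (rule poly_mapping_eqI) (simp add: lookup_res)

lemma res_sum: "res r (sum g S) = (\<Sum>x\<in>S. res r (g x))"
  by (induction S rule: infinite_finite_induct) (auto simp: res_add)

lemma res_single: "res r (sg \<mu> c) = (if ks \<mu> \<subseteq> {1..r} then sg \<mu> c else 0)"
  by (rule poly_mapping_eqI) (auto simp: lookup_res lookup_single when_def)

lemma res_one [simp]: "res r 1 = 1"
  using res_single[of r 0 1] by simp

lemma res_mult: "res r (p * q) = res r p * res r q"
proof (induction p rule: poly_mapping_add_induct)
  case (single k v)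
  show ?case
  proof (induction q rule: poly_mapping_add_induct)
    case (single l w)
    show ?case by (auto simp: mult_single res_single keys_add_nat)
  qed (auto simp: res_add distrib_left)
qed (auto simp: res_add distrib_right)

lemma res_res: "r \<le> m \<Longrightarrow> res r (res m p) = res r p"
  by (rule poly_mapping_eqI) (auto simp: lookup_res dest: subset_trans[of _ "{1..r}" "{1..m}"])

lemma keys_res: "ks (res r p) = {\<mu> \<in> ks p. ks \<mu> \<subseteq> {1..r}}"
proof (rule Set.set_eqI)
  fix \<mu>
  show "\<mu> \<in> ks (res r p) \<longleftrightarrow> \<mu> \<in> {\<mu> \<in> ks p. ks \<mu> \<subseteq> {1..r}}"
    using in_keys_iff[of \<mu> "res r p"] in_keys_iff[of \<mu> p] by (auto simp: lookup_res)
qed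

lemma res_forms: "p \<in> forms m e \<Longrightarrow> res r p \<in> forms r e"
  by (auto simp: forms_iff keys_res monomials_def)

lemma res_wm: "res r (wm f (i, \<alpha>)) = (if ks \<alpha> \<subseteq> {1..r} then wm (\<lambda>i. res r (f i)) (i, \<alpha>) else 0)"
  by (simp add: wm_def res_mult res_single)

lemma res_idl:
  assumes "r \<le> m"
  shows "res r ` idl f m d k e = idl (\<lambda>i. res r (f i)) r d k e"
proof (intro equalityI subsetI)
  fix q assume "q \<in> res r ` idl f m d k e"
  then obtain p where p: "p \<in> vs.span (wm f ` fam m d k e)" "q = res r p" by (auto simp: idl_def)
  from p(1) have "res r p \<in> idl (\<lambda>i. res r (f i)) r d k e"
  proof (induction p rule: vs.span_induct_alt)
    case base
    then show ?case by (simp add: idl_def vs.span_zero)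
  next
    case (step c x y)
    then obtain j \<alpha> where j: "x = wm f (j, \<alpha>)" "(j, \<alpha>) \<in> fam m d k e" by auto
    have "res r x \<in> idl (\<lambda>i. res r (f i)) r d k e"
    proof (cases "ks \<alpha> \<subseteq> {1..r}")
      case True
      then have "(j, \<alpha>) \<in> fam r d k e" using j by (auto simp: fam_def monomials_def)
      then show ?thesis using True by (auto simp: j res_wm idl_def intro: vs.span_base)
    qed (auto simp: j res_wm idl_def vs.span_zero)
    then show ?case
      using step by (auto simp: res_add res_scl idl_def intro: vs.span_add vs.span_scale)
  qed
  then show "q \<in> idl (\<lambda>i. res r (f i)) r d k e" by (simp add: p)
next
  fix q assume "q \<in> idl (\<lambda>i. res r (f i)) r d k e"
  then have "q \<in> vs.span (wm (\<lambda>i. res r (f i)) ` fam r d k e)" by (simp add: idl_def)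
  then show "q \<in> res r ` idl f m d k e"
  proof (induction q rule: vs.span_induct_alt)
    case base
    show ?case by (rule image_eqI[of _ _ 0]) (auto simp: idl_def vs.span_zero)
  next
    case (step c x y)
    then obtain j \<alpha> where j: "x = wm (\<lambda>i. res r (f i)) (j, \<alpha>)" "(j, \<alpha>) \<in> fam r d k e" by auto
    then have a: "ks \<alpha> \<subseteq> {1..r}" "(j, \<alpha>) \<in> fam m d k e"
      using assms by (auto simp: fam_def monomials_def)
    obtain y' where y': "y' \<in> idl f m d k e" "y = res r y'" using step by auto
    have "scl c (wm f (j, \<alpha>)) + y' \<in> idl f m d k e"
      using a y' by (auto simp: idl_def intro: vs.span_add vs.span_scale vs.span_base)
    moreover have "res r (scl c (wm f (j, \<alpha>)) + y') = scl c x + y"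
      using a by (simp add: res_add res_scl res_wm j y')
    ultimately show ?case by (metis image_eqI)
  qed
qed

lemma xmonom_mult_cancel: "xmonom \<alpha> * p = xmonom \<alpha> * q \<Longrightarrow> p = q"
  by (rule poly_mapping_eqI) (metis lookup_monom_mult mult_1)

text \<open>The last conclusion covers degree 0, where \<open>t - 1\<close> is truncated and the
  quotient must not be mistaken for a constant.\<close>

lemma divisible_by_last:
  assumes "1 \<le> m" "p \<in> forms m t" "res (m - 1) p = 0"
  obtains z where "p = xmonom (sg m 1) * z" "z \<in> forms m (t - 1)" "t = 0 \<Longrightarrow> z = 0"
proof -
  define z where "z = (\<Sum>\<mu>\<in>ks p. sg (\<mu> - sg m 1) (lk p \<mu>))"
  have key: "sg m 1 + (\<mu> - sg m 1) = \<mu>" if m: "\<mu> \<in> ks p" for \<mu>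
  proof -
    have mm: "ks \<mu> \<subseteq> {1..m}" using m assms(2) by (auto simp: forms_iff monomials_def)
    have "\<not> ks \<mu> \<subseteq> {1..m-1}"
      using arg_cong[OF assms(3), of "\<lambda>p. lk p \<mu>"] m by (auto simp: lookup_res in_keys_iff split: if_splits)
    then obtain i where "i \<in> ks \<mu>" "i \<notin> {1..m-1}" by blast
    then have "m \<in> ks \<mu>" using mm by (cases "i = m") force+
    then have "lk (sg m 1) i \<le> lk \<mu> i" for i by (auto simp: lookup_single when_def in_keys_iff)
    then show ?thesis by (rule expo_diff(1))
  qed
  have "xmonom (sg m 1) * z = (\<Sum>\<mu>\<in>ks p. sg \<mu> (lk p \<mu>))"
    unfolding z_def sum_distrib_left by (intro sum.cong refl) (simp only: mult_single key mult_1)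
  then have e: "p = xmonom (sg m 1) * z" using poly_mapping_expand[of p] by simp
  have mon: "\<mu> - sg m 1 \<in> monomials {1..m} (t - 1)" "1 \<le> t" if m: "\<mu> \<in> ks p" for \<mu>
  proof -
    have mm: "ks \<mu> \<subseteq> {1..m}" "mdeg \<mu> = t" using m assms(2) by (auto simp: forms_iff monomials_def)
    have "mdeg \<mu> = 1 + mdeg (\<mu> - sg m 1)" using arg_cong[OF key[OF m], of mdeg] by simp
    moreover have "ks (\<mu> - sg m 1) \<subseteq> ks \<mu>"
      using key[OF m] by (metis Un_upper2 keys_add_nat)
    ultimately show "\<mu> - sg m 1 \<in> monomials {1..m} (t - 1)" "1 \<le> t"
      using mm by (auto simp: monomials_def)
  qed
  have "z \<in> forms m (t - 1)"
    unfolding forms_iff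
  proof
    fix \<kappa> assume "\<kappa> \<in> ks z"
    then obtain \<mu> where "\<mu> \<in> ks p" "\<kappa> \<in> ks (sg (\<mu> - sg m 1) (lk p \<mu>))"
      unfolding z_def using keys_sum[of "\<lambda>\<mu>. sg (\<mu> - sg m 1) (lk p \<mu>)" "ks p"] by blast
    then show "\<kappa> \<in> monomials {1..m} (t - 1)" using mon(1)[of \<mu>] by (auto split: if_splits)
  qed
  moreover have "z = 0" if "t = 0"
  proof -
    have "ks p = {}" using mon(2) that by fastforce
    then show ?thesis by (simp add: z_def)
  qed
  ultimately show ?thesis using that e by blast
qed

lemma idl_Suc:
  assumes "p \<in> idl f r d (Suc k) e"
  obtains q u where "p = q + u * f (Suc k)" "q \<in> idl f r d k e" "u \<in> forms r (e - d (Suc k))"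
    "d (Suc k) \<le> e \<or> u = 0"
proof -
  let ?B = "if d (Suc k) \<le> e then {Suc k} \<times> monomials {1..r} (e - d (Suc k)) else {}"
  have "fam r d (Suc k) e = fam r d k e \<union> ?B"
    by (auto simp: fam_def le_Suc_eq)
  then have "p \<in> vs.span (wm f ` fam r d k e \<union> wm f ` ?B)"
    using assms by (simp only: idl_def image_Un)
  then obtain q s where qs: "p = q + s" "q \<in> idl f r d k e" "s \<in> vs.span (wm f ` ?B)"
    unfolding vs.span_Un idl_def by auto
  have "\<exists>u. s = u * f (Suc k) \<and> u \<in> forms r (e - d (Suc k)) \<and> (d (Suc k) \<le> e \<or> u = 0)"
    using qs(3)
  proof (induction s rule: vs.span_induct_alt)
    case base
    show ?case by (rule exI[of _ 0]) (simp add: forms_iff)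
  next
    case (step c x y)
    then obtain \<alpha> where a: "x = xmonom \<alpha> * f (Suc k)" "\<alpha> \<in> monomials {1..r} (e - d (Suc k))" "d (Suc k) \<le> e"
      by (auto simp: wm_def split: if_splits)
    obtain u where u: "y = u * f (Suc k)" "u \<in> forms r (e - d (Suc k))" using step by blast
    have "scl c (xmonom \<alpha>) + u \<in> forms r (e - d (Suc k))"
      using xmonom_forms[OF a(2)] u(2) unfolding forms_def by (intro vs.span_add vs.span_scale)
    moreover have "scl c x + y = (scl c (xmonom \<alpha>) + u) * f (Suc k)"
      by (simp add: a u distrib_right scl_mult(1))
    ultimately show ?case using a(3) by blast
  qed
  then show ?thesis using that qs by blast
qed

text \<open>A relation \<open>x\<^sub>m h = \<Sum> g\<^sub>i f\<^sub>i\<close> becomes a syzygy of the \<open>f\<^sub>i\<close> modulo \<open>x\<^sub>m\<close>. By regularity its last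
  coefficient lies in the ideal of the preceding forms, so it can be traded for a multiple of \<open>x\<^sub>m\<close>.\<close>

lemma last_variable_injective:
  assumes m: "1 \<le> m" and f: "\<And>i. i \<in> {1..k} \<Longrightarrow> f i \<in> forms m (d i)"
    and reg: "\<And>i h. i \<in> {1..k} \<Longrightarrow> d i \<le> e \<Longrightarrow> h \<in> forms (m - 1) (e - d i) \<Longrightarrow>
      h * res (m - 1) (f i) \<in> idl (\<lambda>i. res (m - 1) (f i)) (m - 1) d (i - 1) e \<Longrightarrow>
      h \<in> idl (\<lambda>i. res (m - 1) (f i)) (m - 1) d (i - 1) (e - d i)"
    and e: "1 \<le> e" and h: "h \<in> forms m (e - 1)" "xmonom (sg m 1) * h \<in> idl f m d k e"
  shows "h \<in> idl f m d k (e - 1)"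
  using f reg h
proof (induction k arbitrary: h)
  case 0
  have "idl f m d 0 e = {0}" by (simp add: idl_def fam_def)
  then have "xmonom (sg m 1) * h = xmonom (sg m 1) * 0" using 0 by simp
  then have "h = 0" by (rule xmonom_mult_cancel)
  then show ?case by (simp add: idl_def vs.span_zero)
next
  case (Suc k)
  let ?g = "\<lambda>i. res (m - 1) (f i)" and ?K = "Suc k"
  obtain p q where pq: "xmonom (sg m 1) * h = p + q * f ?K" "p \<in> idl f m d k e"
    "q \<in> forms m (e - d ?K)" "d ?K \<le> e \<or> q = 0"
    by (rule idl_Suc[OF Suc.prems(4)])
  have IH: "h' \<in> idl f m d k (e - 1)" if "h' \<in> forms m (e - 1)" "xmonom (sg m 1) * h' \<in> idl f m d k e" for h'
    by (rule Suc.IH[OF _ _ that]) (use Suc.prems(1,2) in auto)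
  show ?case
  proof (cases "d ?K \<le> e")
    case False
    then have "xmonom (sg m 1) * h \<in> idl f m d k e" using pq by simp
    then show ?thesis using IH[OF Suc.prems(3)] idl_mono[of k ?K f m d "e - 1"] by auto
  next
    case True
    have x0: "res (m - 1) (xmonom (sg m 1)) = 0" using m by (auto simp: res_single)
    have "0 = res (m - 1) p + res (m - 1) q * ?g ?K"
      using arg_cong[OF pq(1), of "res (m - 1)"] by (simp only: res_mult res_add x0 mult_zero_left)
    then have "res (m - 1) q * ?g ?K = - res (m - 1) p" by (simp add: eq_neg_iff_add_eq_0 add.commute)
    moreover have "res (m - 1) p \<in> idl ?g (m - 1) d k e"
      using res_idl[of "m - 1" m f d k e] pq(2) by auto
    ultimately have "res (m - 1) q * ?g ?K \<in> idl ?g (m - 1) d k e"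
      by (simp add: idl_def vs.span_neg)
    then have "res (m - 1) q \<in> idl ?g (m - 1) d k (e - d ?K)"
      using Suc.prems(2)[of ?K] True res_forms[OF pq(3)] by simp
    \<comment> \<open>Since \<open>q'\<close> and \<open>q\<close> agree modulo x_m, q f_{k+1} is q'
      f_{k+1} plus x_m z f_{k+1}. The former already lies in the ideal of the preceding forms. The
      latter is moved to the left-hand side, so that the induction hypothesis applies to h - z
      f_{k+1}.\<close>
    then obtain q' where q': "q' \<in> idl f m d k (e - d ?K)" "res (m - 1) q' = res (m - 1) q"
      using res_idl[of "m - 1" m f d k "e - d ?K"] by (metis diff_le_self imageE)
    have fh: "\<And>i. i \<in> {1..k} \<Longrightarrow> ks (f i) \<subseteq> monomials {1..m} (d i)"
      using Suc.prems(1) by (simp add: forms_iff)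
    have "q - q' \<in> forms m (e - d ?K)"
      using pq(3) q'(1) idl_forms[of k f m d "e - d ?K"] fh forms_diff by blast
    moreover have "res (m - 1) (q - q') = 0" using q' by (simp add: res_diff)
    ultimately obtain z where z: "q - q' = xmonom (sg m 1) * z" "z \<in> forms m (e - d ?K - 1)"
      "e - d ?K = 0 \<Longrightarrow> z = 0" using divisible_by_last[OF m] by blast
    have zf: "z * f ?K \<in> idl f m d ?K (e - 1)" "z * f ?K \<in> forms m (e - 1)"
    proof -
      show zf: "z * f ?K \<in> idl f m d ?K (e - 1)"
      proof (cases "e - d ?K = 0")
        case True
        then show ?thesis using z by (simp add: idl_def vs.span_zero)
      next
        case False
        then show ?thesis
          using z(2) by (intro idl_gen_mult) (auto simp: diff_diff_eq add.commute)
      qed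
      then show "z * f ?K \<in> forms m (e - 1)"
      proof -
        have "idl f m d ?K (e - 1) \<subseteq> forms m (e - 1)"
          by (rule idl_forms) (use Suc.prems(1) in \<open>simp add: forms_iff\<close>)
        then show ?thesis using zf by blast
      qed
    qed
    have "q' * f ?K \<in> idl f m d k e"
    proof -
      have "f ?K * q' \<in> idl f m d k (e - d ?K + d ?K)"
        using Suc.prems(1)[of ?K] q'(1) by (intro idl_mult) auto
      then show ?thesis using True by (simp add: mult.commute)
    qed
    moreover have "xmonom (sg m 1) * (h - z * f ?K) = p + q' * f ?K"
    proof -
      have "q = q' + xmonom (sg m 1) * z" using z(1) by (simp add: algebra_simps)
      then show ?thesis using pq(1) by (simp add: algebra_simps)
    qed
    ultimately have "xmonom (sg m 1) * (h - z * f ?K) \<in> idl f m d k e"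
      using pq(2) by (simp add: idl_def vs.span_add)
    then have "h - z * f ?K \<in> idl f m d k (e - 1)"
      using IH forms_diff[OF Suc.prems(3) zf(2)] by blast
    then have "h - z * f ?K \<in> idl f m d ?K (e - 1)" using idl_mono[of k ?K f m d "e - 1"] by auto
    from vs.span_add[OF this[unfolded idl_def] zf(1)[unfolded idl_def]]
    show ?thesis by (simp add: idl_def)
  qed
qed

text \<open>A form of degree at least e reaches degree e only if its degree equals e, and then only
  with a constant cofactor.\<close>

lemma idl_top_split:
  assumes "p \<in> idl f r d n e" "k \<le> n" "\<And>i. i \<in> {k<..n} \<Longrightarrow> e \<le> d i"
  obtains q c where "p = q + (\<Sum>i | i \<in> {k<..n} \<and> d i = e. scl (c i) (f i))" "q \<in> idl f r d k e"
proof -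
  let ?S = "{i. i \<in> {k<..n} \<and> d i = e}"
  have fS: "finite ?S" by simp
  have "fam r d n e \<subseteq> fam r d k e \<union> ?S \<times> {0}"
  proof
    fix t assume t: "t \<in> fam r d n e"
    obtain j \<alpha> where j: "t = (j, \<alpha>)" by fastforce
    show "t \<in> fam r d k e \<union> ?S \<times> {0}"
    proof (cases "j \<le> k")
      case True
      then show ?thesis using t j by (auto simp: fam_def)
    next
      case False
      then have jn: "j \<in> {k<..n}" "d j \<le> e" "mdeg \<alpha> = e - d j" using t j by (auto simp: fam_def monomials_def)
      then have "d j = e" "\<alpha> = 0" using assms(3)[of j] mdeg_eq_0 by auto
      then show ?thesis using j jn by auto
    qed
  qed
  then have "p \<in> vs.span (wm f ` fam r d k e \<union> wm f ` (?S \<times> {0}))"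
    using assms(1) vs.span_mono[of "wm f ` fam r d n e"] unfolding idl_def image_Un[symmetric]
    by (meson image_mono subsetD)
  moreover have "wm f ` (?S \<times> {0}) = f ` ?S" by (auto simp: wm_def image_iff)
  ultimately obtain q s where qs: "p = q + s" "q \<in> idl f r d k e" "s \<in> vs.span (f ` ?S)"
    unfolding vs.span_Un idl_def by auto
  from qs(3) obtain c where "s = (\<Sum>i\<in>?S. scl (c i) (f i))"
    unfolding span_image_eq[OF fS] by (rule rangeE)
  then show ?thesis using that[of q c] qs by simp
qed

lemma indep_reindex:
  assumes "indep U w" "finite U" "inj_on \<psi> T" "\<psi> ` T \<subseteq> U"
  shows "indep T (\<lambda>t. w (\<psi> t))"
  unfolding indep_def
proof (intro allI impI ballI)
  fix q t assume q: "(\<Sum>t\<in>T. scl (q t) (w (\<psi> t))) = 0" and t: "t \<in> T"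
  let ?q = "\<lambda>u. q (inv_into T \<psi> u)"
  have "(\<Sum>u\<in>\<psi> ` T. scl (?q u) (w u)) = (\<Sum>t\<in>T. scl (q t) (w (\<psi> t)))"
    by (subst sum.reindex[OF assms(3)]) (auto intro!: sum.cong simp: inv_into_f_f[OF assms(3)])
  then have "?q (\<psi> t) = 0"
    using indepD[OF indep_mono[OF assms(1,4,2)], of ?q "\<psi> t"] q t by simp
  then show "q t = 0" using t by (simp add: inv_into_f_f[OF assms(3)])
qed

context generic_forms
begin

text \<open>Generic forms of degree e are generic vectors modulo the ideal of the first k forms. A
  basis of the ideal piece is completed by monomials \<open>N\<close> to a basis of all forms, and
  top forms are specialized to distinct members of \<open>N\<close>. If there are enough monomials
  all top forms are independent modulo the ideal; otherwise as many forms as there are monomials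
  already fill the degree.\<close>

lemma generic_top_forms:
  fixes k e :: nat
  assumes kn: "k \<le> n"
  defines "S \<equiv> {i. i \<in> {k<..n} \<and> d i = e}"
  shows "forms r e \<subseteq> idl f r d n e \<or>
    (\<forall>c. (\<Sum>i\<in>S. scl (c i) (f i)) \<in> idl f r d k e \<longrightarrow> (\<forall>i\<in>S. c i = 0))"
proof -
  have fS: "finite S" by (simp add: S_def)
  let ?M = "{0 :: nat} \<times> monomials {1..r} e"
  obtain T0 where T0: "T0 \<subseteq> fam r d k e" "indep T0 (wm f)" "vs.span (wm f ` T0) = idl f r d k e"
    using indep_extend_spanning[of "fam r d k e" "{}" "wm f"] by (auto simp: idl_def indep_def)
  have fT0: "finite T0" using T0(1) finite_fam by (rule finite_subset)
  obtain U where U: "T0 \<subseteq> U" "U \<subseteq> T0 \<union> ?M" "indep U (wm f)"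
      "vs.span (wm f ` U) = vs.span (wm f ` (T0 \<union> ?M))"
    using indep_extend_spanning[of "T0 \<union> ?M" T0 "wm f"] fT0 T0(2) by auto
  have fU: "finite U" using U(2) fT0 by (auto intro: finite_subset)
  have disj: "T0 \<inter> S \<times> {0} = {}" using T0(1) by (auto simp: fam_def S_def)
  define N where "N = {\<nu>. (0, \<nu>) \<in> U}"
  have T00: "(0, \<nu>) \<notin> T0" for \<nu> using T0(1) by (auto simp: fam_def)
  have N: "N \<subseteq> monomials {1..r} e" using U(2) T00 by (auto simp: N_def)
  have fN: "finite N" using N by (rule finite_subset) simp
  have UN: "U = T0 \<union> {0} \<times> N" using U(1,2) by (auto simp: N_def)
  have special: "indep (T0 \<union> S' \<times> {0}) (wm f)" if S': "S' \<subseteq> S" "inj_on \<phi> S'" "\<phi> ` S' \<subseteq> N" for S' \<phi>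
  proof -
    \<comment> \<open>Forms outside \<open>S'\<close> stay generic, so the products in
      \<open>T0\<close> and their independence are untouched by the specialization.\<close>
    define g :: "nat \<Rightarrow> 'k mpoly" where "g = (\<lambda>i. if i \<in> S' then xmonom (\<phi> i) else f i)"
    show ?thesis
    proof (rule specialize[of g])
      show "g 0 = 1" using S' by (auto simp: g_def f_0 S_def)
      show "ks (g i) \<subseteq> monomials {1..r} (d i)" if "i \<in> {1..n}" for i
      proof (cases "i \<in> S'")
        case True
        then have "\<phi> i \<in> monomials {1..r} (d i)" using S' N by (auto simp: S_def)
        then show ?thesis using True by (simp add: g_def)
      next
        case False
        then show ?thesis using keys_f[OF that] by (simp add: g_def)
      qed
      have fS': "finite S'" using S'(1) fS by (rule finite_subset)
      then show "finite (T0 \<union> S' \<times> {0})" using fT0 by simp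
      show "fst ` (T0 \<union> S' \<times> {0}) \<subseteq> {0..n}"
        using T0(1) S'(1) kn by (force simp: fam_def S_def)
      \<comment> \<open>A top form specialized to a monomial is the same vector as that monomial at
        index 0, so independence is inherited from \<open>U\<close>.\<close>
      define \<psi> where "\<psi> = (\<lambda>t. if t \<in> T0 then t else (0 :: nat, \<phi> (fst t)))"
      have kS: "fst t \<notin> S'" if "t \<in> T0" for t
      proof -
        have "fst t \<le> k" using subsetD[OF T0(1) that] by (auto simp: fam_def)
        then show ?thesis using S'(1) by (auto simp: S_def)
      qed
      have "indep (T0 \<union> S' \<times> {0}) (\<lambda>t. wm f (\<psi> t))"
      proof (rule indep_reindex[OF U(3) fU])
        show "inj_on \<psi> (T0 \<union> S' \<times> {0})"
        proof (rule inj_onI)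
          fix s t assume st: "s \<in> T0 \<union> S' \<times> {0}" "t \<in> T0 \<union> S' \<times> {0}" "\<psi> s = \<psi> t"
          show "s = t"
          proof (cases "s \<in> T0 \<longleftrightarrow> t \<in> T0")
            case True
            then show ?thesis
              using st S'(2) by (cases "s \<in> T0") (auto simp: \<psi>_def dest: inj_onD)
          next
            case False
            then show ?thesis using st T00 by (auto simp: \<psi>_def split: if_splits)
          qed
        qed
        show "\<psi> ` (T0 \<union> S' \<times> {0}) \<subseteq> U" using S'(3) by (auto simp: \<psi>_def UN)
      qed
      moreover have "wm g t = wm f (\<psi> t)" if t: "t \<in> T0 \<union> S' \<times> {0}" for t
      proof (cases "t \<in> T0")
        case True
        then show ?thesis using kS[OF True] by (cases t) (auto simp: \<psi>_def wm_def g_def)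
      next
        case False
        then obtain i where "t = (i, 0)" "i \<in> S'" using t by auto
        then show ?thesis using False by (simp add: \<psi>_def wm_def g_def f_0)
      qed
      ultimately show "indep (T0 \<union> S' \<times> {0}) (wm g)" by (subst indep_cong) auto
    qed
  qed
  show ?thesis
  proof (cases "card S \<le> card N")
    case True
    then obtain \<phi> where \<phi>: "inj_on \<phi> S" "\<phi> ` S \<subseteq> N"
      using card_le_inj[OF fS fN] by blast
    have ind: "indep (T0 \<union> S \<times> {0}) (wm f)" by (rule special[OF order_refl \<phi>])
    have "c i = 0" if c: "(\<Sum>i\<in>S. scl (c i) (f i)) \<in> idl f r d k e" and i: "i \<in> S" for c i
    proof -
      have "(\<Sum>t\<in>S \<times> {0 :: expo}. scl (c (fst t)) (wm f t)) = (\<Sum>i\<in>S. scl (c i) (f i))"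
        by (rule sum.reindex_bij_witness[of _ "\<lambda>i. (i, 0)" fst]) (auto simp: wm_def)
      then have "(\<Sum>t\<in>S \<times> {0 :: expo}. scl (c (fst t)) (wm f t)) \<in> vs.span (wm f ` T0)"
        using c T0(3) by simp
      from indep_span_disjoint[OF ind disj fT0 _ this, of "(i, 0)"] show ?thesis using i fS by simp
    qed
    then show ?thesis by blast
  next
    case False
    then obtain \<phi> where \<phi>: "inj_on \<phi> N" "\<phi> ` N \<subseteq> S"
      using card_le_inj[OF fN fS] by auto
    let ?T = "T0 \<union> (\<phi> ` N) \<times> {0}"
    have ind: "indep ?T (wm f)"
    proof (rule special[OF \<phi>(2)])
      show "inj_on (inv_into N \<phi>) (\<phi> ` N)" by (rule inj_on_inv_into) simp
      show "inv_into N \<phi> ` \<phi> ` N \<subseteq> N" using \<phi>(1) by (auto simp: inv_into_f_f)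
    qed
    have sub: "?T \<subseteq> fam r d n e"
      using T0(1) \<phi>(2) kn by (force simp: fam_def S_def monomials_def)
    have "card (xmonom ` monomials {1..r} e :: 'k mpoly set) \<le> card (wm f ` U)"
    proof -
      have i: "indep (monomials {1..r} e) (\<lambda>x. xmonom x :: 'k mpoly)" by (rule indep_xmonom) auto
      have "(xmonom ` monomials {1..r} e :: 'k mpoly set) \<subseteq> vs.span (wm f ` U)"
      proof
        fix x :: "'k mpoly" assume "x \<in> xmonom ` monomials {1..r} e"
        then obtain \<alpha> where a: "\<alpha> \<in> monomials {1..r} e" "x = xmonom \<alpha>" by blast
        have "x \<in> wm f ` (T0 \<union> ?M)"
          by (rule image_eqI[of _ _ "(0, \<alpha>)"]) (use a in \<open>auto simp: wm_0\<close>)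
        then show "x \<in> vs.span (wm f ` U)" using U(4) by (simp add: vs.span_base)
      qed
      then show ?thesis
        using vs.independent_span_bound[OF finite_imageI[OF fU] indep_imp_independent(2)[OF _ i]] by simp
    qed
    moreover have "card (xmonom ` monomials {1..r} e :: 'k mpoly set) = card (monomials {1..r} e)"
      by (rule card_image) (auto intro!: inj_onI dest: arg_cong[of _ _ ks])
    moreover have "card (wm f ` U) \<le> card U" by (rule card_image_le[OF fU])
    moreover have "card U = card ?T"
    proof -
      have "card U = card T0 + card ({0 :: nat} \<times> N)"
        unfolding UN by (rule card_Un_disjoint) (use fT0 fN T00 in auto)
      moreover have "card ?T = card T0 + card ((\<phi> ` N) \<times> {0 :: expo})"
      proof (rule card_Un_disjoint)
        show "T0 \<inter> \<phi> ` N \<times> {0} = {}" using disj \<phi>(2) by blast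
      qed (use fT0 fN in auto)
      ultimately show ?thesis using card_image[OF \<phi>(1)] by (simp add: card_cartesian_product)
    qed
    ultimately have card: "card (monomials {1..r} e) \<le> card ?T" by simp
    have "forms r e \<subseteq> vs.span (wm f ` ?T)"
    proof (rule spans_if_card[OF _ ind _ card])
      show "wm f ` ?T \<subseteq> forms r e" using wm_forms[of _ n e] sub by blast
    qed (use fT0 fN in simp)
    also have "\<dots> \<subseteq> idl f r d n e" unfolding idl_def by (intro vs.span_mono image_mono sub)
    finally show ?thesis ..
  qed
qed

lemma idl_full_large:
  assumes "r \<le> n" "(\<Sum>j\<in>{1..r}. d j - 1) < e"
  shows "forms r e \<subseteq> idl f r d r e"
proof -
  have "std r d r e = {}"
  proof (rule ccontr)
    assume "std r d r e \<noteq> {}"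
    then obtain \<beta> where b: "\<beta> \<in> std r d r e" by auto
    then have "e = (\<Sum>j\<in>{1..r}. lk \<beta> j)"
      using mdeg_superset[of "{1..r}" \<beta>] by (auto simp: std_def monomials_def)
    also have "\<dots> \<le> (\<Sum>j\<in>{1..r}. d j - 1)"
    proof (rule sum_mono)
      fix j assume "j \<in> {1..r}"
      then have "lk \<beta> j < d j" using b by (auto simp: std_def)
      then show "lk \<beta> j \<le> d j - 1" by simp
    qed
    finally show False using assms by simp
  qed
  then show ?thesis using forms_subset_span[of r e] idl_eq_span_red[of r e] assms by simp
qed

end

subsection \<open>Multiplication by the last variable\<close>

lemma delta_eq:
  assumes "\<And>j. j \<in> {1..i} \<Longrightarrow> 0 < d j"
  shows "delta d i = int (\<Sum>j\<in>{1..i}. d j - 1)"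
proof -
  have "int (\<Sum>j\<in>{1..i}. d j - 1) = (\<Sum>j\<in>{1..i}. int (d j) - 1)"
    unfolding of_nat_sum
  proof (rule sum.cong[OF refl])
    fix j assume "j \<in> {1..i}"
    then have "0 < d j" by (rule assms)
    then show "int (d j - 1) = int (d j) - 1" by simp
  qed
  then show ?thesis by (simp add: delta_def sum_subtractf)
qed

text \<open>For m = 3 and m = 4 monotonicity suffices. For larger m the assumptions at m - 1 and at
  m offer two alternatives each. With w \<le> x \<le> y the last three degrees up to d_m, the
  alternative \<open>D k \<le> x\<close> gives the claim through w \<le> y, and
  \<open>D (k + 1) \<le> 2 * x + 1\<close> gives it when x < y.\<close>

lemma degree_bound:
  assumes dpos: "\<And>i. i \<in> {1..n} \<Longrightarrow> 0 < d i" and mono: "mono_on {1..n} d"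
    and sig: "\<And>i. i \<in> {4..n} \<Longrightarrow> sigma d (i - 1) \<le> int (d i)"
    and m: "3 \<le> m" "m \<le> n"
  shows "(\<Sum>j\<in>{1..<m - 1}. d j - 1) \<le> d (m - 1) + d m"
proof -
  define D where "D k = (\<Sum>j\<in>{1..k}. d j - 1)" for k
  have D_Suc: "D (Suc k) = D k + (d (Suc k) - 1)" for k by (simp add: D_def)
  have mono': "d i \<le> d j" if "1 \<le> i" "i \<le> j" "j \<le> n" for i j
    using mono that by (auto simp: mono_on_def)
  \<comment> \<open>The summand 1 in the second alternative is the loss from rounding \<delta>_{i-1}
    / 2 down.\<close>
  have sig': "D (i - 2) \<le> d i \<or> D (i - 1) \<le> 2 * d i + 1" if i: "4 \<le> i" "i \<le> n" for i
  proof -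
    have del: "delta d k = int (D k)" if "k \<le> n" for k
      unfolding D_def by (rule delta_eq) (use that dpos in auto)
    have "delta d (i - 1 - 1) = int (D (i - 2))" "delta d (i - 1) = int (D (i - 1))"
      using del[of "i - 2"] del[of "i - 1"] i by (simp_all add: numeral_2_eq_2)
    then have "min (int (D (i - 2))) (int (D (i - 1)) div 2) \<le> int (d i)"
      using sig[of i] i by (simp add: sigma_def)
    then show ?thesis by (auto simp: min_def split: if_splits)
  qed
  have "D (m - 2) \<le> d (m - 1) + d m"
  proof -
    define k where "k = m - 3"
    consider "m = 3" | "m = 4" | "m = k + 3" "2 \<le> k"
      using m unfolding k_def by linarith
    then show ?thesis
    proof cases
      case 1
      have "D 1 \<le> d 1" by (simp add: D_def)
      then show ?thesis using 1 m mono'[of 1 2] by simp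
    next
      case 2
      have "D 2 \<le> d 1 + d 2" by (simp add: D_def numeral_2_eq_2)
      then show ?thesis using 2 m mono'[of 1 3] mono'[of 2 4] by simp
    next
      case 3
      define w x y where "w = d (k + 1)" and "x = d (k + 2)" and "y = d (k + 3)"
      have le: "0 < w" "w \<le> x" "x \<le> y" "0 < x"
        using 3 m mono'[of "k+1" "k+2"] mono'[of "k+2" "k+3"] dpos[of "k+1"] dpos[of "k+2"]
        by (auto simp: w_def x_def y_def)
      have D1: "D (k + 1) = D k + (w - 1)" "D (k + 2) = D (k + 1) + (x - 1)"
        using D_Suc[of k] D_Suc[of "k + 1"] by (auto simp: w_def x_def)
      have sx: "D k \<le> x \<or> D (k + 1) \<le> 2 * x + 1"
        using sig'[of "k + 2"] 3 m by (simp add: x_def)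
      have sy: "D (k + 1) \<le> y \<or> D (k + 2) \<le> 2 * y + 1"
        using sig'[of "k + 3"] 3 m by (simp add: y_def)
      \<comment> \<open>In the remaining case x = y the assumption at m yields at worst
        \<open>D (k + 1) \<le> x + 2\<close>, which is at most 2x unless x = 1. If x = 1, all
        earlier degrees are 1 and the sum is 0.\<close>
      have x1: "D (k + 1) = 0" if "x = 1"
      proof -
        have "d j - 1 = 0" if "j \<in> {1..k+1}" for j
          using mono'[of j "k + 2"] that 3 m \<open>x = 1\<close> by (auto simp: x_def)
        then show ?thesis by (simp add: D_def)
      qed
      have "D (k + 1) \<le> x + y"
      proof (cases "x = 1")
        case True
        then show ?thesis using x1 by simp
      next
        case False
        then show ?thesis using sx sy D1 le by linarith
      qed
      then show ?thesis using 3 by (simp add: x_def y_def numeral_3_eq_3 numeral_2_eq_2)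
    qed
  qed
  moreover have "{1..<m - 1} = {1..m - 2}" using m by auto
  ultimately show ?thesis by (simp add: D_def)
qed

lemma mpoly_eval_cong:
  assumes "\<And>m i. m \<in> ks p \<Longrightarrow> i \<in> ks m \<Longrightarrow> c i = c' i"
  shows "mpoly_eval c p = mpoly_eval c' p"
  unfolding mpoly_eval_def by (intro sum.cong refl arg_cong2[of _ _ _ _ "(*)"] prod.cong) (simp add: assms)

lemma alg_indep_subset:
  assumes "alg_indep F B c" "A \<subseteq> B" "\<And>i. i \<in> A \<Longrightarrow> c' i = c i"
  shows "alg_indep F A c'"
  unfolding alg_indep_def
proof (intro allI impI)
  fix p assume p: "\<forall>m. lk p m \<in> F" "\<forall>m\<in>ks p. ks m \<subseteq> A" "mpoly_eval c' p = 0"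
  have "mpoly_eval c p = mpoly_eval c' p"
  proof (rule mpoly_eval_cong)
    fix m i assume "m \<in> ks p" "i \<in> ks m"
    then have "i \<in> A" using p(2) by blast
    then show "c i = c' i" by (simp add: assms(3))
  qed
  moreover have "\<forall>m\<in>ks p. ks m \<subseteq> B" using p(2) assms(2) by blast
  ultimately show "p = 0" using assms(1) p(1,3) unfolding alg_indep_def by simp
qed

locale generic_sequence = generic_forms F n n d f
  for F :: "'k::field set" and n and d and f +
  assumes d_pos: "\<And>i. i \<in> {1..n} \<Longrightarrow> 0 < d i"
    and d_mono: "mono_on {1..n} d"
    and d_sigma: "\<And>i. i \<in> {4..n} \<Longrightarrow> sigma d (i - 1) \<le> int (d i)"
begin

definition fr :: "nat \<Rightarrow> nat \<Rightarrow> 'k mpoly"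
  where "fr r = (\<lambda>i. res r (f i))"

lemma d_le: "1 \<le> i \<Longrightarrow> i \<le> j \<Longrightarrow> j \<le> n \<Longrightarrow> d i \<le> d j"
  using d_mono by (auto simp: mono_on_def)

lemma fr_forms:
  assumes "i \<in> {1..n}"
  shows "fr r i \<in> forms r (d i)"
proof -
  have "f i \<in> forms n (d i)" using keys_f[OF assms] by (simp add: forms_iff)
  then show ?thesis unfolding fr_def by (rule res_forms)
qed

lemma res_fr: "r \<le> m \<Longrightarrow> (\<lambda>i. res r (fr m i)) = fr r"
  by (simp add: fr_def res_res)

text \<open>The coefficients of the restricted forms are a subfamily of the original coefficients,
  so they stay algebraically independent.\<close>

lemma generic_fr:
  assumes "r \<le> n"
  shows "generic_forms F n r d (fr r)"
proof (rule generic_forms.intro)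
  show "alg_indep F (SIGMA i:{1..n}. monomials {1..r} (d i)) (\<lambda>(i, \<mu>). lk (fr r i) \<mu>)"
  proof (rule alg_indep_subset[OF generic])
    show "(SIGMA i:{1..n}. monomials {1..r} (d i)) \<subseteq> (SIGMA i:{1..n}. monomials {1..n} (d i))"
      using assms by (auto simp: monomials_def)
  qed (auto simp: fr_def lookup_res monomials_def)
  show "ks (fr r i) \<subseteq> monomials {1..r} (d i)" if "i \<in> {1..n}" for i
    using fr_forms[OF that] by (simp add: forms_iff)
qed (use subfield infinite_field f_0 in \<open>simp_all add: fr_def\<close>)

text \<open>The first alternative says that the cokernel of x_m is zero in degree e. The second
  records \<open>int e \<le> sigma d m\<close> besides injectivity, because this bound is what later
  keeps f_{m+1}, ..., f_n out of all degrees below e.\<close>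

lemma last_variable_max_rank:
  assumes m: "3 \<le> m" "m \<le> n" and e: "1 \<le> e"
  defines "r \<equiv> m - 1"
  shows "forms r e \<subseteq> idl (fr r) r d m e \<or>
    int e \<le> sigma d m \<and>
    (\<forall>h\<in>forms m (e - 1). xmonom (sg m 1) * h \<in> idl (fr m) m d m e \<longrightarrow> h \<in> idl (fr m) m d m (e - 1))"
proof -
  interpret R: generic_forms F n r d "fr r"
    by (rule generic_fr) (use m in \<open>simp add: r_def\<close>)
  let ?D = "\<Sum>j\<in>{1..<r}. d j - 1"
  have r: "1 \<le> r" "r < m" "r \<le> n" "r \<le> m" using m by (auto simp: r_def)
  have dpos: "\<And>j. j \<in> {1..<r} \<Longrightarrow> 0 < d j" using d_pos r by auto
  have pos: "0 < d r" "0 < d m" using d_pos r m by auto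
  have drm: "d r \<le> d m" using d_le r m by auto
  have D: "?D \<le> d r + d m"
    using degree_bound[OF d_pos d_mono d_sigma m] by (simp add: r_def)
  have Dr: "(\<Sum>j\<in>{1..r}. d j - 1) = ?D + (d r - 1)"
  proof -
    have "{1..r} = insert r {1..<r}" using r by auto
    then show ?thesis by simp
  qed
  have Dm: "(\<Sum>j\<in>{1..m}. d j - 1) = ?D + (d r - 1) + (d m - 1)"
  proof -
    have "{1..m} = insert m {1..r}" using r m by (auto simp: r_def)
    then show ?thesis using r Dr by simp
  qed
  have large: ?thesis if "?D + (d r - 1) < e"
    using R.idl_full_large[of e] that Dr r idl_mono[of r m "fr r" r d e] by auto
  \<comment> \<open>Above \<delta>_r the first r forms alone fill everything. Below, the threshold
    decides between counting and injectivity; in the counting case the bound e \<le> \<delta>_r also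
    yields d_m \<le> e.\<close>
  consider "?D + (d r - 1) < e" | "?D + d r + d m \<le> 2 * e + 1" "e \<le> ?D + (d r - 1)"
    | "2 * e + 1 < ?D + d r + d m" "e \<le> ?D + (d r - 1)" by linarith
  then show ?thesis
  proof cases
    case 1
    then show ?thesis by (rule large)
  next
    case 2
    then have "d m \<le> e" using pos by linarith
    then have "forms r e \<subseteq> idl (fr r) r d m e"
      using R.idl_full[OF r(1,2) m(2) dpos] D drm 2 by simp
    then show ?thesis ..
  next
    case 3
    have "sigma d m = min (int (?D + (d r - 1))) (int (?D + (d r - 1) + (d m - 1)) div 2)"
    proof -
      have "delta d r = int (?D + (d r - 1))"
        unfolding Dr[symmetric] by (rule delta_eq) (use d_pos r in auto)
      moreover have "delta d m = int (?D + (d r - 1) + (d m - 1))"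
        unfolding Dm[symmetric] by (rule delta_eq) (use d_pos m in auto)
      ultimately show ?thesis by (simp add: sigma_def r_def)
    qed
    \<comment> \<open>The strict inequality 2e + 1 < D + d_r + d_m reads 2e \<le> \<delta>_m,
      because \<delta>_m is D + d_r + d_m - 2.\<close>
    moreover have "e \<le> (?D + (d r - 1) + (d m - 1)) div 2" using 3 pos by linarith
    then have "int e \<le> int (?D + (d r - 1) + (d m - 1)) div 2"
      unfolding zdiv_int[of _ 2, simplified, symmetric] by (simp only: of_nat_le_iff)
    moreover have "int e \<le> int (?D + (d r - 1))" using 3 by (simp only: of_nat_le_iff)
    ultimately have "int e \<le> sigma d m" by simp
    moreover have "h \<in> idl (fr m) m d m (e - 1)"
      if h: "h \<in> forms m (e - 1)" "xmonom (sg m 1) * h \<in> idl (fr m) m d m e" for h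
    proof (rule last_variable_injective[OF _ _ _ e h])
      show "fr m i \<in> forms m (d i)" if "i \<in> {1..m}" for i
        using fr_forms that m by auto
      fix i h assume i: "i \<in> {1..m}" "d i \<le> e" "h \<in> forms (m - 1) (e - d i)"
        and hi: "h * res (m - 1) (fr m i) \<in> idl (\<lambda>i. res (m - 1) (fr m i)) (m - 1) d (i - 1) e"
      have res: "(\<lambda>i. res (m - 1) (fr m i)) = fr r" "res (m - 1) (fr m i) = fr r i"
        using res_fr[OF r(4)] by (auto simp: r_def fr_def res_res)
      have "h \<in> idl (fr r) r d (i - 1) (e - d i)"
      proof (cases "i = m")
        case True
        have "h \<in> idl (fr r) r d r (e - d m)"
        proof (rule R.multiplication_injective[OF r(1,2) m(2) dpos drm])
          show "e < d m + d r" "2 * e + 1 \<le> ?D + d r + d m" using 3 D by auto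
          show "h * fr r m \<in> idl (fr r) r d r e"
            using hi True unfolding res by (simp add: r_def)
        qed (use i True in \<open>auto simp: r_def\<close>)
        then show ?thesis using True by (simp add: r_def)
      next
        case False
        show ?thesis
        proof (rule R.regular)
          show "h * fr r i \<in> idl (fr r) r d (i - 1) e"
            using hi unfolding res by (simp add: r_def)
        qed (use i False r in \<open>auto simp: r_def\<close>)
      qed
      then show "h \<in> idl (\<lambda>i. res (m - 1) (fr m i)) (m - 1) d (i - 1) (e - d i)"
        unfolding res by (simp add: r_def)
    qed (use m in auto)
    ultimately show ?thesis by blast
  qed
qed

theorem last_variable_injective_or_surjective:
  assumes m: "1 \<le> m" "m \<le> n" and e: "1 \<le> e"
  shows "forms (m - 1) e \<subseteq> idl (fr (m - 1)) (m - 1) d n e \<or>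
    (\<forall>h\<in>forms m (e - 1). xmonom (sg m 1) * h \<in> idl (fr m) m d n e \<longrightarrow> h \<in> idl (fr m) m d n (e - 1))"
proof -
  consider "m = 1" | "m = 2" | "3 \<le> m" using m by linarith
  then show ?thesis
  proof cases
    case 1
    \<comment> \<open>Without variables there are no nonzero forms of positive degree, so
      surjectivity is trivial.\<close>
    have "monomials {1..0} e = {}" using e by (auto simp: monomials_def mdeg_def)
    then have "forms 0 e = {0 :: 'k mpoly}" by (simp add: forms_def)
    then show ?thesis using 1 by (auto simp: idl_def vs.span_zero)
  next
    case 2
    interpret R: generic_forms F n 1 d "fr 1"
      by (rule generic_fr) (use m in simp)
    show ?thesis
    \<comment> \<open>In one variable f_1 restricts to a nonzero multiple of x_1^{d_1} and fills
      every degree from d_1 on. Below d_1, the smallest degree, the ideal is zero and x_m is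
      injective.\<close>
    proof (cases "d 1 \<le> e")
      case True
      then have "forms 1 e \<subseteq> idl (fr 1) 1 d 1 e"
        using d_pos[of 1] m by (intro R.idl_full_large) auto
      then show ?thesis using 2 m idl_mono[of 1 n "fr 1" 1 d e] by auto
    next
      case False
      have "e < d i" if "i \<in> {1..n}" for i using d_le[of 1 i] that False by auto
      then have "fam m d n e = {}" by (force simp: fam_def)
      then have "h = 0" if "xmonom (sg m 1) * h \<in> idl (fr m) m d n e" for h
        using xmonom_mult_cancel[of "sg m 1" h 0] that by (simp add: idl_def)
      moreover have "0 \<in> idl (fr m) m d n (e - 1)" by (simp add: idl_def vs.span_zero)
      ultimately show ?thesis by blast
    qed
  next
    case 3
    define r where "r = m - 1"
    have r: "r \<le> m" "r \<le> n" using m by (auto simp: r_def)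
    interpret R: generic_forms F n r d "fr r"
      by (rule generic_fr) (use r in simp)
    have x0: "res r (xmonom (sg m 1)) = 0" using m by (auto simp: res_single r_def)
    consider "forms r e \<subseteq> idl (fr r) r d m e" | "int e \<le> sigma d m"
      "\<And>h. h\<in>forms m (e - 1) \<Longrightarrow> xmonom (sg m 1) * h \<in> idl (fr m) m d m e \<Longrightarrow> h \<in> idl (fr m) m d m (e - 1)"
      using last_variable_max_rank[OF 3 m(2) e] unfolding r_def by blast
    then show ?thesis
    proof cases
      case 1
      then show ?thesis using idl_mono[OF m(2), of "fr r" r d e] unfolding r_def by blast
    next
      case 2
      let ?S = "{i. i \<in> {m<..n} \<and> d i = e}"
      \<comment> \<open>This is the point where \<sigma>_m \<le> d_{m+1} is used directly: no later
        form has degree below e.\<close>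
      have ed: "e \<le> d i" if i: "i \<in> {m<..n}" for i
      proof -
        have "sigma d m \<le> int (d (m + 1))" using d_sigma[of "m + 1"] i 3 by simp
        then have "e \<le> d (m + 1)" using 2(1) by linarith
        also have "\<dots> \<le> d i" using d_le[of "m + 1" i] i by simp
        finally show ?thesis .
      qed
      from R.generic_top_forms[OF m(2), of e] show ?thesis
      proof (elim disjE)
        assume "forms r e \<subseteq> idl (fr r) r d n e"
        then show ?thesis by (simp add: r_def)
      next
        assume c: "\<forall>c. (\<Sum>i\<in>?S. scl (c i) (fr r i)) \<in> idl (fr r) r d m e \<longrightarrow> (\<forall>i\<in>?S. c i = 0)"
        have "h \<in> idl (fr m) m d n (e - 1)"
          if h: "h \<in> forms m (e - 1)" "xmonom (sg m 1) * h \<in> idl (fr m) m d n e" for h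
        proof -
          obtain q c' where q: "xmonom (sg m 1) * h = q + (\<Sum>i\<in>?S. scl (c' i) (fr m i))"
              "q \<in> idl (fr m) m d m e"
            by (rule idl_top_split[OF h(2) m(2) ed])
          \<comment> \<open>Modulo x_m the left-hand side disappears, so a combination of the top
            forms lies in the ideal of the first m forms. Genericity makes its scalars vanish, and
            the relation involves only the first m forms.\<close>
          have "0 = res r q + (\<Sum>i\<in>?S. scl (c' i) (fr r i))"
            using arg_cong[OF q(1), of "res r"] r(1)
            by (simp only: res_mult res_add x0 mult_zero_left res_sum res_scl) (simp add: fr_def res_res)
          then have "(\<Sum>i\<in>?S. scl (c' i) (fr r i)) = - res r q" by (simp add: eq_neg_iff_add_eq_0 add.commute)
          moreover have "res r q \<in> idl (fr r) r d m e"
            using res_idl[OF r(1), of "fr m" d m e] q(2) res_fr[OF r(1)] by auto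
          ultimately have "(\<Sum>i\<in>?S. scl (c' i) (fr r i)) \<in> idl (fr r) r d m e"
            by (simp add: idl_def vs.span_neg)
          then have "\<forall>i\<in>?S. c' i = 0" using c by blast
          then have "(\<Sum>i\<in>?S. scl (c' i) (fr m i)) = 0" by (intro sum.neutral) auto
          then have "xmonom (sg m 1) * h \<in> idl (fr m) m d m e" using q by simp
          then show ?thesis using 2(2)[OF h(1)] idl_mono[OF m(2), of "fr m" m d "e - 1"] by blast
        qed
        then show ?thesis by blast
      qed
    qed
  qed
qed

end

subsection \<open>Ideals of the polynomial ring\<close>

lemma mpoly_ring_simps:
  "carrier (mpoly_ring n) = {p. \<forall>\<mu>\<in>ks p. ks \<mu> \<subseteq> {1..n}}"
  "x \<otimes>\<^bsub>mpoly_ring n\<^esub> y = x * y" "x \<oplus>\<^bsub>mpoly_ring n\<^esub> y = x + y"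
  "\<zero>\<^bsub>mpoly_ring n\<^esub> = 0" "\<one>\<^bsub>mpoly_ring n\<^esub> = 1"
  by (simp_all add: mpoly_ring_def ring_of_type_algebra_def)

lemma mpoly_carrier_closed:
  assumes "p \<in> carrier (mpoly_ring n)" "q \<in> carrier (mpoly_ring n)"
  shows "p + q \<in> carrier (mpoly_ring n)" "p * q \<in> carrier (mpoly_ring n)" "- p \<in> carrier (mpoly_ring n)"
proof -
  show "p + q \<in> carrier (mpoly_ring n)"
    using assms keys_add[of p q] unfolding mpoly_ring_simps by blast
  show "p * q \<in> carrier (mpoly_ring n)"
    unfolding mpoly_ring_simps
  proof (intro CollectI ballI)
    fix \<mu> assume "\<mu> \<in> ks (p * q)"
    then obtain a b where "\<mu> = a + b" "a \<in> ks p" "b \<in> ks q" using keys_mult[of p q] by blast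
    then show "ks \<mu> \<subseteq> {1..n}" using assms unfolding mpoly_ring_simps by (auto simp: keys_add_nat)
  qed
  show "- p \<in> carrier (mpoly_ring n)" using assms by (simp add: mpoly_ring_simps)
qed

lemma cring_mpoly_ring: "cring (mpoly_ring n :: 'a::comm_ring_1 mpoly ring)"
proof (rule cringI)
  show "abelian_group (mpoly_ring n :: 'a mpoly ring)"
  proof (rule abelian_groupI)
    fix x :: "'a mpoly" assume "x \<in> carrier (mpoly_ring n)"
    then show "\<exists>y\<in>carrier (mpoly_ring n). y \<oplus>\<^bsub>mpoly_ring n\<^esub> x = \<zero>\<^bsub>mpoly_ring n\<^esub>"
      using mpoly_carrier_closed(3)[of x n x] by (intro bexI[of _ "- x"]) (auto simp: mpoly_ring_simps)
  next
    fix x y :: "'a mpoly" assume "x \<in> carrier (mpoly_ring n)" "y \<in> carrier (mpoly_ring n)"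
    then show "x \<oplus>\<^bsub>mpoly_ring n\<^esub> y \<in> carrier (mpoly_ring n)"
      using mpoly_carrier_closed(1) by (simp add: mpoly_ring_simps(3))
  qed (auto simp: mpoly_ring_simps algebra_simps)
  show "Group.comm_monoid (mpoly_ring n :: 'a mpoly ring)"
  proof (rule comm_monoidI)
    show "\<one>\<^bsub>mpoly_ring n\<^esub> \<in> carrier (mpoly_ring n :: 'a mpoly ring)"
      by (simp add: mpoly_ring_simps)
  next
    fix x y :: "'a mpoly" assume "x \<in> carrier (mpoly_ring n)" "y \<in> carrier (mpoly_ring n)"
    then show "x \<otimes>\<^bsub>mpoly_ring n\<^esub> y \<in> carrier (mpoly_ring n)"
      using mpoly_carrier_closed(2) by (simp add: mpoly_ring_simps(2))
  qed (auto simp: mpoly_ring_simps algebra_simps)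
qed (simp add: mpoly_ring_simps algebra_simps)

lemma ideal_mpoly_ringI:
  assumes "S \<subseteq> carrier (mpoly_ring n)" "0 \<in> S" "\<And>x y. x \<in> S \<Longrightarrow> y \<in> S \<Longrightarrow> x + y \<in> S"
    "\<And>x y. x \<in> S \<Longrightarrow> y \<in> carrier (mpoly_ring n) \<Longrightarrow> y * x \<in> S"
  shows "ideal S (mpoly_ring n :: 'a::comm_ring_1 mpoly ring)"
proof -
  interpret R: cring "mpoly_ring n :: 'a mpoly ring" by (rule cring_mpoly_ring)
  show ?thesis
  proof (rule idealI[OF R.ring_axioms])
    show "subgroup S (add_monoid (mpoly_ring n))"
    proof
      fix x assume x: "x \<in> S"
      have "\<ominus>\<^bsub>mpoly_ring n\<^esub> x = - x"
        using x assms(1) mpoly_carrier_closed(3)[of x n x]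
        by (intro R.minus_equality) (auto simp: mpoly_ring_simps)
      moreover have "(- 1) * x \<in> S"
        by (rule assms(4)[OF x]) (simp add: mpoly_ring_simps)
      ultimately show "inv\<^bsub>add_monoid (mpoly_ring n)\<^esub> x \<in> S" by (simp add: a_inv_def)
    qed (use assms in \<open>auto simp: mpoly_ring_simps\<close>)
  qed (use assms in \<open>auto simp: mpoly_ring_simps mult.commute\<close>)
qed

section \<open>Homogeneous components and graded pieces\<close>

definition hcomp :: "nat \<Rightarrow> 'a::comm_ring_1 mpoly \<Rightarrow> 'a mpoly"
  where "hcomp e p = (\<Sum>\<mu> | \<mu> \<in> ks p \<and> mdeg \<mu> = e. sg \<mu> (lk p \<mu>))"

lemma lookup_hcomp: "lk (hcomp e p) \<mu> = (if mdeg \<mu> = e then lk p \<mu> else 0)"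
proof -
  have "lk (hcomp e p) \<mu> = (\<Sum>\<nu> | \<nu> \<in> ks p \<and> mdeg \<nu> = e. if \<nu> = \<mu> then lk p \<mu> else 0)"
    unfolding hcomp_def lookup_sum by (intro sum.cong) (auto simp: lookup_single when_def)
  then show ?thesis by (auto simp: in_keys_iff)
qed

lemma keys_hcomp: "ks (hcomp e p) = {\<mu> \<in> ks p. mdeg \<mu> = e}"
proof (rule Set.set_eqI)
  fix \<mu>
  show "\<mu> \<in> ks (hcomp e p) \<longleftrightarrow> \<mu> \<in> {\<mu> \<in> ks p. mdeg \<mu> = e}"
    using in_keys_iff[of \<mu> "hcomp e p"] in_keys_iff[of \<mu> p] by (auto simp: lookup_hcomp)
qed

lemma hcomp_add: "hcomp e (p + q) = hcomp e p + hcomp e q"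
  by (rule poly_mapping_eqI) (simp add: lookup_hcomp lookup_add)

lemma hcomp_sum: "hcomp e (sum g S) = (\<Sum>x\<in>S. hcomp e (g x))"
  by (induction S rule: infinite_finite_induct)
    (auto simp: hcomp_add intro!: poly_mapping_eqI simp: lookup_hcomp)

lemma hcomp_monom_mult:
  "hcomp e (sg k v * p) = (if mdeg k \<le> e then sg k v * hcomp (e - mdeg k) p else 0)"
proof (rule poly_mapping_eqI)
  fix \<mu>
  show "lk (hcomp e (sg k v * p)) \<mu> = lk (if mdeg k \<le> e then sg k v * hcomp (e - mdeg k) p else 0) \<mu>"
  proof (cases "\<exists>\<kappa>. \<mu> = k + \<kappa>")
    case True
    then obtain \<kappa> where "\<mu> = k + \<kappa>" ..
    then show ?thesis by (auto simp: lookup_hcomp lookup_monom_mult)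
  next
    case False
    then show ?thesis using lookup_monom_mult_eq_0[of \<mu> k v] by (auto simp: lookup_hcomp)
  qed
qed

lemma hcomp_homogeneous: "p \<in> forms n d \<Longrightarrow> hcomp e p = (if e = d then p else 0)"
  by (rule poly_mapping_eqI) (auto simp: lookup_hcomp forms_iff monomials_def in_keys_iff)

lemma forms_carrier: "p \<in> forms n e \<Longrightarrow> p \<in> carrier (mpoly_ring n)"
  unfolding forms_iff mpoly_ring_simps monomials_def by blast

lemma idl_subset_genideal:
  assumes f: "\<And>i. i \<in> {1..k} \<Longrightarrow> f i \<in> forms n (d i)"
  shows "idl f n d k e \<subseteq> Idl\<^bsub>mpoly_ring n\<^esub> (f ` {1..k})"
proof
  interpret R: cring "mpoly_ring n :: 'a mpoly ring" by (rule cring_mpoly_ring)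
  let ?I = "Idl\<^bsub>mpoly_ring n\<^esub> (f ` {1..k})"
  have sub: "f ` {1..k} \<subseteq> carrier (mpoly_ring n)"
    using f forms_carrier by blast
  interpret I: ideal ?I "mpoly_ring n" by (rule R.genideal_ideal[OF sub])
  have l: "y * x \<in> ?I" if "x \<in> ?I" "y \<in> carrier (mpoly_ring n)" for x y
    using I.I_l_closed[OF that] by (simp add: mpoly_ring_simps)
  fix p assume "p \<in> idl f n d k e"
  then have "p \<in> vs.span (wm f ` fam n d k e)" by (simp add: idl_def)
  then show "p \<in> ?I"
  proof (induction p rule: vs.span_induct_alt)
    case base
    show ?case using I.zero_closed by (simp add: mpoly_ring_simps)
  next
    case (step c x y)
    then obtain j \<alpha> where j: "x = xmonom \<alpha> * f j" "j \<in> {1..k}" "ks \<alpha> \<subseteq> {1..n}"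
      by (auto simp: wm_def fam_def monomials_def)
    have "f j \<in> ?I" using R.genideal_self[OF sub] j by blast
    then have "x \<in> ?I" unfolding j(1) by (rule l) (use j in \<open>simp add: mpoly_ring_simps\<close>)
    then have "scl c x \<in> ?I" unfolding scl_def by (rule l) (simp add: mpoly_ring_simps)
    then show ?case using I.a_closed[OF _ step(2)] by (simp add: mpoly_ring_simps)
  qed
qed

text \<open>The polynomials all of whose components lie in the graded pieces form an ideal that
  contains the generators. With \<open>idl_subset_genideal\<close> this identifies
  \<open>idl\<close> as the degree e part of the generated ideal.\<close>

lemma hcomp_genideal:
  fixes f :: "nat \<Rightarrow> 'a::field mpoly"
  assumes f: "\<And>i. i \<in> {1..k} \<Longrightarrow> f i \<in> forms n (d i)" and p: "p \<in> Idl\<^bsub>mpoly_ring n\<^esub> (f ` {1..k})"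
  shows "hcomp e p \<in> idl f n d k e"
proof -
  interpret R: cring "mpoly_ring n :: 'a mpoly ring" by (rule cring_mpoly_ring)
  let ?J = "{p \<in> carrier (mpoly_ring n). \<forall>e. hcomp e p \<in> idl f n d k e}"
  have zero: "0 \<in> idl f n d k e" for e by (simp add: idl_def vs.span_zero)
  have "ideal ?J (mpoly_ring n)"
  proof (rule ideal_mpoly_ringI)
    show "0 \<in> ?J" using zero by (simp add: hcomp_def mpoly_ring_simps)
    show "x + y \<in> ?J" if "x \<in> ?J" "y \<in> ?J" for x y
      using that mpoly_carrier_closed(1)[of x n y] by (auto simp: hcomp_add idl_def vs.span_add)
    show "y * x \<in> ?J" if x: "x \<in> ?J" and y: "y \<in> carrier (mpoly_ring n)" for x y
    proof -
      have "hcomp e (y * x) \<in> idl f n d k e" for e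
      proof -
        have "y * x = (\<Sum>\<kappa>\<in>ks y. sg \<kappa> (lk y \<kappa>) * x)"
          by (subst poly_mapping_expand[of y]) (rule sum_distrib_right)
        moreover have "hcomp e (sg \<kappa> (lk y \<kappa>) * x) \<in> idl f n d k e" if \<kappa>: "\<kappa> \<in> ks y" for \<kappa>
        proof (cases "mdeg \<kappa> \<le> e")
          case True
          have "sg \<kappa> (lk y \<kappa>) \<in> forms n (mdeg \<kappa>)"
            using \<kappa> y by (auto simp: forms_iff monomials_def mpoly_ring_simps)
          from idl_mult[OF this, of "hcomp (e - mdeg \<kappa>) x" f d k "e - mdeg \<kappa>"]
          show ?thesis using x True by (simp add: hcomp_monom_mult)
        qed (simp add: hcomp_monom_mult zero)
        ultimately show ?thesis unfolding idl_def by (simp only: hcomp_sum) (rule vs.span_sum)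
      qed
      then show ?thesis using mpoly_carrier_closed(2)[OF y, of x] x by simp
    qed
  qed auto
  moreover have "f ` {1..k} \<subseteq> ?J"
  proof (rule image_subsetI)
    fix i assume i: "i \<in> {1..k}"
    have "f i \<in> carrier (mpoly_ring n)"
      using f[OF i] by (rule forms_carrier)
    moreover have "f i \<in> idl f n d k (d i)"
      using idl_gen_mult[of i k 1 n "d i" d f] i by (auto simp: forms_iff monomials_def)
    ultimately show "f i \<in> ?J" using zero by (auto simp: hcomp_homogeneous[OF f[OF i]])
  qed
  ultimately have "Idl\<^bsub>mpoly_ring n\<^esub> (f ` {1..k}) \<subseteq> ?J" by (rule R.genideal_minimal)
  then show ?thesis using p by blast
qed

subsection \<open>Leading monomials\<close>

lemma drl_less_irrefl: "\<not> drl_less \<alpha> \<alpha>"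
  by (simp add: drl_less_def)

lemma drl_less_trans:
  assumes "drl_less \<alpha> \<beta>" "drl_less \<beta> \<gamma>"
  shows "drl_less \<alpha> \<gamma>"
proof (cases "mdeg \<alpha> < mdeg \<gamma>")
  case False
  then have deg: "mdeg \<alpha> = mdeg \<beta>" "mdeg \<beta> = mdeg \<gamma>" using assms by (auto simp: drl_less_def)
  then obtain i j where i: "lk \<alpha> i > lk \<beta> i" "\<And>l. l > i \<Longrightarrow> lk \<alpha> l = lk \<beta> l"
    and j: "lk \<beta> j > lk \<gamma> j" "\<And>l. l > j \<Longrightarrow> lk \<beta> l = lk \<gamma> l"
    using assms by (auto simp: drl_less_def)
  have "lk \<alpha> (max i j) > lk \<gamma> (max i j)"
    using i(1) j(1) i(2)[of j] j(2)[of i] by (cases i j rule: linorder_cases) (auto simp: max_def)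
  moreover have "lk \<alpha> l = lk \<gamma> l" if "l > max i j" for l using i(2) j(2) that by simp
  ultimately show ?thesis using deg by (auto simp: drl_less_def)
qed (simp add: drl_less_def)

lemma drl_less_total:
  assumes "\<alpha> \<noteq> \<beta>"
  shows "drl_less \<alpha> \<beta> \<or> drl_less \<beta> \<alpha>"
proof (cases "mdeg \<alpha> = mdeg \<beta>")
  case True
  let ?D = "{i. lk \<alpha> i \<noteq> lk \<beta> i}"
  have "?D \<subseteq> ks \<alpha> \<union> ks \<beta>"
  proof
    fix i assume "i \<in> ?D"
    then show "i \<in> ks \<alpha> \<union> ks \<beta>" by (cases "lk \<alpha> i = 0") (simp_all add: in_keys_iff)
  qed
  then have fin: "finite ?D" by (rule finite_subset) simp
  have "?D \<noteq> {}"
  proof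
    assume "?D = {}"
    then have "\<alpha> = \<beta>" by (intro poly_mapping_eqI) blast
    then show False using assms by simp
  qed
  then have M: "Max ?D \<in> ?D" using fin by (intro Max_in)
  have "lk \<alpha> j = lk \<beta> j" if "j > Max ?D" for j
    using Max_ge[OF fin, of j] that by (meson CollectI not_less)
  then show ?thesis using M True unfolding drl_less_def by (metis (mono_tags, lifting) linorder_neqE_nat mem_Collect_eq)
qed (auto simp: drl_less_def)

lemma drl_less_add_cancel: "drl_less (\<kappa> + \<alpha>) (\<kappa> + \<beta>) \<longleftrightarrow> drl_less \<alpha> \<beta>"
  by (simp add: drl_less_def lookup_add)

text \<open>The feature of the reverse lexicographic order on which the reduction rests: at equal
  degree, every monomial with a variable beyond x_m is smaller than every monomial without
  one.\<close>

lemma drl_less_if_later_variable: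
  assumes "mdeg \<nu> = mdeg \<kappa>" "ks \<kappa> \<subseteq> {1..m}" "ks \<nu> \<subseteq> {1..n}" "\<not> ks \<nu> \<subseteq> {1..m}"
  shows "drl_less \<nu> \<kappa>"
proof -
  obtain j where j: "j \<in> ks \<nu>" "j > m" using assms(3,4) by force
  let ?i = "Max (ks \<nu>)"
  have i: "?i \<in> ks \<nu>" by (rule Max_in) (use j in auto)
  have im: "?i > m" using j Max_ge[OF finite_keys j(1)] by linarith
  have k0: "lk \<kappa> l = 0" if "l > m" for l
  proof -
    have "l \<notin> ks \<kappa>" using assms(2) that by auto
    then show ?thesis by (simp add: in_keys_iff)
  qed
  have n0: "lk \<nu> l = 0" if "l > ?i" for l
  proof -
    have "l \<notin> ks \<nu>" using that Max_ge[OF finite_keys[of \<nu>]] by (meson leD)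
    then show ?thesis by (simp add: in_keys_iff)
  qed
  have "lk \<nu> ?i > lk \<kappa> ?i" using i k0[OF im] by (simp add: in_keys_iff)
  moreover have "lk \<nu> l = lk \<kappa> l" if "l > ?i" for l using n0[OF that] k0[of l] that im by simp
  ultimately show ?thesis using assms(1) by (auto simp: drl_less_def)
qed

text \<open>A relation in place of the description operator: it also asserts that a leading exponent
  exists, and so that the polynomial is nonzero.\<close>

definition leads :: "'a::zero mpoly \<Rightarrow> expo \<Rightarrow> bool"
  where "leads p \<mu> \<longleftrightarrow> \<mu> \<in> ks p \<and> (\<forall>\<nu>\<in>ks p. \<nu> \<noteq> \<mu> \<longrightarrow> drl_less \<nu> \<mu>)"

lemma lead_expo_eq:
  assumes "leads p \<mu>"
  shows "lead_expo p = \<mu>"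
  unfolding lead_expo_def
proof (rule the_equality)
  show "\<mu> \<in> ks p \<and> (\<forall>\<nu>\<in>ks p. \<nu> \<noteq> \<mu> \<longrightarrow> drl_less \<nu> \<mu>)"
    using assms by (simp add: leads_def)
  fix \<nu> assume \<nu>: "\<nu> \<in> ks p \<and> (\<forall>\<kappa>\<in>ks p. \<kappa> \<noteq> \<nu> \<longrightarrow> drl_less \<kappa> \<nu>)"
  show "\<nu> = \<mu>"
  proof (rule ccontr)
    assume "\<nu> \<noteq> \<mu>"
    then have "drl_less \<nu> \<mu>" "drl_less \<mu> \<nu>" using \<nu> assms by (simp_all add: leads_def)
    then show False using drl_less_trans drl_less_irrefl by blast
  qed
qed

lemma leads_lead_expo:
  assumes "p \<noteq> 0"
  shows "leads p (lead_expo p)"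
proof -
  have "\<exists>\<mu>\<in>S. \<forall>\<nu>\<in>S. \<nu> \<noteq> \<mu> \<longrightarrow> drl_less \<nu> \<mu>" if "finite S" "S \<noteq> {}" for S
    using that
  proof (induction S rule: finite_ne_induct)
    case (insert x S)
    then obtain \<mu> where m: "\<mu> \<in> S" "\<And>\<nu>. \<nu> \<in> S \<Longrightarrow> \<nu> \<noteq> \<mu> \<Longrightarrow> drl_less \<nu> \<mu>" by auto
    then have "x \<noteq> \<mu>" using insert by auto
    then consider "drl_less x \<mu>" | "drl_less \<mu> x" using drl_less_total by blast
    then show ?case
    proof cases
      case 1
      then show ?thesis using m by auto
    next
      case 2
      then have "drl_less \<nu> x" if "\<nu> \<in> S" for \<nu>
        using m(2)[OF that] drl_less_trans by (cases "\<nu> = \<mu>") auto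
      then show ?thesis by auto
    qed
  qed simp
  moreover have "ks p \<noteq> {}"
    using assms by (metis in_keys_iff empty_iff lookup_zero poly_mapping_eqI)
  ultimately obtain \<mu> where "leads p \<mu>" unfolding leads_def by (meson finite_keys)
  then show ?thesis using lead_expo_eq by metis
qed

lemma leads_monom_mult: "leads (xmonom \<alpha> * p) (\<alpha> + \<mu>) \<longleftrightarrow> leads p \<mu>" for p :: "'a::comm_ring_1 mpoly"
proof -
  have "ks (xmonom \<alpha> * p) = (+) \<alpha> ` ks p"
  proof
    show "(+) \<alpha> ` ks p \<subseteq> ks (xmonom \<alpha> * p)"
      using lookup_monom_mult[of \<alpha> 1 p] by (auto simp: in_keys_iff)
  qed (rule keys_monom_mult)
  then show ?thesis by (auto simp: leads_def drl_less_add_cancel)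
qed

text \<open>Restriction discards only monomials with later variables, and these lie below every
  monomial that is kept.\<close>

lemma leads_if_restriction_leads:
  assumes p: "p \<in> forms n e" and m: "leads (res m p) \<mu>"
  shows "leads p \<mu>"
  unfolding leads_def
proof (intro conjI ballI impI)
  have \<mu>: "\<mu> \<in> ks p" "ks \<mu> \<subseteq> {1..m}" using m by (auto simp: leads_def keys_res)
  show "\<mu> \<in> ks p" by (rule \<mu>)
  fix \<nu> assume n: "\<nu> \<in> ks p" "\<nu> \<noteq> \<mu>"
  show "drl_less \<nu> \<mu>"
  proof (cases "ks \<nu> \<subseteq> {1..m}")
    case True
    then show ?thesis using n m by (auto simp: leads_def keys_res)
  next
    case False
    have "\<nu> \<in> monomials {1..n} e" "\<mu> \<in> monomials {1..n} e" using p n \<mu> by (auto simp: forms_iff)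
    then show ?thesis
      using drl_less_if_later_variable[OF _ \<mu>(2) _ False, of n] by (auto simp: monomials_def)
  qed
qed

context
  fixes f :: "nat \<Rightarrow> 'a::field mpoly" and n k :: nat and d :: "nat \<Rightarrow> nat" and I :: "'a mpoly set"
  assumes f: "\<And>i. i \<in> {1..k} \<Longrightarrow> f i \<in> forms n (d i)"
    and I: "I = Idl\<^bsub>mpoly_ring n\<^esub> (f ` {1..k})"
begin

lemma I_carrier: "I \<subseteq> carrier (mpoly_ring n)"
proof -
  interpret R: cring "mpoly_ring n :: 'a mpoly ring" by (rule cring_mpoly_ring)
  have "f ` {1..k} \<subseteq> carrier (mpoly_ring n)"
    using f forms_carrier by blast
  then interpret ideal I "mpoly_ring n" unfolding I by (rule R.genideal_ideal)
  show ?thesis by (rule a_subset)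
qed

lemma lead_expos_carrier: "{xmonom (lead_expo p) | p. p \<in> I \<and> p \<noteq> 0} \<subseteq> carrier (mpoly_ring n)"
  using I_carrier leads_lead_expo by (fastforce simp: mpoly_ring_simps leads_def)

lemma initial_ideal_monomialI:
  assumes "p \<in> idl f n d k e" "leads p \<mu>"
  shows "xmonom \<mu> \<in> initial_ideal n I"
proof -
  interpret R: cring "mpoly_ring n :: 'a mpoly ring" by (rule cring_mpoly_ring)
  have "p \<in> I" using idl_subset_genideal[where f = f and k = k and d = d, OF f] assms(1) unfolding I by blast
  moreover have "p \<noteq> 0" using assms(2) by (auto simp: leads_def)
  ultimately show ?thesis
    using R.genideal_self[OF lead_expos_carrier] lead_expo_eq[OF assms(2)]
    unfolding initial_ideal_def by blast
qed

text \<open>Multiplication by a monomial shifts leading exponents, so the polynomials supported on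
  leading exponents of homogeneous elements form an ideal. It contains the generators of the initial
  ideal, since the component of p in the degree of its leading monomial has the same leading
  monomial.\<close>

lemma initial_ideal_monomialD:
  assumes "xmonom \<mu> \<in> initial_ideal n I"
  obtains p where "p \<in> idl f n d k (mdeg \<mu>)" "leads p \<mu>"
proof -
  interpret R: cring "mpoly_ring n :: 'a mpoly ring" by (rule cring_mpoly_ring)
  let ?L = "{\<mu>. \<exists>p \<in> idl f n d k (mdeg \<mu>). leads p \<mu>}"
  let ?J = "{q \<in> carrier (mpoly_ring n). ks q \<subseteq> ?L} :: 'a mpoly set"
  have "ideal ?J (mpoly_ring n)"
  proof (rule ideal_mpoly_ringI)
    show "x + y \<in> ?J" if "x \<in> ?J" "y \<in> ?J" for x y
      using that mpoly_carrier_closed(1)[of x n y] keys_add[of x y] by blast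
    show "y * x \<in> ?J" if x: "x \<in> ?J" and y: "y \<in> carrier (mpoly_ring n)" for x y
    proof -
      have "ks (y * x) \<subseteq> ?L"
      proof
        fix \<mu> assume "\<mu> \<in> ks (y * x)"
        then obtain a b where ab: "\<mu> = a + b" "a \<in> ks y" "b \<in> ks x" using keys_mult[of y x] by blast
        obtain p where p: "p \<in> idl f n d k (mdeg b)" "leads p b" using x ab(3) by blast
        have "xmonom a \<in> forms n (mdeg a)"
          using y ab(2) by (auto simp: forms_iff monomials_def mpoly_ring_simps)
        from idl_mult[OF this p(1)] have "xmonom a * p \<in> idl f n d k (mdeg \<mu>)"
          by (simp add: ab(1) add.commute)
        moreover have "leads (xmonom a * p) \<mu>" using p(2) by (simp add: ab(1) leads_monom_mult)
        ultimately show "\<mu> \<in> ?L" by blast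
      qed
      then show ?thesis using mpoly_carrier_closed(2)[OF y, of x] x by simp
    qed
  qed (auto simp: mpoly_ring_simps)
  moreover have "{xmonom (lead_expo p) | p. p \<in> I \<and> p \<noteq> 0} \<subseteq> ?J"
  proof
    fix x :: "'a mpoly" assume x: "x \<in> {xmonom (lead_expo p) | p. p \<in> I \<and> p \<noteq> 0}"
    then obtain p where p: "x = xmonom (lead_expo p)" "p \<in> I" "p \<noteq> 0" by blast
    let ?\<mu> = "lead_expo p"
    have l: "leads p ?\<mu>" by (rule leads_lead_expo[OF p(3)])
    have "hcomp (mdeg ?\<mu>) p \<in> idl f n d k (mdeg ?\<mu>)"
      using hcomp_genideal[where f = f and k = k and d = d, OF f] p(2) unfolding I by blast
    moreover have "leads (hcomp (mdeg ?\<mu>) p) ?\<mu>"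
      using l by (simp add: leads_def keys_hcomp)
    ultimately have "?\<mu> \<in> ?L" by blast
    then show "x \<in> ?J" using x lead_expos_carrier p(1) by auto
  qed
  ultimately have "initial_ideal n I \<subseteq> ?J"
    unfolding initial_ideal_def by (rule R.genideal_minimal)
  then have "ks (xmonom \<mu> :: 'a mpoly) \<subseteq> ?L" using assms by blast
  then have "\<mu> \<in> ?L" by simp
  then show ?thesis using that by blast
qed

end

section \<open>From minimal generators to multiplication by the last variable\<close>

theorem theorem1:
  fixes F :: "'k::field set"
    and n :: nat
    and d :: "nat \<Rightarrow> nat"
    and I :: "'k mpoly set"
  assumes "infinite (UNIV :: 'k set)"
    and "subfield F (ring_of_type_algebra :: 'k ring)"
    and "n \<ge> 4"
    and "\<And>i. i \<in> {1..n} \<Longrightarrow> d i > 0"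
    and "mono_on {1..n} d"
    and "generic_ideal F n n d I"
    and "\<And>i. i \<in> {4..n} \<Longrightarrow> int (d i) \<ge> sigma d (i - 1)"
  shows "\<forall>\<mu> m e. min_generator (initial_ideal n I) \<mu> \<and>
           m = Max (Poly_Mapping.keys \<mu>) \<and> e = mdeg \<mu> \<longrightarrow>
           (\<forall>\<nu>\<in>monomials {1..<m} e. xmonom \<nu> \<in> initial_ideal n I)"
proof (intro allI impI ballI, elim conjE)
  fix \<mu> m e \<nu>
  assume min: "min_generator (initial_ideal n I) \<mu>" and m: "m = Max (ks \<mu>)" and e: "e = mdeg \<mu>"
    and \<nu>: "\<nu> \<in> monomials {1..<m} e"
  obtain f0 where f0: "\<And>i. i \<in> {1..n} \<Longrightarrow> generic_form F n (d i) (f0 i)"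
      "alg_indep F (SIGMA i:{1..n}. monomials {1..n} (d i)) (\<lambda>(i, \<mu>). lk (f0 i) \<mu>)"
      "I = Idl\<^bsub>mpoly_ring n\<^esub> (f0 ` {1..n})"
    using assms(6) unfolding generic_ideal_def by blast
  define f where "f = f0(0 := 1)"
  have I: "I = Idl\<^bsub>mpoly_ring n\<^esub> (f ` {1..n})"
  proof -
    have "f ` {1..n} = f0 ` {1..n}" by (rule image_cong) (auto simp: f_def)
    then show ?thesis using f0(3) by simp
  qed
  have keys: "ks (f i) \<subseteq> monomials {1..n} (d i)" if "i \<in> {1..n}" for i
    using f0(1)[OF that] that by (auto simp: f_def generic_form_def)
  interpret generic_sequence F n d f
  proof (intro generic_sequence.intro generic_forms.intro generic_sequence_axioms.intro)
    show "alg_indep F (SIGMA i:{1..n}. monomials {1..n} (d i)) (\<lambda>(i, \<mu>). lk (f i) \<mu>)"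
      by (rule alg_indep_subset[OF f0(2)]) (auto simp: f_def)
  qed (use assms keys in \<open>simp_all add: f_def\<close>)
  have forms: "f i \<in> forms n (d i)" if "i \<in> {1..n}" for i
    using keys[OF that] by (simp add: forms_iff)
  note inI = initial_ideal_monomialI[where f = f and d = d and k = n, OF forms I]
  have "xmonom \<mu> \<in> initial_ideal n I" using min by (simp add: min_generator_def)
  then obtain p where p: "p \<in> idl f n d n e" "leads p \<mu>"
    using initial_ideal_monomialD[where f = f and d = d and k = n, OF forms I] unfolding e by blast
  have idl_n: "idl f n d n e' \<subseteq> forms n e'" for e'
    by (rule idl_forms) (rule keys)
  have p_forms: "p \<in> forms n e" using p(1) idl_n by blast
  have \<mu>: "\<mu> \<in> ks p" "ks \<mu> \<subseteq> {1..n}"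
    using p(2) p_forms by (auto simp: leads_def forms_iff monomials_def)
  \<comment> \<open>Positive degrees keep constants out of the ideal. Hence \<open>\<mu>\<close> is
    not 0 and the maximum defining \<open>m\<close> is taken over a nonempty set.\<close>
  have e1: "1 \<le> e"
  proof (rule ccontr)
    assume "\<not> 1 \<le> e"
    then have "fam n d n e = {}" using assms(4) by (force simp: fam_def)
    then have "p = 0" using p(1) by (simp add: idl_def)
    then show False using \<mu>(1) by simp
  qed
  then have "ks \<mu> \<noteq> {}" unfolding e mdeg_def by auto
  then have m_key: "m \<in> ks \<mu>" and m_max: "ks \<mu> \<subseteq> {1..m}"
    using \<mu>(2) by (auto simp: m)
  have mn: "1 \<le> m" "m \<le> n" using m_key \<mu>(2) by auto
  have lift: "\<exists>q \<in> idl f n d n e'. res r q = h" if "h \<in> idl (fr r) r d n e'" "r \<le> n" for r e' h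
    using that(1) unfolding fr_def res_idl[OF that(2), symmetric] by blast
  \<comment> \<open>A lift of x^\<nu> to the ideal restricts to this single monomial, which is
    therefore the leading monomial of the lift.\<close>
  have surj: "(xmonom \<nu> :: 'k mpoly) \<in> initial_ideal n I" if s: "forms (m - 1) e \<subseteq> idl (fr (m - 1)) (m - 1) d n e"
  proof -
    have "{1..<m} = {1..m - 1}" by auto
    then have "(xmonom \<nu> :: 'k mpoly) \<in> forms (m - 1) e" using \<nu> by (simp add: xmonom_forms)
    then obtain q where q: "q \<in> idl f n d n e" "res (m - 1) q = xmonom \<nu>"
      using s lift[of "xmonom \<nu>" "m - 1" e] mn by force
    have "leads (res (m - 1) q) \<nu>" unfolding q(2) by (simp add: leads_def)
    then have "leads q \<nu>" using leads_if_restriction_leads q(1) idl_n by blast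
    then show ?thesis using inI q(1) by blast
  qed
  have res_p: "leads (res m p) \<mu>" "res m p \<in> forms m e"
    using p(2) m_max res_forms[OF p_forms] by (auto simp: leads_def keys_res)
  \<comment> \<open>A monomial of the restricted polynomial without x_m would exceed the leading
    monomial, which contains x_m. So x_m divides the whole restriction of \<open>p\<close>.\<close>
  have "res (m - 1) (res m p) = 0"
  proof (rule poly_mapping_eqI)
    fix \<kappa>
    have nsub: "\<not> ks \<kappa> \<subseteq> {1..m - 1}" if \<kappa>: "\<kappa> \<in> ks (res m p)"
    proof
      assume sub: "ks \<kappa> \<subseteq> {1..m - 1}"
      have mk: "m \<notin> ks \<kappa>" using sub mn by auto
      then have "\<kappa> \<noteq> \<mu>" using m_key by auto
      then have "drl_less \<kappa> \<mu>" using res_p(1) \<kappa> by (auto simp: leads_def)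
      moreover have "drl_less \<mu> \<kappa>"
      proof (rule drl_less_if_later_variable[OF _ sub \<mu>(2)])
        show "mdeg \<mu> = mdeg \<kappa>" using \<kappa> res_p(2) e by (auto simp: forms_iff monomials_def)
        show "\<not> ks \<mu> \<subseteq> {1..m - 1}" using m_key mn by auto
      qed
      ultimately show False using drl_less_trans drl_less_irrefl by blast
    qed
    show "lk (res (m - 1) (res m p)) \<kappa> = lk 0 \<kappa>"
    proof (cases "\<kappa> \<in> ks (res m p)")
      case True
      then show ?thesis unfolding lookup_res[of "m - 1"] using nsub by simp
    next
      case False
      then show ?thesis unfolding lookup_res[of "m - 1"] by (simp add: in_keys_iff)
    qed
  qed
  then obtain h where h: "res m p = xmonom (sg m 1) * h" "h \<in> forms m (e - 1)"
    using divisible_by_last[OF mn(1) res_p(2)] by blast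
  have "lk (sg m 1) i \<le> lk \<mu> i" for i
    using m_key by (auto simp: lookup_single when_def in_keys_iff)
  then have \<kappa>: "sg m 1 + (\<mu> - sg m 1) = \<mu>" by (rule expo_diff(1))
  then have lead_h: "leads h (\<mu> - sg m 1)"
    using res_p(1) leads_monom_mult[of "sg m 1" h "\<mu> - sg m 1"] unfolding h(1) by simp
  \<comment> \<open>Otherwise a lift of \<open>h\<close> would put x^\<mu> / x_m into the initial
    ideal, against the minimality of x^\<mu>. Thus \<open>h\<close> witnesses that x_m is not
    injective.\<close>
  have not_mem: "h \<notin> idl (fr m) m d n (e - 1)"
  proof
    assume "h \<in> idl (fr m) m d n (e - 1)"
    then obtain q where q: "q \<in> idl f n d n (e - 1)" "res m q = h" using lift mn by blast
    then have "leads q (\<mu> - sg m 1)"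
      using leads_if_restriction_leads[of q n "e - 1" m] lead_h idl_n by blast
    then have "xmonom (\<mu> - sg m 1) \<in> initial_ideal n I" using inI q(1) by blast
    moreover have "lk (\<mu> - sg m 1) i \<le> lk \<mu> i" for i
      by (simp add: lookup_minus)
    ultimately have "\<mu> - sg m 1 = \<mu>" using min unfolding min_generator_def by blast
    then show False using arg_cong[OF \<kappa>, of mdeg] by simp
  qed
  have "xmonom (sg m 1) * h \<in> idl (fr m) m d n e"
    using res_idl[OF mn(2), of f d n e] p(1) unfolding h(1)[symmetric] fr_def by blast
  then show "xmonom \<nu> \<in> initial_ideal n I"
    using last_variable_injective_or_surjective[OF mn e1] surj h(2) not_mem by blast
qed

end
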